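(* Let $t\in\mathbb R$ and let $v_t=\frac{1+t}{4}(u_{11}+u_{22})+\frac{1-t}{4}(u_{33}+u_{44})\in A_s(4)$, where $u=(u_{ij})$ is the fundamental corepresentation of $A_s(4)$. The Cauchy transform $G$ of the law of $v_t$ has derivative given (for $\xi\in\mathbb C$ with $|\xi|$ sufficiently large) by $$G'(\xi)=\frac12\cdot\frac{2\xi-1}{\xi^2-\xi^3}\sqrt{\frac{\xi-\xi^2}{\xi-\xi^2-(1-t^2)/4}}.$$
   Context: A magic unitary over a $C^*$-algebra $A$ is a square matrix over $A$ whose entries are projections, such that on each row and on each column the entries are pairwise orthogonal and sum up to $1$. $A_s(4)$ is the universal $C^*$-algebra generated by $16$ elements $u_{ij}$ ($1\le i,j\le 4$) with the relations making $u=(u_{ij})$ a magic unitary matrix. It is a Hopf algebra in the sense of Woronowicz, with comultiplication $\Delta(u_{ij})=\sum_k u_{ik}\otimes u_{kj}$. Let $\int:A_s(4)\to\mathbb C$ be its Haar functional, i.e. the unique state which is left and right invariant with respect to $\Delta$. The law of a self-adjoint element $a\in A_s(4)$ is the unique compactly supported probability measure on $\mathbb R$ whose $k$-th moment is $\int a^k$, for all $k\ge 0$. The Cauchy transform of a compactly supported probability measure $\mu$ is $G(\xi)=\int\frac{d\mu(y)}{\xi-y}=\sum_{k\ge0}\xi^{-k-1}\int y^k\,d\mu(y)$ (the series for $|\xi|$ large). The square root is the analytic branch near $\xi=\infty$ which tends to $1$ as $\xi\to\infty$ (the quantity under the root tends to $1$). *)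

theory Defs
  imports "HOL-Probability.Probability" "HOL-Algebra.Module"
begin

text \<open>
  Unital complex C*-algebras, with explicit carriers so that one can quantify over all of them
  inside a formula (this is needed for universal properties). The ring operations and the scalar
  multiplication are those of HOL-Algebra.
\<close>

record 'a cstar_struct = "(complex, 'a) module" +
  star :: "'a \<Rightarrow> 'a"
  nrm :: "'a \<Rightarrow> real"

locale cstar_algebra = ring A for A :: "'a cstar_struct" (structure) +
  assumes smult_closed: "x \<in> carrier A \<Longrightarrow> c \<odot> x \<in> carrier A"
    and smult_add_right: "\<lbrakk>x \<in> carrier A; y \<in> carrier A\<rbrakk> \<Longrightarrow> c \<odot> (x \<oplus> y) = c \<odot> x \<oplus> c \<odot> y"
    and smult_add_left: "x \<in> carrier A \<Longrightarrow> (c + d) \<odot> x = c \<odot> x \<oplus> d \<odot> x"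
    and smult_smult: "x \<in> carrier A \<Longrightarrow> (c * d) \<odot> x = c \<odot> (d \<odot> x)"
    and smult_one: "x \<in> carrier A \<Longrightarrow> 1 \<odot> x = x"
    and smult_mult_left: "\<lbrakk>x \<in> carrier A; y \<in> carrier A\<rbrakk> \<Longrightarrow> (c \<odot> x) \<otimes> y = c \<odot> (x \<otimes> y)"
    and smult_mult_right: "\<lbrakk>x \<in> carrier A; y \<in> carrier A\<rbrakk> \<Longrightarrow> x \<otimes> (c \<odot> y) = c \<odot> (x \<otimes> y)"
    and star_closed: "x \<in> carrier A \<Longrightarrow> star A x \<in> carrier A"
    and star_star: "x \<in> carrier A \<Longrightarrow> star A (star A x) = x"
    and star_add: "\<lbrakk>x \<in> carrier A; y \<in> carrier A\<rbrakk> \<Longrightarrow> star A (x \<oplus> y) = star A x \<oplus> star A y"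
    and star_smult: "x \<in> carrier A \<Longrightarrow> star A (c \<odot> x) = cnj c \<odot> star A x"
    and star_mult: "\<lbrakk>x \<in> carrier A; y \<in> carrier A\<rbrakk> \<Longrightarrow> star A (x \<otimes> y) = star A y \<otimes> star A x"
    and nrm_nonneg: "x \<in> carrier A \<Longrightarrow> 0 \<le> nrm A x"
    and nrm_eq_0: "x \<in> carrier A \<Longrightarrow> nrm A x = 0 \<longleftrightarrow> x = \<zero>"
    and nrm_triangle: "\<lbrakk>x \<in> carrier A; y \<in> carrier A\<rbrakk> \<Longrightarrow> nrm A (x \<oplus> y) \<le> nrm A x + nrm A y"
    and nrm_smult: "x \<in> carrier A \<Longrightarrow> nrm A (c \<odot> x) = cmod c * nrm A x"
    and nrm_mult: "\<lbrakk>x \<in> carrier A; y \<in> carrier A\<rbrakk> \<Longrightarrow> nrm A (x \<otimes> y) \<le> nrm A x * nrm A y"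
    and cstar_identity: "x \<in> carrier A \<Longrightarrow> nrm A (star A x \<otimes> x) = (nrm A x)\<^sup>2"
    and complete: "\<lbrakk>\<And>n. X n \<in> carrier A;
                    \<forall>e>0. \<exists>N. \<forall>m\<ge>N. \<forall>n\<ge>N. nrm A (X m \<ominus> X n) < e\<rbrakk>
                   \<Longrightarrow> \<exists>x\<in>carrier A. (\<lambda>n. nrm A (X n \<ominus> x)) \<longlonglongrightarrow> 0"

definition unital_star_hom :: "'a cstar_struct \<Rightarrow> 'b cstar_struct \<Rightarrow> ('a \<Rightarrow> 'b) \<Rightarrow> bool" where
  "unital_star_hom A B \<phi> \<longleftrightarrow>
     \<phi> \<in> ring_hom A B \<and>
     (\<forall>c. \<forall>x\<in>carrier A. \<phi> (c \<odot>\<^bsub>A\<^esub> x) = c \<odot>\<^bsub>B\<^esub> \<phi> x) \<and>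
     (\<forall>x\<in>carrier A. \<phi> (star A x) = star B (\<phi> x))"

definition closed_unital_star_subalgebra :: "'a cstar_struct \<Rightarrow> 'a set \<Rightarrow> bool" where
  "closed_unital_star_subalgebra A S \<longleftrightarrow>
     S \<subseteq> carrier A \<and> \<one>\<^bsub>A\<^esub> \<in> S \<and>
     (\<forall>x\<in>S. \<forall>y\<in>S. x \<oplus>\<^bsub>A\<^esub> y \<in> S \<and> x \<otimes>\<^bsub>A\<^esub> y \<in> S) \<and>
     (\<forall>c. \<forall>x\<in>S. c \<odot>\<^bsub>A\<^esub> x \<in> S) \<and>
     (\<forall>x\<in>S. star A x \<in> S) \<and>
     (\<forall>X. \<forall>x\<in>carrier A. (\<forall>n. X n \<in> S) \<and> (\<lambda>n. nrm A (X n \<ominus>\<^bsub>A\<^esub> x)) \<longlonglongrightarrow> 0 \<longrightarrow> x \<in> S)"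

definition projection :: "'a cstar_struct \<Rightarrow> 'a \<Rightarrow> bool" where
  "projection A p \<longleftrightarrow> p \<in> carrier A \<and> star A p = p \<and> p \<otimes>\<^bsub>A\<^esub> p = p"

definition magic_unitary :: "nat \<Rightarrow> 'a cstar_struct \<Rightarrow> (nat \<Rightarrow> nat \<Rightarrow> 'a) \<Rightarrow> bool" where
  "magic_unitary n A u \<longleftrightarrow>
     (\<forall>i\<in>{1..n}. \<forall>j\<in>{1..n}. projection A (u i j)) \<and>
     (\<forall>i\<in>{1..n}. \<forall>j\<in>{1..n}. \<forall>k\<in>{1..n}. j \<noteq> k \<longrightarrow>
        u i j \<otimes>\<^bsub>A\<^esub> u i k = \<zero>\<^bsub>A\<^esub> \<and> u j i \<otimes>\<^bsub>A\<^esub> u k i = \<zero>\<^bsub>A\<^esub>) \<and>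
     (\<forall>i\<in>{1..n}. (\<Oplus>\<^bsub>A\<^esub>j\<in>{1..n}. u i j) = \<one>\<^bsub>A\<^esub> \<and> (\<Oplus>\<^bsub>A\<^esub>j\<in>{1..n}. u j i) = \<one>\<^bsub>A\<^esub>)"

text \<open>
  \<open>is_A_s n A u\<close>: the pair \<open>(A, u)\<close> is the universal C*-algebra generated by the entries of a
  magic unitary of size \<open>n\<close>. The algebras \<open>B\<close> in the universal property have carriers contained in
  the type \<open>nat \<Rightarrow> complex\<close>. This is no restriction: the C*-subalgebra generated by the entries of
  a magic unitary over an arbitrary C*-algebra is separable, hence has at most continuum many
  elements and an isomorphic copy of this form. Uniqueness of \<open>\<phi>\<close> follows from generation.
\<close>

definition is_A_s :: "nat \<Rightarrow> 'a cstar_struct \<Rightarrow> (nat \<Rightarrow> nat \<Rightarrow> 'a) \<Rightarrow> bool" where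
  "is_A_s n A u \<longleftrightarrow>
     cstar_algebra A \<and> magic_unitary n A u \<and>
     (\<forall>S. closed_unital_star_subalgebra A S \<and> (\<forall>i\<in>{1..n}. \<forall>j\<in>{1..n}. u i j \<in> S)
          \<longrightarrow> S = carrier A) \<and>
     (\<forall>(B :: (nat \<Rightarrow> complex) cstar_struct) w. cstar_algebra B \<and> magic_unitary n B w \<longrightarrow>
        (\<exists>\<phi>. unital_star_hom A B \<phi> \<and> (\<forall>i\<in>{1..n}. \<forall>j\<in>{1..n}. \<phi> (u i j) = w i j)))"

text \<open>
  \<open>cstar_tensor A B C \<tau>\<close>: \<open>C\<close> is a completion of the algebraic tensor product of \<open>A\<close> and \<open>B\<close> with
  respect to some C*-norm, where \<open>\<tau> a b\<close> is the elementary tensor of \<open>a\<close> and \<open>b\<close>. The clause about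
  linearly independent families says that the algebraic tensor product embeds into \<open>C\<close>.
\<close>

definition lin_indep :: "'a cstar_struct \<Rightarrow> nat \<Rightarrow> (nat \<Rightarrow> 'a) \<Rightarrow> bool" where
  "lin_indep A m a \<longleftrightarrow>
     (\<forall>c. (\<Oplus>\<^bsub>A\<^esub>i\<in>{..<m}. c i \<odot>\<^bsub>A\<^esub> a i) = \<zero>\<^bsub>A\<^esub> \<longrightarrow> (\<forall>i<m. c i = 0))"

definition cstar_tensor ::
    "'a cstar_struct \<Rightarrow> 'b cstar_struct \<Rightarrow> 'c cstar_struct \<Rightarrow> ('a \<Rightarrow> 'b \<Rightarrow> 'c) \<Rightarrow> bool" where
  "cstar_tensor A B C \<tau> \<longleftrightarrow>
     cstar_algebra A \<and> cstar_algebra B \<and> cstar_algebra C \<and>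
     (\<forall>a\<in>carrier A. \<forall>b\<in>carrier B. \<tau> a b \<in> carrier C) \<and>
     (\<forall>a\<in>carrier A. \<forall>a'\<in>carrier A. \<forall>b\<in>carrier B. \<tau> (a \<oplus>\<^bsub>A\<^esub> a') b = \<tau> a b \<oplus>\<^bsub>C\<^esub> \<tau> a' b) \<and>
     (\<forall>a\<in>carrier A. \<forall>b\<in>carrier B. \<forall>b'\<in>carrier B. \<tau> a (b \<oplus>\<^bsub>B\<^esub> b') = \<tau> a b \<oplus>\<^bsub>C\<^esub> \<tau> a b') \<and>
     (\<forall>c. \<forall>a\<in>carrier A. \<forall>b\<in>carrier B.
        \<tau> (c \<odot>\<^bsub>A\<^esub> a) b = c \<odot>\<^bsub>C\<^esub> \<tau> a b \<and> \<tau> a (c \<odot>\<^bsub>B\<^esub> b) = c \<odot>\<^bsub>C\<^esub> \<tau> a b) \<and>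
     (\<forall>a\<in>carrier A. \<forall>a'\<in>carrier A. \<forall>b\<in>carrier B. \<forall>b'\<in>carrier B.
        \<tau> a b \<otimes>\<^bsub>C\<^esub> \<tau> a' b' = \<tau> (a \<otimes>\<^bsub>A\<^esub> a') (b \<otimes>\<^bsub>B\<^esub> b')) \<and>
     (\<forall>a\<in>carrier A. \<forall>b\<in>carrier B. star C (\<tau> a b) = \<tau> (star A a) (star B b)) \<and>
     \<tau> \<one>\<^bsub>A\<^esub> \<one>\<^bsub>B\<^esub> = \<one>\<^bsub>C\<^esub> \<and>
     (\<forall>(m::nat) a b. (\<forall>i<m. a i \<in> carrier A \<and> b i \<in> carrier B) \<and> lin_indep A m a \<and>
        (\<Oplus>\<^bsub>C\<^esub>i\<in>{..<m}. \<tau> (a i) (b i)) = \<zero>\<^bsub>C\<^esub> \<longrightarrow> (\<forall>i<m. b i = \<zero>\<^bsub>B\<^esub>)) \<and>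
     (\<forall>x\<in>carrier C. \<forall>e>0. \<exists>(m::nat) a b. (\<forall>i<m. a i \<in> carrier A \<and> b i \<in> carrier B) \<and>
        nrm C (x \<ominus>\<^bsub>C\<^esub> (\<Oplus>\<^bsub>C\<^esub>i\<in>{..<m}. \<tau> (a i) (b i))) < e)"

text \<open>
  The minimal C*-tensor product: the norm of \<open>C\<close> is the smallest C*-norm on the algebraic tensor
  product. The competitors \<open>D\<close> may be taken over the type of \<open>C\<close>: a completion of the algebraic
  tensor product \<open>A \<odot> B\<close> has at most as many elements as there are sequences in \<open>A \<odot> B\<close>, which is
  also a lower bound for the cardinality of the Banach space \<open>C\<close>.
\<close>

definition min_cstar_tensor ::
    "'a cstar_struct \<Rightarrow> 'b cstar_struct \<Rightarrow> 'c cstar_struct \<Rightarrow> ('a \<Rightarrow> 'b \<Rightarrow> 'c) \<Rightarrow> bool" where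
  "min_cstar_tensor A B C \<tau> \<longleftrightarrow>
     cstar_tensor A B C \<tau> \<and>
     (\<forall>(D :: 'c cstar_struct) \<sigma>. cstar_tensor A B D \<sigma> \<longrightarrow>
        (\<forall>(m::nat) a b. (\<forall>i<m. a i \<in> carrier A \<and> b i \<in> carrier B) \<longrightarrow>
           nrm C (\<Oplus>\<^bsub>C\<^esub>i\<in>{..<m}. \<tau> (a i) (b i)) \<le> nrm D (\<Oplus>\<^bsub>D\<^esub>i\<in>{..<m}. \<sigma> (a i) (b i))))"

definition comultiplication ::
    "nat \<Rightarrow> 'a cstar_struct \<Rightarrow> (nat \<Rightarrow> nat \<Rightarrow> 'a) \<Rightarrow> 'c cstar_struct \<Rightarrow> ('a \<Rightarrow> 'a \<Rightarrow> 'c)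
     \<Rightarrow> ('a \<Rightarrow> 'c) \<Rightarrow> bool" where
  "comultiplication n A u C \<tau> \<Delta> \<longleftrightarrow>
     unital_star_hom A C \<Delta> \<and>
     (\<forall>i\<in>{1..n}. \<forall>j\<in>{1..n}. \<Delta> (u i j) = (\<Oplus>\<^bsub>C\<^esub>k\<in>{1..n}. \<tau> (u i k) (u k j)))"

definition state :: "'a cstar_struct \<Rightarrow> ('a \<Rightarrow> complex) \<Rightarrow> bool" where
  "state A h \<longleftrightarrow>
     (\<forall>x\<in>carrier A. \<forall>y\<in>carrier A. h (x \<oplus>\<^bsub>A\<^esub> y) = h x + h y) \<and>
     (\<forall>c. \<forall>x\<in>carrier A. h (c \<odot>\<^bsub>A\<^esub> x) = c * h x) \<and>
     (\<forall>x\<in>carrier A. h (star A x \<otimes>\<^bsub>A\<^esub> x) \<in> \<real>\<^sub>\<ge>\<^sub>0) \<and>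
     h \<one>\<^bsub>A\<^esub> = 1"

definition bounded_linear_map :: "'a cstar_struct \<Rightarrow> 'b cstar_struct \<Rightarrow> ('a \<Rightarrow> 'b) \<Rightarrow> bool" where
  "bounded_linear_map A B L \<longleftrightarrow>
     (\<forall>x\<in>carrier A. L x \<in> carrier B) \<and>
     (\<forall>x\<in>carrier A. \<forall>y\<in>carrier A. L (x \<oplus>\<^bsub>A\<^esub> y) = L x \<oplus>\<^bsub>B\<^esub> L y) \<and>
     (\<forall>c. \<forall>x\<in>carrier A. L (c \<odot>\<^bsub>A\<^esub> x) = c \<odot>\<^bsub>B\<^esub> L x) \<and>
     (\<exists>K. \<forall>x\<in>carrier A. nrm B (L x) \<le> K * nrm A x)"

text \<open>
  Invariance means \<open>(h \<otimes> id) \<circ> \<Delta> = h(\<cdot>) 1 = (id \<otimes> h) \<circ> \<Delta>\<close>. The slice maps \<open>L = h \<otimes> id\<close> and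
  \<open>R = id \<otimes> h\<close> are the bounded linear maps with the prescribed values on elementary tensors;
  they are unique because elementary tensors span a dense subspace.
\<close>

definition haar_functional ::
    "'a cstar_struct \<Rightarrow> 'c cstar_struct \<Rightarrow> ('a \<Rightarrow> 'a \<Rightarrow> 'c) \<Rightarrow> ('a \<Rightarrow> 'c)
     \<Rightarrow> ('a \<Rightarrow> complex) \<Rightarrow> bool" where
  "haar_functional A C \<tau> \<Delta> h \<longleftrightarrow>
     state A h \<and>
     (\<exists>L. bounded_linear_map C A L \<and>
        (\<forall>a\<in>carrier A. \<forall>b\<in>carrier A. L (\<tau> a b) = h a \<odot>\<^bsub>A\<^esub> b) \<and>
        (\<forall>x\<in>carrier A. L (\<Delta> x) = h x \<odot>\<^bsub>A\<^esub> \<one>\<^bsub>A\<^esub>)) \<and>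
     (\<exists>R. bounded_linear_map C A R \<and>
        (\<forall>a\<in>carrier A. \<forall>b\<in>carrier A. R (\<tau> a b) = h b \<odot>\<^bsub>A\<^esub> a) \<and>
        (\<forall>x\<in>carrier A. R (\<Delta> x) = h x \<odot>\<^bsub>A\<^esub> \<one>\<^bsub>A\<^esub>))"

definition is_law :: "'a cstar_struct \<Rightarrow> ('a \<Rightarrow> complex) \<Rightarrow> 'a \<Rightarrow> real measure \<Rightarrow> bool" where
  "is_law A h a \<mu> \<longleftrightarrow>
     prob_space \<mu> \<and> sets \<mu> = sets borel \<and>
     (\<exists>K. compact K \<and> (AE y in \<mu>. y \<in> K)) \<and>
     (\<forall>k::nat. complex_of_real (\<integral>y. y ^ k \<partial>\<mu>) = h (a [^]\<^bsub>A\<^esub> k))"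

definition cauchy_transform :: "real measure \<Rightarrow> complex \<Rightarrow> complex" where
  "cauchy_transform \<mu> \<xi> = (\<integral>y. 1 / (\<xi> - complex_of_real y) \<partial>\<mu>)"

end

theory Submission imports Defs begin

text \<open>
  With respect to the characters of the Klein four-group on rows and columns, \<open>u\<close> becomes
  \<open>1 \<oplus> a\<close> for a \<open>3 \<times> 3\<close> matrix \<open>a\<close> whose entries anticommute within a row or column and commute
  otherwise: \<open>A_s(4)\<close> is a twist of the function algebra of \<open>SO(3)\<close>. Put \<open>S = 1 + a\<^sub>1\<^sub>1\<close>,
  \<open>C = a\<^sub>2\<^sub>2 + a\<^sub>3\<^sub>3\<close> and \<open>D = a\<^sub>2\<^sub>3 + a\<^sub>3\<^sub>2\<close>. Then \<open>4 v = S + C + t D\<close>, where \<open>S\<close> commutes with \<open>C\<close> and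
  \<open>D\<close>, \<open>C D = - D C\<close> and \<open>C\<^sup>2 + D\<^sup>2 = S\<^sup>2\<close>. Hence \<open>(4 v - S)\<^sup>2 = S\<^sup>2 - (1 - t\<^sup>2) D\<^sup>2\<close>, and the law of \<open>v\<close>
  is determined by the numbers \<open>h(S^l D^(2i))\<close>.

  The rotations about a coordinate axis give a one-parameter family of representations of
  \<open>A_s(4)\<close> on \<open>2 \<times> 2\<close> matrices. Applying them to the second leg of the invariance of \<open>h\<close> and
  differentiating at angle \<open>0\<close> shows that \<open>h\<close> vanishes on the range of a twisted derivation. The
  resulting recursions say that \<open>a\<^sub>1\<^sub>1\<close> is uniform on \<open>[-1, 1]\<close> and that \<open>D\<close> behaves like \<open>S\<close> times the
  sine of an independent uniform angle. The generating function of the moments of \<open>v\<close> is therefore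
  obtained from \<open>(1 + (1 - t\<^sup>2) x) powr (-1/2)\<close> by two binomial transforms.
\<close>

section \<open>The C*-algebra of square matrices\<close>

text \<open>Representations cannot be differentiated directly: for each angle the universal property
  only provides some representation, and nothing ties together the choices made at different angles.
  Nor is it evident that a twisted derivation is well defined on the algebra. Both obstacles are met
  by working with words in letters whose coproduct is known after a rotation of the second leg.
  Evaluating such a word yields an explicit trigonometric polynomial in the angle, and invariance
  forces this polynomial to be constant.

  Scalars cannot carry a rotation, because anticommutation within a row would force cos \<theta> sin
  \<theta> = 0. Hence cosine and sine are multiplied by two anticommuting reflections X and Y, and
  the matrices have size two. At angle 0 an odd letter still picks up X, and this is what makes
  \<open>h\<close> vanish on words with an odd number of odd letters.

  The formula concerns G' and not G because the uniform law puts a denominator n + 1 into the n-th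
  moment, which differentiation cancels. The square root is read off from the resulting series,
  whose square is a rational function, so no branch has to be selected.\<close>

definition matrix_smult :: "complex \<Rightarrow> complex^'n^'n \<Rightarrow> complex^'n^'n" where
  "matrix_smult c M = (\<chi> i j. c * M$i$j)"

definition matrix_adjoint :: "complex^'n^'n \<Rightarrow> complex^'n^'n" where
  "matrix_adjoint M = (\<chi> i j. cnj (M$j$i))"

definition matrix_norm :: "complex^'n^'n \<Rightarrow> real" where
  "matrix_norm M = onorm ((*v) M)"

lemma matrix_smult_simps:
  "matrix_smult c (M + N) = matrix_smult c M + matrix_smult c N"
  "matrix_smult (c + d) M = matrix_smult c M + matrix_smult d M"
  "matrix_smult (c * d) M = matrix_smult c (matrix_smult d M)"
  "matrix_smult 1 M = M"
  "matrix_smult c M ** N = matrix_smult c (M ** N)"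
  "M ** matrix_smult c N = matrix_smult c (M ** N)"
  "matrix_smult c M *v x = c *s (M *v x)"
  by (simp_all add: matrix_smult_def vec_eq_iff algebra_simps matrix_matrix_mult_def
      matrix_vector_mult_def sum_distrib_left)

lemma matrix_adjoint_simps:
  "matrix_adjoint (matrix_adjoint M) = M"
  "matrix_adjoint (M + N) = matrix_adjoint M + matrix_adjoint N"
  "matrix_adjoint (matrix_smult c M) = matrix_smult (cnj c) (matrix_adjoint M)"
  "matrix_adjoint (M ** N) = matrix_adjoint N ** matrix_adjoint M"
  by (simp_all add: matrix_smult_def matrix_adjoint_def vec_eq_iff matrix_matrix_mult_def mult.commute)

lemma matrix_add_rdistrib: "(M + N) ** P = M ** P + N ** P" for M N :: "complex^'n^'n"
  by (simp add: matrix_matrix_mult_def vec_eq_iff algebra_simps sum.distrib)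

text \<open>The inner product is the real one, that is, the real part of the Hermitian product. It
  induces the same norm, so this adjunction is enough for the C*-identity.\<close>

lemma inner_matrix_adjoint: "(M *v x) \<bullet> y = x \<bullet> (matrix_adjoint M *v y)" for x y :: "complex^'n"
proof -
  have *: "(a * b) \<bullet> c = b \<bullet> (cnj a * c)" for a b c :: complex
    by (simp add: inner_complex_def algebra_simps)
  have "(M *v x) \<bullet> y = (\<Sum>i\<in>UNIV. \<Sum>j\<in>UNIV. x$j \<bullet> (cnj (M$i$j) * y$i))"
    by (simp add: inner_vec_def matrix_vector_mult_def inner_sum_left *)
  also have "\<dots> = x \<bullet> (matrix_adjoint M *v y)"
    by (subst sum.swap) (simp add: inner_vec_def matrix_vector_mult_def inner_sum_right matrix_adjoint_def)
  finally show ?thesis .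
qed

lemma norm_matrix_vector: "norm (M *v x) \<le> matrix_norm M * norm x"
  unfolding matrix_norm_def by (rule onorm) simp

lemma matrix_norm_nonneg: "0 \<le> matrix_norm M"
  unfolding matrix_norm_def by (rule onorm_pos_le) simp

lemma matrix_norm_leI: "(\<And>x. norm (M *v x) \<le> K * norm x) \<Longrightarrow> matrix_norm M \<le> K"
  unfolding matrix_norm_def by (rule onorm_le)

lemma matrix_norm_entry: "cmod (M$i$j) \<le> matrix_norm M"
proof -
  have "M$i$j = (M *v axis j 1)$i"
    by (simp add: matrix_vector_mult_def axis_def if_distrib cong: if_cong)
  then have "cmod (M$i$j) \<le> norm (M *v axis j 1)"
    using Finite_Cartesian_Product.norm_nth_le[of "M *v axis j 1" i] by simp
  also have "\<dots> \<le> matrix_norm M"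
    using norm_matrix_vector[of M "axis j 1"] by simp
  finally show ?thesis .
qed

text \<open>Together with \<open>matrix_norm_le_norm\<close> this is a crude equivalence with the
  Euclidean norm. It transfers completeness to the operator norm.\<close>

lemma norm_le_matrix_norm: "norm M \<le> real (CARD('n))^2 * matrix_norm M" for M :: "complex^'n^'n"
proof -
  have "norm M \<le> (\<Sum>i\<in>UNIV. norm (M$i))"
    by (simp add: norm_vec_def L2_set_le_sum)
  also have "\<dots> \<le> (\<Sum>i\<in>UNIV. \<Sum>j\<in>UNIV. norm (M$i$j))"
    by (intro sum_mono) (simp add: norm_vec_def L2_set_le_sum)
  also have "\<dots> \<le> (\<Sum>i\<in>(UNIV::'n set). \<Sum>j\<in>(UNIV::'n set). matrix_norm M)"
    by (intro sum_mono matrix_norm_entry)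
  finally show ?thesis by (simp add: power2_eq_square)
qed

lemma matrix_norm_le_norm: "matrix_norm M \<le> real (CARD('n))^2 * norm M" for M :: "complex^'n^'n"
proof (rule matrix_norm_leI)
  fix x :: "complex^'n"
  have "norm (M *v x) \<le> (\<Sum>i\<in>UNIV. norm ((M *v x)$i))"
    by (simp add: norm_vec_def L2_set_le_sum)
  also have "\<dots> \<le> (\<Sum>i\<in>UNIV. \<Sum>j\<in>UNIV. norm (M$i$j * x$j))"
    by (intro sum_mono) (simp add: matrix_vector_mult_def norm_sum)
  also have "\<dots> \<le> (\<Sum>i\<in>(UNIV::'n set). \<Sum>j\<in>(UNIV::'n set). norm M * norm x)"
    by (intro sum_mono) (auto simp: norm_mult intro!: mult_mono Finite_Cartesian_Product.norm_nth_le
        order_trans[OF Finite_Cartesian_Product.norm_nth_le Finite_Cartesian_Product.norm_nth_le])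
  finally show "norm (M *v x) \<le> real (CARD('n))^2 * norm M * norm x"
    by (simp add: power2_eq_square)
qed

lemma matrix_norm_mult: "matrix_norm (M ** N) \<le> matrix_norm M * matrix_norm N"
proof (rule matrix_norm_leI)
  fix x
  have "norm ((M ** N) *v x) \<le> matrix_norm M * norm (N *v x)"
    using norm_matrix_vector[of M "N *v x"] by (simp add: matrix_vector_mul_assoc)
  also have "\<dots> \<le> matrix_norm M * (matrix_norm N * norm x)"
    by (intro mult_left_mono norm_matrix_vector matrix_norm_nonneg)
  finally show "norm ((M ** N) *v x) \<le> matrix_norm M * matrix_norm N * norm x"
    by (simp add: mult.assoc)
qed

lemma matrix_norm_triangle: "matrix_norm (M + N) \<le> matrix_norm M + matrix_norm N"
proof (rule matrix_norm_leI)
  fix x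
  have "norm ((M + N) *v x) \<le> norm (M *v x) + norm (N *v x)"
    by (simp add: matrix_vector_mult_add_rdistrib norm_triangle_ineq)
  also have "\<dots> \<le> matrix_norm M * norm x + matrix_norm N * norm x"
    by (intro add_mono norm_matrix_vector)
  finally show "norm ((M + N) *v x) \<le> (matrix_norm M + matrix_norm N) * norm x"
    by (simp add: algebra_simps)
qed

lemma norm_vector_smult: "norm (c *s x) = cmod c * norm x" for x :: "complex^'n"
proof -
  have "norm (c *s x) = L2_set (\<lambda>i. cmod c * norm (x$i)) UNIV"
    by (simp add: norm_vec_def norm_mult)
  then show ?thesis by (simp add: norm_vec_def L2_set_right_distrib)
qed

lemma matrix_norm_smult: "matrix_norm (matrix_smult c M) = cmod c * matrix_norm M"
proof -
  have le: "matrix_norm (matrix_smult c M) \<le> cmod c * matrix_norm M" for c and M :: "complex^'n^'n"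
  proof (rule matrix_norm_leI)
    fix x :: "complex^'n"
    show "norm (matrix_smult c M *v x) \<le> cmod c * matrix_norm M * norm x"
      by (simp add: matrix_smult_simps norm_vector_smult mult.assoc mult_left_mono norm_matrix_vector)
  qed
  show ?thesis
  proof (cases "c = 0")
    case True
    then show ?thesis using le[of c M] matrix_norm_nonneg[of "matrix_smult c M"] by simp
  next
    case False
    have "matrix_norm M \<le> cmod (inverse c) * matrix_norm (matrix_smult c M)"
      using le[of "inverse c" "matrix_smult c M"] False
      by (simp flip: matrix_smult_simps(3) add: matrix_smult_simps(4))
    then have "cmod c * matrix_norm M \<le> matrix_norm (matrix_smult c M)"
      using False by (simp add: norm_divide field_simps)
    then show ?thesis using le[of c M] by simp
  qed
qed

lemma matrix_norm_eq_0: "matrix_norm M = 0 \<longleftrightarrow> M = 0"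
proof
  assume "matrix_norm M = 0"
  then show "M = 0" using matrix_norm_entry[of M] by (simp add: vec_eq_iff)
next
  assume "M = 0"
  then show "matrix_norm M = 0"
    using matrix_norm_le_norm[of M] matrix_norm_nonneg[of M] by simp
qed

lemma matrix_norm_adjoint_le: "matrix_norm (matrix_adjoint M) \<le> matrix_norm M"
proof (rule matrix_norm_leI)
  fix x
  let ?y = "matrix_adjoint M *v x"
  have "norm ?y ^ 2 = (M *v ?y) \<bullet> x"
    by (simp add: power2_norm_eq_inner inner_matrix_adjoint)
  also have "\<dots> \<le> norm (M *v ?y) * norm x" by (rule norm_cauchy_schwarz)
  also have "\<dots> \<le> (matrix_norm M * norm ?y) * norm x"
    by (intro mult_right_mono norm_matrix_vector norm_ge_zero)
  finally have "norm ?y * norm ?y \<le> norm ?y * (matrix_norm M * norm x)"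
    by (simp add: power2_eq_square mult_ac)
  then show "norm ?y \<le> matrix_norm M * norm x"
    by (cases "norm ?y = 0") (auto simp: matrix_norm_nonneg)
qed

lemma matrix_norm_cstar: "matrix_norm (matrix_adjoint M ** M) = (matrix_norm M)\<^sup>2"
proof (rule antisym)
  show "matrix_norm (matrix_adjoint M ** M) \<le> (matrix_norm M)\<^sup>2"
    using matrix_norm_mult[of "matrix_adjoint M" M]
      mult_right_mono[OF matrix_norm_adjoint_le matrix_norm_nonneg, of M M]
    by (simp add: power2_eq_square)
  let ?K = "matrix_norm (matrix_adjoint M ** M)"
  have "matrix_norm M \<le> sqrt ?K"
  proof (rule matrix_norm_leI)
    fix x
    have "norm (M *v x) ^ 2 = x \<bullet> ((matrix_adjoint M ** M) *v x)"
      by (simp add: power2_norm_eq_inner inner_matrix_adjoint matrix_vector_mul_assoc)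
    also have "\<dots> \<le> norm x * (?K * norm x)"
      by (rule order_trans[OF norm_cauchy_schwarz]) (simp add: mult_left_mono norm_matrix_vector)
    finally have "norm (M *v x) ^ 2 \<le> (sqrt ?K * norm x)^2"
      by (simp add: power_mult_distrib matrix_norm_nonneg power2_eq_square mult_ac)
    then show "norm (M *v x) \<le> sqrt ?K * norm x"
      by (rule power2_le_imp_le) (simp add: matrix_norm_nonneg)
  qed
  then have "(matrix_norm M)\<^sup>2 \<le> (sqrt ?K)\<^sup>2"
    by (intro power_mono matrix_norm_nonneg)
  then show "(matrix_norm M)\<^sup>2 \<le> ?K" by (simp add: matrix_norm_nonneg)
qed

text \<open>The universal property of \<open>A_s(4)\<close> only ranges over algebras on the type \<open>nat \<Rightarrow> complex\<close>.\<close>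

definition matrix_encode :: "complex^2^2 \<Rightarrow> nat \<Rightarrow> complex" where
  "matrix_encode M = (\<lambda>n. if n = 0 then M$1$1 else if n = 1 then M$1$2
                          else if n = 2 then M$2$1 else M$2$2)"

definition matrix_decode :: "(nat \<Rightarrow> complex) \<Rightarrow> complex^2^2" where
  "matrix_decode f = (\<chi> i j. if i = 1 then if j = 1 then f 0 else f 1
                             else if j = 1 then f 2 else f 3)"

lemma matrix_decode_encode [simp]: "matrix_decode (matrix_encode M) = M"
  by (simp add: matrix_decode_def matrix_encode_def vec_eq_iff forall_2)

definition matrix_cstar :: "(nat \<Rightarrow> complex) cstar_struct" where
  "matrix_cstar =
     \<lparr>carrier = range matrix_encode,
      mult = \<lambda>x y. matrix_encode (matrix_decode x ** matrix_decode y),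
      one = matrix_encode (mat 1),
      zero = matrix_encode 0,
      add = \<lambda>x y. matrix_encode (matrix_decode x + matrix_decode y),
      smult = \<lambda>c x. matrix_encode (matrix_smult c (matrix_decode x)),
      star = \<lambda>x. matrix_encode (matrix_adjoint (matrix_decode x)),
      nrm = \<lambda>x. matrix_norm (matrix_decode x)\<rparr>"

lemma ring_matrix_cstar: "ring matrix_cstar"
proof (rule ringI)
  show "abelian_group matrix_cstar"
  proof (rule abelian_groupI)
    fix x assume "x \<in> carrier matrix_cstar"
    then obtain M where "x = matrix_encode M" by (auto simp: matrix_cstar_def)
    then show "\<exists>y\<in>carrier matrix_cstar. y \<oplus>\<^bsub>matrix_cstar\<^esub> x = \<zero>\<^bsub>matrix_cstar\<^esub>"
      by (intro bexI[of _ "matrix_encode (- M)"]) (auto simp: matrix_cstar_def)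
  qed (auto simp: matrix_cstar_def add_ac)
  show "monoid matrix_cstar"
    by (rule monoidI) (auto simp: matrix_cstar_def matrix_mul_assoc)
qed (auto simp: matrix_cstar_def matrix_add_ldistrib matrix_add_rdistrib)

lemma minus_matrix_cstar:
  "matrix_encode M \<ominus>\<^bsub>matrix_cstar\<^esub> matrix_encode N = matrix_encode (M - N)"
proof -
  interpret ring matrix_cstar by (rule ring_matrix_cstar)
  have "matrix_encode M = matrix_encode (M - N) \<oplus>\<^bsub>matrix_cstar\<^esub> matrix_encode N"
    by (simp add: matrix_cstar_def)
  moreover have in_carrier: "matrix_encode X \<in> carrier matrix_cstar" for X
    by (simp add: matrix_cstar_def)
  ultimately show ?thesis
    by (simp add: minus_eq a_assoc r_neg)
qed

lemma cstar_algebra_matrix: "cstar_algebra matrix_cstar"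
proof -
  interpret R: ring matrix_cstar by (rule ring_matrix_cstar)
  have complete: "\<exists>x\<in>carrier matrix_cstar. (\<lambda>n. nrm matrix_cstar (X n \<ominus>\<^bsub>matrix_cstar\<^esub> x)) \<longlonglongrightarrow> 0"
    if X: "\<And>n. X n \<in> carrier matrix_cstar"
      and Cauchy: "\<forall>e>0. \<exists>N. \<forall>m\<ge>N. \<forall>n\<ge>N. nrm matrix_cstar (X m \<ominus>\<^bsub>matrix_cstar\<^esub> X n) < e" for X
  proof -
    define Y where "Y n = matrix_decode (X n)" for n
    have XY: "X n = matrix_encode (Y n)" for n
      using X[of n] by (auto simp: Y_def matrix_cstar_def)
    have nrm: "nrm matrix_cstar (X m \<ominus>\<^bsub>matrix_cstar\<^esub> matrix_encode M) = matrix_norm (Y m - M)" for m M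
      by (simp only: XY minus_matrix_cstar) (simp add: matrix_cstar_def)
    have "Cauchy Y"
    proof (rule CauchyI)
      fix e :: real assume "0 < e"
      \<comment> \<open>The divisor 4 is \<open>CARD(2)^2\<close>, the constant in
        \<open>norm_le_matrix_norm\<close>.\<close>
      then obtain N where N: "\<And>m n. m \<ge> N \<Longrightarrow> n \<ge> N \<Longrightarrow> matrix_norm (Y m - Y n) < e / 4"
        using Cauchy[rule_format, of "e/4"] by (auto simp: XY[of "_"] nrm[unfolded XY])
      have "norm (Y m - Y n) < e" if "m \<ge> N" "n \<ge> N" for m n
        using norm_le_matrix_norm[of "Y m - Y n"] N[OF that] by simp
      then show "\<exists>M. \<forall>m\<ge>M. \<forall>n\<ge>M. norm (Y m - Y n) < e" by blast
    qed
    then obtain M where M: "Y \<longlonglongrightarrow> M" using Cauchy_convergent_iff convergent_def by blast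
    have "(\<lambda>n. matrix_norm (Y n - M)) \<longlonglongrightarrow> 0"
    proof (rule tendsto_sandwich)
      show "\<forall>\<^sub>F n in sequentially. 0 \<le> matrix_norm (Y n - M)" by (simp add: matrix_norm_nonneg)
      show "\<forall>\<^sub>F n in sequentially. matrix_norm (Y n - M) \<le> 4 * norm (Y n - M)"
        using matrix_norm_le_norm[of "Y _ - M"] by simp
      show "(\<lambda>n. 4 * norm (Y n - M)) \<longlonglongrightarrow> 0"
        using tendsto_mult_right_zero[OF tendsto_norm_zero[OF LIM_zero[OF M]]] by simp
    qed simp
    then show ?thesis
      by (intro bexI[of _ "matrix_encode M"]) (simp add: nrm, simp add: matrix_cstar_def)
  qed
  show ?thesis
    by unfold_locales
      (use complete in \<open>auto simp: matrix_cstar_def matrix_smult_simps matrix_adjoint_simps matrix_norm_nonneg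
        matrix_norm_eq_0 matrix_norm_triangle matrix_norm_smult matrix_norm_mult matrix_norm_cstar
        dest: arg_cong[of _ _ matrix_decode]\<close>)
qed

section \<open>Rotation models\<close>

lemma (in abelian_monoid) finsum_upto_4:
  assumes "f \<in> {1..4::nat} \<rightarrow> carrier G"
  shows "(\<Oplus>j\<in>{1..4}. f j) = f 1 \<oplus> (f 2 \<oplus> (f 3 \<oplus> f 4))"
proof -
  have "{1..4::nat} = {1,2,3,4}" by auto
  then show ?thesis using assms by (simp add: Pi_def)
qed

lemma ball_upto_4: "(\<forall>i\<in>{1..4::nat}. P i) \<longleftrightarrow> P 1 \<and> P 2 \<and> P 3 \<and> P 4"
proof -
  have "{1..4::nat} = {1,2,3,4}" by auto
  then show ?thesis by simp
qed

lemma sum_upto_4: "(\<Sum>j\<in>{1..4::nat}. f j) = f 1 + f 2 + f 3 + f 4"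
proof -
  have "{1..4::nat} = {1,2,3,4}" by auto
  then show ?thesis by (simp add: add.assoc)
qed

text \<open>The characters \<open>c = 0, \<dots>, 3\<close> of the Klein four-group, whose elements are numbered \<open>1, \<dots>, 4\<close>.\<close>

definition klein_char :: "nat \<Rightarrow> nat \<Rightarrow> complex" where
  "klein_char c i = (if c = 0 \<or> i = 1 \<or> i = Suc c then 1 else - 1)"

definition reflection_x :: "complex^2^2" where
  "reflection_x = (\<chi> i j. if i = j then if i = 1 then 1 else - 1 else 0)"

definition reflection_y :: "complex^2^2" where
  "reflection_y = (\<chi> i j. if i = j then 0 else 1)"

text \<open>For signs \<epsilon> and \<delta> this is the spectral projection, for the eigenvalue
  \<delta>, of the reflection cos \<theta> X + \<epsilon> sin \<theta> Y.\<close>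

definition half_projection :: "real \<Rightarrow> complex \<Rightarrow> complex \<Rightarrow> complex^2^2" where
  "half_projection \<theta> \<epsilon> \<delta> = matrix_smult (1/2) (mat 1 + matrix_smult \<delta>
     (matrix_smult (cos \<theta>) reflection_x + matrix_smult (\<epsilon> * sin \<theta>) reflection_y))"

lemmas matrix_2_simps = matrix_smult_def vec_eq_iff forall_2 matrix_matrix_mult_def sum_2 mat_def

lemma half_projection_nth:
  "half_projection \<theta> \<epsilon> \<delta> $ 1 $ 1 = (1 + \<delta> * cos \<theta>) / 2"
  "half_projection \<theta> \<epsilon> \<delta> $ 1 $ 2 = \<delta> * \<epsilon> * sin \<theta> / 2"
  "half_projection \<theta> \<epsilon> \<delta> $ 2 $ 1 = \<delta> * \<epsilon> * sin \<theta> / 2"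
  "half_projection \<theta> \<epsilon> \<delta> $ 2 $ 2 = (1 - \<delta> * cos \<theta>) / 2"
  by (simp_all add: half_projection_def matrix_smult_def reflection_x_def reflection_y_def mat_def)

lemma half_projection:
  assumes "\<epsilon> \<in> {1, -1}"
  shows "\<delta> \<in> {1, -1} \<Longrightarrow> matrix_adjoint (half_projection \<theta> \<epsilon> \<delta>) = half_projection \<theta> \<epsilon> \<delta>"
    and "\<delta> \<in> {1, -1} \<Longrightarrow> half_projection \<theta> \<epsilon> \<delta> ** half_projection \<theta> \<epsilon> \<delta> = half_projection \<theta> \<epsilon> \<delta>"
    and "half_projection \<theta> \<epsilon> 1 ** half_projection \<theta> \<epsilon> (- 1) = 0"
    and "half_projection \<theta> \<epsilon> (- 1) ** half_projection \<theta> \<epsilon> 1 = 0"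
    and "half_projection \<theta> \<epsilon> 1 + half_projection \<theta> \<epsilon> (- 1) = mat 1"
    and "half_projection \<theta> \<epsilon> (- 1) + half_projection \<theta> \<epsilon> 1 = mat 1"
proof -
  define c s where "c = complex_of_real (cos \<theta>)" and "s = complex_of_real (sin \<theta>)"
  have cs: "c * c = 1 - s * s"
    unfolding c_def s_def by (metis cos_squared_eq of_real_1 of_real_diff of_real_mult power2_eq_square)
  note simps = vec_eq_iff forall_2 matrix_matrix_mult_def sum_2 half_projection_nth mat_def
    c_def[symmetric] s_def[symmetric]
  have \<epsilon>: "\<epsilon> = 1 \<or> \<epsilon> = - 1" using assms by simp
  then show "half_projection \<theta> \<epsilon> 1 ** half_projection \<theta> \<epsilon> (- 1) = 0"
    "half_projection \<theta> \<epsilon> (- 1) ** half_projection \<theta> \<epsilon> 1 = 0"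
    "half_projection \<theta> \<epsilon> 1 + half_projection \<theta> \<epsilon> (- 1) = mat 1"
    "half_projection \<theta> \<epsilon> (- 1) + half_projection \<theta> \<epsilon> 1 = mat 1"
    by (elim disjE; simp add: simps; simp add: field_simps cs)+
  assume "\<delta> \<in> {1, -1}"
  then have \<delta>: "\<delta> = 1 \<or> \<delta> = - 1" by simp
  show "matrix_adjoint (half_projection \<theta> \<epsilon> \<delta>) = half_projection \<theta> \<epsilon> \<delta>"
  proof -
    have "cnj \<epsilon> = \<epsilon>" "cnj \<delta> = \<delta>" using \<epsilon> \<delta> by auto
    then show ?thesis by (simp add: vec_eq_iff forall_2 half_projection_nth matrix_adjoint_def)
  qed
  have "c * (c * r) = r - s * (s * r)" for r
    using arg_cong[OF cs, of "\<lambda>x. x * r"] by (simp add: algebra_simps)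
  then show "half_projection \<theta> \<epsilon> \<delta> ** half_projection \<theta> \<epsilon> \<delta> = half_projection \<theta> \<epsilon> \<delta>"
    using \<epsilon> \<delta> by (elim disjE; simp add: simps; simp add: field_simps cs)
qed

text \<open>Indices with the same value of chi_e form a block of size two, and chi_f separates the
  two indices of a block. So each block is a magic unitary with a projection p on its diagonal and 1
  - p beside it. The sign chi_e(k) turns the angle in opposite directions in the two blocks.\<close>

definition rotation_model :: "nat \<Rightarrow> nat \<Rightarrow> real \<Rightarrow> nat \<Rightarrow> nat \<Rightarrow> complex^2^2" where
  "rotation_model e f \<theta> k j = (if klein_char e k = klein_char e j
     then half_projection \<theta> (klein_char e k) (klein_char f k * klein_char f j) else 0)"

lemma magic_unitary_rotation_model:
  assumes "(e, f) \<in> {(1,2), (2,1), (3,1)}"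
  shows "magic_unitary 4 matrix_cstar (\<lambda>k j. matrix_encode (rotation_model e f \<theta> k j))"
proof -
  interpret B: cstar_algebra matrix_cstar by (rule cstar_algebra_matrix)
  have closed: "matrix_encode M \<in> carrier matrix_cstar" for M by (simp add: matrix_cstar_def)
  have fin: "(\<Oplus>\<^bsub>matrix_cstar\<^esub>j\<in>{1..4::nat}. matrix_encode (M j)) = matrix_encode (M 1 + M 2 + M 3 + M 4)" for M
    by (subst B.finsum_upto_4) (auto simp: matrix_cstar_def add.assoc)
  have simps: "star matrix_cstar (matrix_encode M) = matrix_encode (matrix_adjoint M)"
    "matrix_encode M \<otimes>\<^bsub>matrix_cstar\<^esub> matrix_encode N = matrix_encode (M ** N)"
    "\<zero>\<^bsub>matrix_cstar\<^esub> = matrix_encode 0" "\<one>\<^bsub>matrix_cstar\<^esub> = matrix_encode (mat 1)" for M N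
    by (simp_all add: matrix_cstar_def)
  have zeros: "matrix_adjoint 0 = (0 :: complex^2^2)" "0 ** M = 0" "M ** 0 = 0" for M :: "complex^2^2"
    by (simp_all add: matrix_adjoint_def vec_eq_iff matrix_matrix_mult_def)
  have ef: "e = 1 \<and> f = 2 \<or> e = 2 \<and> f = 1 \<or> e = 3 \<and> f = 1" using assms(1) by auto
  show ?thesis
    unfolding magic_unitary_def projection_def ball_upto_4 fin simps rotation_model_def
    using ef by (elim disjE conjE; hypsubst; simp add: klein_char_def closed half_projection zeros)
qed

text \<open>The Fourier transform in the column index exhibits the model as a twisted rotation about
  the axis \<open>e\<close>: chi_e is fixed, while chi_f and chi_g are mixed through cos \<theta> X
  and sin \<theta> Y. Since 1 + 2 + 3 = 6, \<open>6 - e - f\<close> is the remaining axis.\<close>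

lemma sum_rotation_model:
  assumes "(e, f) \<in> {(1,2), (2,1), (3,1)}" "k \<in> {1..4}" "g = 6 - e - f"
  shows "(\<Sum>j\<in>{1..4}. matrix_smult (klein_char e j) (rotation_model e f \<theta> k j))
      = matrix_smult (klein_char e k) (mat 1)" (is ?A)
    and "(\<Sum>j\<in>{1..4}. matrix_smult (klein_char f j) (rotation_model e f \<theta> k j))
      = matrix_smult (klein_char f k * cos \<theta>) reflection_x
        + matrix_smult (klein_char g k * sin \<theta>) reflection_y" (is ?B)
    and "(\<Sum>j\<in>{1..4}. matrix_smult (klein_char g j) (rotation_model e f \<theta> k j))
      = matrix_smult (klein_char g k * cos \<theta>) reflection_x
        + matrix_smult (klein_char f k * sin \<theta>) reflection_y" (is ?C)
proof -
  have k: "k = 1 \<or> k = 2 \<or> k = 3 \<or> k = 4" using assms(2) by auto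
  have ef: "e = 1 \<and> f = 2 \<or> e = 2 \<and> f = 1 \<or> e = 3 \<and> f = 1" using assms(1) by auto
  define I X Y where "I = matrix_smult (1/2) (mat 1 :: complex^2^2)"
    and "X = matrix_smult (cos \<theta> / 2) reflection_x"
    and "Y = matrix_smult (sin \<theta> / 2) reflection_y"
  have smult: "matrix_smult 1 M = M" "matrix_smult (- 1) M = - M" "matrix_smult a 0 = 0"
    for M :: "complex^2^2" and a
    by (simp_all add: matrix_smult_def vec_eq_iff)
  have P: "half_projection \<theta> 1 1 = I + X + Y" "half_projection \<theta> (- 1) 1 = I + X - Y"
    "half_projection \<theta> 1 (- 1) = I - X - Y" "half_projection \<theta> (- 1) (- 1) = I - X + Y"
    by (simp_all add: half_projection_def I_def X_def Y_def vec_eq_iff forall_2 matrix_smult_def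
        reflection_x_def reflection_y_def mat_def)
  have XY: "matrix_smult (klein_char c k * cos \<theta>) reflection_x = matrix_smult (klein_char c k) (X + X)"
    "matrix_smult (klein_char c k * sin \<theta>) reflection_y = matrix_smult (klein_char c k) (Y + Y)"
    "mat 1 = I + I" for c
    by (simp_all add: I_def X_def Y_def matrix_smult_simps(4) flip: matrix_smult_simps(2,3))
  have "?A \<and> ?B \<and> ?C"
    unfolding sum_upto_4 assms(3) rotation_model_def XY
    using k ef
    by (elim disjE conjE; hypsubst; simp add: klein_char_def smult P add_ac)
  then show ?A ?B ?C by auto
qed

definition matrix_rep :: "'a cstar_struct \<Rightarrow> ('a \<Rightarrow> complex^2^2) \<Rightarrow> bool" where
  "matrix_rep A \<Phi> \<longleftrightarrow>
     (\<forall>x\<in>carrier A. \<forall>y\<in>carrier A. \<Phi> (x \<oplus>\<^bsub>A\<^esub> y) = \<Phi> x + \<Phi> y \<and> \<Phi> (x \<otimes>\<^bsub>A\<^esub> y) = \<Phi> x ** \<Phi> y) \<and>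
     (\<forall>c. \<forall>x\<in>carrier A. \<Phi> (c \<odot>\<^bsub>A\<^esub> x) = matrix_smult c (\<Phi> x)) \<and>
     \<Phi> \<one>\<^bsub>A\<^esub> = mat 1"

lemma exists_rotation_rep:
  assumes "is_A_s 4 A u" "(e, f) \<in> {(1,2), (2,1), (3,1)}"
  shows "\<exists>\<Phi>. matrix_rep A \<Phi> \<and> (\<forall>i\<in>{1..4}. \<forall>j\<in>{1..4}. \<Phi> (u i j) = rotation_model e f \<theta> i j)"
proof -
  have "\<forall>(B :: (nat \<Rightarrow> complex) cstar_struct) w. cstar_algebra B \<and> magic_unitary 4 B w \<longrightarrow>
      (\<exists>\<phi>. unital_star_hom A B \<phi> \<and> (\<forall>i\<in>{1..4}. \<forall>j\<in>{1..4}. \<phi> (u i j) = w i j))"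
    using assms(1) unfolding is_A_s_def by (elim conjE)
  from this[THEN spec, THEN spec, THEN mp, OF conjI, OF cstar_algebra_matrix
      magic_unitary_rotation_model[OF assms(2), of \<theta>]]
  obtain \<phi> where hom: "unital_star_hom A matrix_cstar \<phi>"
    and \<phi>: "\<forall>i\<in>{1..4}. \<forall>j\<in>{1..4}. \<phi> (u i j) = matrix_encode (rotation_model e f \<theta> i j)"
    by (elim exE conjE)
  have "matrix_rep A (\<lambda>x. matrix_decode (\<phi> x))"
    using hom unfolding unital_star_hom_def matrix_rep_def
    by (auto simp: ring_hom_def) (simp_all add: matrix_cstar_def)
  then show ?thesis
    using \<phi> by (intro exI[of _ "\<lambda>x. matrix_decode (\<phi> x)"]) simp
qed

section \<open>Relations between the Fourier coefficients of a magic unitary\<close>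

context cstar_algebra
begin

declare smult_closed [simp, intro]

lemma smult_zero_right [simp]: "c \<odot> \<zero> = \<zero>"
proof -
  have "c \<odot> \<zero> = c \<odot> \<zero> \<oplus> c \<odot> \<zero>"
    using smult_add_right[of \<zero> \<zero> c] by simp
  then show ?thesis by (metis add.r_cancel_one' smult_closed zero_closed)
qed

lemma smult_zero_left [simp]: "x \<in> carrier A \<Longrightarrow> 0 \<odot> x = \<zero>"
proof -
  assume x: "x \<in> carrier A"
  then have "0 \<odot> x = 0 \<odot> x \<oplus> 0 \<odot> x"
    using smult_add_left[of x 0 0] by simp
  then show ?thesis by (metis add.r_cancel_one' smult_closed x)
qed

lemma smult_minus_one: "x \<in> carrier A \<Longrightarrow> (- 1) \<odot> x = \<ominus> x"
proof -
  assume x: "x \<in> carrier A"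
  then have "(- 1) \<odot> x \<oplus> x = \<zero>"
    using smult_add_left[of x "-1" 1] by (simp add: smult_one)
  then show ?thesis using x by (simp add: minus_equality)
qed

lemma finsum_smult:
  "f \<in> I \<rightarrow> carrier A \<Longrightarrow> c \<odot> (\<Oplus>i\<in>I. f i) = (\<Oplus>i\<in>I. c \<odot> f i)"
proof (induction I rule: infinite_finite_induct)
  case (insert i I)
  then show ?case by (simp add: smult_add_right Pi_iff)
qed (simp_all add: finsum_infinite)

lemma finsum_scalar:
  assumes "x \<in> carrier A" "finite I"
  shows "(\<Oplus>i\<in>I. c i \<odot> x) = (\<Sum>i\<in>I. c i) \<odot> x"
  using assms(2) by (induction I rule: finite_induct) (simp_all add: assms(1) smult_add_left Pi_iff)

lemma finsum_swap:
  assumes "finite I" "finite K" "\<And>i k. i \<in> I \<Longrightarrow> k \<in> K \<Longrightarrow> f i k \<in> carrier A"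
  shows "(\<Oplus>i\<in>I. \<Oplus>k\<in>K. f i k) = (\<Oplus>k\<in>K. \<Oplus>i\<in>I. f i k)"
  using assms(1,3)
proof (induction I rule: finite_induct)
  case empty
  then show ?case by simp
next
  case (insert i I)
  have "(\<Oplus>i\<in>insert i I. \<Oplus>k\<in>K. f i k) = (\<Oplus>k\<in>K. f i k) \<oplus> (\<Oplus>k\<in>K. \<Oplus>i\<in>I. f i k)"
    using insert by (simp add: Pi_iff)
  also have "\<dots> = (\<Oplus>k\<in>K. f i k \<oplus> (\<Oplus>i\<in>I. f i k))"
    using insert by (intro finsum_addf[symmetric]) (auto simp: Pi_iff)
  also have "\<dots> = (\<Oplus>k\<in>K. \<Oplus>i\<in>insert i I. f i k)"
    using insert by (intro finsum_cong') (auto simp: Pi_iff)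
  finally show ?case .
qed

lemma finsum_product:
  assumes "finite I" "finite K" "x \<in> I \<rightarrow> carrier A" "y \<in> K \<rightarrow> carrier A"
  shows "(\<Oplus>i\<in>I. c i \<odot> x i) \<otimes> (\<Oplus>k\<in>K. d k \<odot> y k)
       = (\<Oplus>i\<in>I. \<Oplus>k\<in>K. (c i * d k) \<odot> (x i \<otimes> y k))"
proof -
  have y: "(\<Oplus>k\<in>K. d k \<odot> y k) \<in> carrier A" using assms by (auto simp: Pi_iff)
  have "(\<Oplus>i\<in>I. c i \<odot> x i) \<otimes> (\<Oplus>k\<in>K. d k \<odot> y k)
      = (\<Oplus>i\<in>I. (c i \<odot> x i) \<otimes> (\<Oplus>k\<in>K. d k \<odot> y k))"
    using assms y by (intro finsum_ldistr) (auto simp: Pi_iff)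
  also have "\<dots> = (\<Oplus>i\<in>I. \<Oplus>k\<in>K. (c i \<odot> x i) \<otimes> (d k \<odot> y k))"
    using assms by (intro finsum_cong' finsum_rdistr) (auto simp: Pi_iff)
  also have "\<dots> = (\<Oplus>i\<in>I. \<Oplus>k\<in>K. (c i * d k) \<odot> (x i \<otimes> y k))"
    using assms by (intro finsum_cong')
      (auto simp: Pi_iff smult_mult_left smult_mult_right mult.commute simp flip: smult_smult)
  finally show ?thesis .
qed

lemma finsum_delta:
  assumes "finite I" "x \<in> I \<rightarrow> carrier A" "k \<in> I"
  shows "(\<Oplus>i\<in>I. (if k = i then c i else 0) \<odot> x i) = c k \<odot> x k"
proof -
  have "(\<Oplus>i\<in>I. (if k = i then c i else 0) \<odot> x i) = (\<Oplus>i\<in>I. if k = i then c i \<odot> x i else \<zero>)"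
    using assms by (intro finsum_cong') (auto simp: Pi_iff)
  also have "\<dots> = c k \<odot> x k"
    using assms by (intro finsum_singleton) (auto simp: Pi_iff)
  finally show ?thesis .
qed

end

section \<open>Characters of the Klein four-group and Fourier coefficients\<close>

lemma klein_char_orthogonal:
  assumes "i \<in> {1..4}" "k \<in> {1..4}"
  shows "(\<Sum>c\<in>{0..3}. klein_char c i * klein_char c k) = (if i = k then 4 else 0)"
proof -
  have sets: "{0..3::nat} = {0,1,2,3}" "{1..4::nat} = {1,2,3,4}" by auto
  show ?thesis using assms unfolding sets by (auto simp: klein_char_def)
qed

text \<open>All orderings of the three nontrivial characters; the product of any two of them is the
  third.\<close>

definition klein_triples :: "(nat \<times> nat \<times> nat) set" where
  "klein_triples = {(1,2,3), (2,1,3), (1,3,2), (3,1,2), (2,3,1), (3,2,1)}"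

lemma klein_triplesD:
  assumes "(p, q, e) \<in> klein_triples"
  shows "p \<in> {1,2,3}" "q \<in> {1,2,3}" "e \<in> {1,2,3}" "(p, e, q) \<in> klein_triples" "(q, e, p) \<in> klein_triples"
  using assms unfolding klein_triples_def by (elim insertE emptyE Pair_inject; hypsubst; simp)+

lemma klein_char_mult:
  assumes "(p, q, e) \<in> klein_triples" "i \<in> {1..4}"
  shows "klein_char p i * klein_char q i = klein_char e i"
proof -
  have "i \<in> {1,2,3,4}" using assms(2) by auto
  with assms(1) show ?thesis unfolding klein_triples_def
    by (elim insertE emptyE Pair_inject; hypsubst; simp add: klein_char_def)
qed

lemma klein_char_0: "klein_char 0 i = 1"
  by (simp add: klein_char_def)

lemma klein_char_self: "klein_char c i * klein_char c i = 1"
  by (simp add: klein_char_def)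

text \<open>Turns linear identities in the algebra into pointwise identities between coefficient
  functions.\<close>

definition entry_comb :: "'a cstar_struct \<Rightarrow> (nat \<Rightarrow> nat \<Rightarrow> 'a) \<Rightarrow> (nat \<Rightarrow> nat \<Rightarrow> complex) \<Rightarrow> 'a" where
  "entry_comb A u k = (\<Oplus>\<^bsub>A\<^esub>i\<in>{1..4}. \<Oplus>\<^bsub>A\<^esub>j\<in>{1..4}. k i j \<odot>\<^bsub>A\<^esub> u i j)"

text \<open>The factor 1/4 normalises the characters on both sides, so that the entry for the
  trivial characters is \<open>\<one>\<close>. Arbitrary functions are allowed because products of
  characters occur as arguments.\<close>

definition fourier_entry ::
    "'a cstar_struct \<Rightarrow> (nat \<Rightarrow> nat \<Rightarrow> 'a) \<Rightarrow> (nat \<Rightarrow> complex) \<Rightarrow> (nat \<Rightarrow> complex) \<Rightarrow> 'a" where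
  "fourier_entry A u f g = entry_comb A u (\<lambda>i j. f i * g j / 4)"

locale magic_unitary_4 = cstar_algebra A for A :: "'a cstar_struct" (structure) +
  fixes u :: "nat \<Rightarrow> nat \<Rightarrow> 'a"
  assumes magic: "magic_unitary 4 A u"
begin

lemma u_closed [simp, intro]: "i \<in> {1..4} \<Longrightarrow> j \<in> {1..4} \<Longrightarrow> u i j \<in> carrier A"
  using magic by (auto simp: magic_unitary_def projection_def)

lemma u_mult: "i \<in> {1..4} \<Longrightarrow> j \<in> {1..4} \<Longrightarrow> k \<in> {1..4} \<Longrightarrow>
    u i j \<otimes> u i k = (if j = k then u i j else \<zero>)"
  using magic by (auto simp: magic_unitary_def projection_def)

lemma u_sum: "i \<in> {1..4} \<Longrightarrow> (\<Oplus>j\<in>{1..4}. u i j) = \<one>"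
  using magic by (auto simp: magic_unitary_def)

lemma entry_comb_closed [simp, intro]: "entry_comb A u k \<in> carrier A"
  unfolding entry_comb_def by (intro finsum_closed Pi_I smult_closed) auto

lemma entry_comb_cong:
  "(\<And>i j. i \<in> {1..4} \<Longrightarrow> j \<in> {1..4} \<Longrightarrow> k i j = l i j) \<Longrightarrow> entry_comb A u k = entry_comb A u l"
  unfolding entry_comb_def by (intro finsum_cong' Pi_I finsum_closed smult_closed) auto

lemma entry_comb_add: "entry_comb A u k \<oplus> entry_comb A u l = entry_comb A u (\<lambda>i j. k i j + l i j)"
proof -
  have row: "(\<Oplus>j\<in>{1..4}. (k i j + l i j) \<odot> u i j)
      = (\<Oplus>j\<in>{1..4}. k i j \<odot> u i j) \<oplus> (\<Oplus>j\<in>{1..4}. l i j \<odot> u i j)" if "i \<in> {1..4}" for i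
  proof -
    have "(\<Oplus>j\<in>{1..4}. (k i j + l i j) \<odot> u i j) = (\<Oplus>j\<in>{1..4}. k i j \<odot> u i j \<oplus> l i j \<odot> u i j)"
      using that by (intro finsum_cong') (auto simp: smult_add_left)
    also have "\<dots> = (\<Oplus>j\<in>{1..4}. k i j \<odot> u i j) \<oplus> (\<Oplus>j\<in>{1..4}. l i j \<odot> u i j)"
      using that by (intro finsum_addf) auto
    finally show ?thesis .
  qed
  have "entry_comb A u (\<lambda>i j. k i j + l i j)
      = (\<Oplus>i\<in>{1..4}. (\<Oplus>j\<in>{1..4}. k i j \<odot> u i j) \<oplus> (\<Oplus>j\<in>{1..4}. l i j \<odot> u i j))"
    unfolding entry_comb_def
    by (rule finsum_cong'[OF refl _ row]) auto
  also have "\<dots> = entry_comb A u k \<oplus> entry_comb A u l"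
    unfolding entry_comb_def by (intro finsum_addf Pi_I finsum_closed smult_closed) auto
  finally show ?thesis by simp
qed

lemma entry_comb_smult: "c \<odot> entry_comb A u k = entry_comb A u (\<lambda>i j. c * k i j)"
proof -
  have "c \<odot> entry_comb A u k = (\<Oplus>i\<in>{1..4}. c \<odot> (\<Oplus>j\<in>{1..4}. k i j \<odot> u i j))"
    unfolding entry_comb_def by (intro finsum_smult Pi_I finsum_closed smult_closed) auto
  also have "\<dots> = entry_comb A u (\<lambda>i j. c * k i j)"
    unfolding entry_comb_def
    by (intro finsum_cong' Pi_I finsum_closed smult_closed, simp, simp, simp)
      (subst finsum_smult, auto simp: smult_smult intro!: finsum_cong')
  finally show ?thesis .
qed

lemma entry_comb_entry:
  assumes "k \<in> {1..4}" "l \<in> {1..4}"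
  shows "entry_comb A u (\<lambda>i j. if i = k \<and> j = l then 1 else 0) = u k l"
proof -
  have "(\<Oplus>j\<in>{1..4}. (if i = k \<and> j = l then 1 else 0) \<odot> u i j) = (if k = i then 1 else 0) \<odot> u i l"
    if "i \<in> {1..4}" for i
  proof -
    have "(\<Oplus>j\<in>{1..4}. (if i = k \<and> j = l then 1 else 0) \<odot> u i j)
        = (\<Oplus>j\<in>{1..4}. (if l = j then (if k = i then 1 else 0) else 0) \<odot> u i j)"
      using that by (intro finsum_cong') auto
    then show ?thesis using that assms finsum_delta[of "{1..4}" "u i" l "\<lambda>_. if k = i then 1 else 0"] by auto
  qed
  then have "entry_comb A u (\<lambda>i j. if i = k \<and> j = l then 1 else 0)
      = (\<Oplus>i\<in>{1..4}. (if k = i then 1 else 0) \<odot> u i l)"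
    unfolding entry_comb_def using assms by (intro finsum_cong') auto
  then show ?thesis
    using assms finsum_delta[of "{1..4}" "\<lambda>i. u i l" k "\<lambda>_. 1"] by (auto simp: smult_one)
qed

lemma entry_comb_transpose: "entry_comb A (\<lambda>i j. u j i) k = entry_comb A u (\<lambda>i j. k j i)"
  unfolding entry_comb_def by (rule finsum_swap) auto

definition row :: "(nat \<Rightarrow> complex) \<Rightarrow> nat \<Rightarrow> 'a" where
  "row g i = (\<Oplus>j\<in>{1..4}. g j \<odot> u i j)"

lemma row_closed [simp, intro]: "i \<in> {1..4} \<Longrightarrow> row g i \<in> carrier A"
  unfolding row_def by (intro finsum_closed Pi_I smult_closed) auto

text \<open>The entries of a row are orthogonal projections, so applying functions to a row is
  multiplicative.\<close>

lemma row_mult: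
  assumes i: "i \<in> {1..4}"
  shows "row g i \<otimes> row g' i = row (\<lambda>j. g j * g' j) i"
proof -
  have "row g i \<otimes> row g' i = (\<Oplus>j\<in>{1..4}. \<Oplus>k\<in>{1..4}. (g j * g' k) \<odot> (u i j \<otimes> u i k))"
    unfolding row_def using i by (intro finsum_product) auto
  also have "\<dots> = (\<Oplus>j\<in>{1..4}. (g j * g' j) \<odot> u i j)"
  proof (intro finsum_cong' refl)
    fix j :: nat assume j: "j \<in> {1..4}"
    have "(\<Oplus>k\<in>{1..4}. (g j * g' k) \<odot> (u i j \<otimes> u i k))
        = (\<Oplus>k\<in>{1..4}. (if j = k then g j * g' k else 0) \<odot> u i k)"
      using i j by (intro finsum_cong') (auto simp: u_mult)
    then show "(\<Oplus>k\<in>{1..4}. (g j * g' k) \<odot> (u i j \<otimes> u i k)) = (g j * g' j) \<odot> u i j"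
      using i j by (simp add: finsum_delta Pi_iff)
  qed (use i in auto)
  finally show ?thesis by (simp add: row_def)
qed

lemma fourier_entry_row: "fourier_entry A u f g = (\<Oplus>i\<in>{1..4}. (f i / 4) \<odot> row g i)"
  unfolding fourier_entry_def entry_comb_def
proof (intro finsum_cong' refl)
  fix i :: nat assume i: "i \<in> {1..4}"
  show "(\<Oplus>j\<in>{1..4}. (f i * g j / 4) \<odot> u i j) = (f i / 4) \<odot> row g i"
    unfolding row_def using i
    by (subst finsum_smult) (auto simp flip: smult_smult intro!: finsum_cong')
qed auto

text \<open>Source of all quadratic relations. Orthogonality of the characters collapses the double
  sum over the rows i and k to i = k, where \<open>row_mult\<close> applies.\<close>

lemma fourier_convolution:
  "(\<Oplus>c\<in>{0..3}. fourier_entry A u (\<lambda>i. klein_char c i * f i) g \<otimes> fourier_entry A u (klein_char c) g')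
    = fourier_entry A u f (\<lambda>j. g j * g' j)"
proof -
  define z where "z i k = row g i \<otimes> row g' k" for i k
  have z [simp, intro]: "i \<in> {1..4} \<Longrightarrow> k \<in> {1..4} \<Longrightarrow> z i k \<in> carrier A" for i k
    by (simp add: z_def)
  define co where "co c i k = klein_char c i * f i / 4 * (klein_char c k / 4)" for c i k
  have "fourier_entry A u (\<lambda>i. klein_char c i * f i) g \<otimes> fourier_entry A u (klein_char c) g'
      = (\<Oplus>i\<in>{1..4}. \<Oplus>k\<in>{1..4}. co c i k \<odot> z i k)" for c
    unfolding fourier_entry_row z_def co_def by (intro finsum_product) auto
  then have "(\<Oplus>c\<in>{0..3}. fourier_entry A u (\<lambda>i. klein_char c i * f i) g \<otimes> fourier_entry A u (klein_char c) g')
      = (\<Oplus>c\<in>{0..3::nat}. \<Oplus>i\<in>{1..4}. \<Oplus>k\<in>{1..4}. co c i k \<odot> z i k)"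
    by simp
  also have "\<dots> = (\<Oplus>i\<in>{1..4}. \<Oplus>c\<in>{0..3::nat}. \<Oplus>k\<in>{1..4}. co c i k \<odot> z i k)"
    by (rule finsum_swap) auto
  also have "\<dots> = (\<Oplus>i\<in>{1..4}. \<Oplus>k\<in>{1..4}. \<Oplus>c\<in>{0..3::nat}. co c i k \<odot> z i k)"
    by (intro finsum_cong' refl finsum_swap) auto
  also have "\<dots> = (\<Oplus>i\<in>{1..4}. \<Oplus>k\<in>{1..4}. (if i = k then f i / 4 else 0) \<odot> z i k)"
  proof (intro finsum_cong' refl)
    fix i k :: nat assume ik: "i \<in> {1..4}" "k \<in> {1..4}"
    have "(\<Sum>c\<in>{0..3}. co c i k) = f i / 16 * (\<Sum>c\<in>{0..3}. klein_char c i * klein_char c k)"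
      by (simp add: co_def sum_distrib_left mult_ac)
    also have "\<dots> = (if i = k then f i / 4 else 0)"
      using klein_char_orthogonal[OF ik] by simp
    finally show "(\<Oplus>c\<in>{0..3::nat}. co c i k \<odot> z i k) = (if i = k then f i / 4 else 0) \<odot> z i k"
      using ik by (simp add: finsum_scalar)
  qed auto
  also have "\<dots> = (\<Oplus>i\<in>{1..4}. (f i / 4) \<odot> z i i)"
    by (intro finsum_cong' refl finsum_delta) auto
  also have "\<dots> = fourier_entry A u f (\<lambda>j. g j * g' j)"
    unfolding fourier_entry_row z_def by (intro finsum_cong') (auto simp: row_mult)
  finally show ?thesis .
qed

abbreviation a :: "nat \<Rightarrow> nat \<Rightarrow> 'a" where
  "a c d \<equiv> fourier_entry A u (klein_char c) (klein_char d)"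

lemma fourier_entry_closed [simp, intro]: "fourier_entry A u f g \<in> carrier A"
  by (simp add: fourier_entry_def)

lemma fourier_entry_cong:
  "(\<And>i. i \<in> {1..4} \<Longrightarrow> f i = f' i) \<Longrightarrow> (\<And>i. i \<in> {1..4} \<Longrightarrow> g i = g' i) \<Longrightarrow>
    fourier_entry A u f g = fourier_entry A u f' g'"
  unfolding fourier_entry_def by (intro entry_comb_cong) auto

lemma row_const: "i \<in> {1..4} \<Longrightarrow> row (klein_char 0) i = \<one>"
proof -
  assume i: "i \<in> {1..4}"
  then have "row (klein_char 0) i = (\<Oplus>j\<in>{1..4}. u i j)"
    unfolding row_def by (intro finsum_cong') (auto simp: klein_char_0 smult_one)
  then show ?thesis using u_sum[OF i] by simp
qed

lemma sum_klein_char: "c \<in> {1,2,3} \<Longrightarrow> (\<Sum>i\<in>{1..4}. klein_char c i) = 0"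
  unfolding sum_upto_4 by (elim insertE emptyE; hypsubst; simp add: klein_char_def)

lemma a_0_0: "a 0 0 = \<one>"
proof -
  have "a 0 0 = (\<Oplus>i\<in>{1..4::nat}. (1 / 4) \<odot> \<one>)"
    unfolding fourier_entry_row by (intro finsum_cong') (auto simp: row_const klein_char_def[of 0])
  then show ?thesis by (simp add: finsum_scalar smult_one)
qed

lemma a_c_0: "c \<in> {1,2,3} \<Longrightarrow> a c 0 = \<zero>"
proof -
  assume c: "c \<in> {1,2,3}"
  have "a c 0 = (\<Oplus>i\<in>{1..4::nat}. (klein_char c i / 4) \<odot> \<one>)"
    unfolding fourier_entry_row by (intro finsum_cong') (auto simp: row_const)
  then show ?thesis using sum_klein_char[OF c] by (simp add: finsum_scalar flip: sum_divide_distrib)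
qed

end

text \<open>Every relation proved for columns thereby becomes a relation for rows.\<close>

lemma (in magic_unitary_4) magic_unitary_transpose: "magic_unitary_4 A (\<lambda>i j. u j i)"
  by unfold_locales (use magic in \<open>auto simp: magic_unitary_def\<close>)

lemma (in magic_unitary_4) fourier_entry_transpose:
  "fourier_entry A (\<lambda>i j. u j i) f g = fourier_entry A u g f"
  by (simp add: fourier_entry_def entry_comb_transpose mult.commute)

context magic_unitary_4
begin

lemma a_0_d: "d \<in> {1,2,3} \<Longrightarrow> a 0 d = \<zero>"
  using magic_unitary_4.a_c_0[OF magic_unitary_transpose, of d] by (simp add: fourier_entry_transpose)

text \<open>In the convolution formula for chi_e the terms c = 0 and c = e contain the vanishing
  entries \<open>a 0 d'\<close> and \<open>a 0 d\<close>; the terms c = p and c = q remain.\<close>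

lemma column_relation:
  assumes "(p, q, e) \<in> klein_triples" "d \<in> {1,2,3}" "d' \<in> {1,2,3}"
  shows "a p d \<otimes> a q d' \<oplus> a q d \<otimes> a p d' = fourier_entry A u (klein_char e) (\<lambda>j. klein_char d j * klein_char d' j)"
proof -
  have sets: "{0..3::nat} = {0,1,2,3}" by auto
  note perms = klein_triplesD(4,5)[OF assms(1)]
  have a: "fourier_entry A u (\<lambda>i. klein_char 0 i * klein_char e i) (klein_char d) = a e d"
    "fourier_entry A u (\<lambda>i. klein_char p i * klein_char e i) (klein_char d) = a q d"
    "fourier_entry A u (\<lambda>i. klein_char q i * klein_char e i) (klein_char d) = a p d"
    "fourier_entry A u (\<lambda>i. klein_char e i * klein_char e i) (klein_char d) = a 0 d"
    by (intro fourier_entry_cong refl klein_char_mult[OF perms(1)] klein_char_mult[OF perms(2)];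
        simp add: klein_char_0 klein_char_self)+
  have pqe: "(\<Oplus>c\<in>{0..3}. F c) = F 0 \<oplus> (F p \<oplus> (F q \<oplus> F e))" if "\<And>c. F c \<in> carrier A" for F :: "nat \<Rightarrow> 'a"
  proof -
    have "(\<Oplus>c\<in>{0..3}. F c) = F 0 \<oplus> (F 1 \<oplus> (F 2 \<oplus> F 3))"
      unfolding sets using that by simp
    then show ?thesis
      using assms(1) that unfolding klein_triples_def
      by (elim insertE emptyE Pair_inject; hypsubst; simp add: a_ac)
  qed
  have "fourier_entry A u (klein_char e) (\<lambda>j. klein_char d j * klein_char d' j)
      = a e d \<otimes> a 0 d' \<oplus> (a q d \<otimes> a p d' \<oplus> (a p d \<otimes> a q d' \<oplus> a 0 d \<otimes> a e d'))"
    unfolding fourier_convolution[symmetric] by (subst pqe) (simp_all add: a)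
  then show ?thesis using assms(2,3) by (simp add: a_0_d a_comm)
qed

lemma column_squares:
  assumes "d \<in> {1,2,3}"
  shows "a 1 d \<otimes> a 1 d \<oplus> (a 2 d \<otimes> a 2 d \<oplus> a 3 d \<otimes> a 3 d) = \<one>"
proof -
  have sets: "{0..3::nat} = {0,1,2,3}" by auto
  have a: "fourier_entry A u (\<lambda>i. klein_char c i * klein_char 0 i) (klein_char d) = a c d" for c
    by (intro fourier_entry_cong) (auto simp: klein_char_0 klein_char_self)
  have one: "fourier_entry A u (klein_char 0) (\<lambda>j. klein_char d j * klein_char d j) = a 0 0"
    by (intro fourier_entry_cong) (auto simp: klein_char_0 klein_char_self)
  have "a 0 0 = a 0 d \<otimes> a 0 d \<oplus> (a 1 d \<otimes> a 1 d \<oplus> (a 2 d \<otimes> a 2 d \<oplus> a 3 d \<otimes> a 3 d))"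
    unfolding one[symmetric] fourier_convolution[symmetric] by (simp add: sets a)
  then show ?thesis using assms by (simp add: a_0_d a_0_0)
qed

lemma row_relation:
  assumes "(p, q, e) \<in> klein_triples" "c \<in> {1,2,3}" "c' \<in> {1,2,3}"
  shows "a c p \<otimes> a c' q \<oplus> a c q \<otimes> a c' p = fourier_entry A u (\<lambda>j. klein_char c j * klein_char c' j) (klein_char e)"
  using magic_unitary_4.column_relation[OF magic_unitary_transpose assms]
  by (simp add: fourier_entry_transpose)

lemma row_squares:
  assumes "c \<in> {1,2,3}"
  shows "a c 1 \<otimes> a c 1 \<oplus> (a c 2 \<otimes> a c 2 \<oplus> a c 3 \<otimes> a c 3) = \<one>"
  using magic_unitary_4.column_squares[OF magic_unitary_transpose assms]
  by (simp add: fourier_entry_transpose)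

lemma klein_char_square: "fourier_entry A u f (\<lambda>j. klein_char d j * klein_char d j) = fourier_entry A u f (klein_char 0)"
    "fourier_entry A u (\<lambda>j. klein_char d j * klein_char d j) f = fourier_entry A u (klein_char 0) f"
  by (simp_all add: klein_char_0 klein_char_self fun_eq_iff cong: fourier_entry_cong)

text \<open>For equal columns the product of the two column characters is trivial, so the right-hand
  side of \<open>column_relation\<close> is the vanishing entry \<open>a e 0\<close>.\<close>

lemma column_anticommute:
  assumes "(p, q, e) \<in> klein_triples" "d \<in> {1,2,3}"
  shows "a p d \<otimes> a q d = \<ominus> (a q d \<otimes> a p d)"
proof -
  have "a p d \<otimes> a q d \<oplus> a q d \<otimes> a p d = a e 0"
    using column_relation[OF assms(1,2,2)] by (simp add: klein_char_square)
  also have "\<dots> = \<zero>" using klein_triplesD(3)[OF assms(1)] by (rule a_c_0)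
  finally show ?thesis by (simp add: minus_equality)
qed

lemma row_anticommute:
  assumes "(p, q, e) \<in> klein_triples" "c \<in> {1,2,3}"
  shows "a c p \<otimes> a c q = \<ominus> (a c q \<otimes> a c p)"
  using magic_unitary_4.column_anticommute[OF magic_unitary_transpose assms]
  by (simp add: fourier_entry_transpose)

text \<open>Twisted cofactor formula: the twist turns the determinant signs into plus signs. The
  column and the row relation express the same entry and differ only in the order of one product,
  which gives the commutation.\<close>

lemma minor_relations:
  assumes "(p, q, e) \<in> klein_triples" "(r, s, g) \<in> klein_triples"
  shows "a p r \<otimes> a q s \<oplus> a q r \<otimes> a p s = a e g"
    and "a q r \<otimes> a p s = a p s \<otimes> a q r"
proof -
  have "a p r \<otimes> a q s \<oplus> a q r \<otimes> a p s = fourier_entry A u (klein_char e) (\<lambda>j. klein_char r j * klein_char s j)"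
    using assms klein_triplesD[OF assms(2)] by (intro column_relation)
  also have "\<dots> = a e g"
    using assms(2) by (intro fourier_entry_cong refl klein_char_mult)
  finally show 1: "a p r \<otimes> a q s \<oplus> a q r \<otimes> a p s = a e g" .
  have "a p r \<otimes> a q s \<oplus> a p s \<otimes> a q r = fourier_entry A u (\<lambda>j. klein_char p j * klein_char q j) (klein_char g)"
    using assms klein_triplesD[OF assms(1)] by (intro row_relation)
  also have "\<dots> = a e g"
    using assms(1) by (intro fourier_entry_cong refl klein_char_mult)
  finally have "a p r \<otimes> a q s \<oplus> a q r \<otimes> a p s = a p r \<otimes> a q s \<oplus> a p s \<otimes> a q r"
    using 1 by simp
  then show "a q r \<otimes> a p s = a p s \<otimes> a q r" by simp
qed

end

section \<open>The elements S, C, D and their relations\<close>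

context magic_unitary_4
begin

definition elem_s :: 'a where "elem_s = \<one> \<oplus> a 1 1"
definition elem_c :: 'a where "elem_c = a 2 2 \<oplus> a 3 3"
definition elem_d :: 'a where "elem_d = a 2 3 \<oplus> a 3 2"

lemma elem_closed [simp, intro]: "elem_s \<in> carrier A" "elem_c \<in> carrier A" "elem_d \<in> carrier A"
  by (simp_all add: elem_s_def elem_c_def elem_d_def)

lemma elem_s_commute: "elem_s \<otimes> elem_c = elem_c \<otimes> elem_s" "elem_s \<otimes> elem_d = elem_d \<otimes> elem_s"
proof -
  have "a 1 1 \<otimes> a 2 2 = a 2 2 \<otimes> a 1 1" "a 1 1 \<otimes> a 3 3 = a 3 3 \<otimes> a 1 1"
    "a 1 1 \<otimes> a 2 3 = a 2 3 \<otimes> a 1 1" "a 1 1 \<otimes> a 3 2 = a 3 2 \<otimes> a 1 1"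
    by (rule minor_relations(2)[of 2 1 3 1 2 3] minor_relations(2)[of 3 1 2 1 3 2]
        minor_relations(2)[of 2 1 3 1 3 2] minor_relations(2)[of 3 1 2 1 2 3]; simp add: klein_triples_def)+
  then show "elem_s \<otimes> elem_c = elem_c \<otimes> elem_s" "elem_s \<otimes> elem_d = elem_d \<otimes> elem_s"
    by (simp_all add: elem_s_def elem_c_def elem_d_def l_distr r_distr a_ac)
qed

lemma elem_c_d_anticommute: "elem_c \<otimes> elem_d = \<ominus> (elem_d \<otimes> elem_c)"
proof -
  have "a 2 2 \<otimes> a 2 3 = \<ominus> (a 2 3 \<otimes> a 2 2)" "a 3 3 \<otimes> a 3 2 = \<ominus> (a 3 2 \<otimes> a 3 3)"
    by (rule row_anticommute[of 2 3 1] row_anticommute[of 3 2 1]; simp add: klein_triples_def)+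
  moreover have "a 2 2 \<otimes> a 3 2 = \<ominus> (a 3 2 \<otimes> a 2 2)" "a 3 3 \<otimes> a 2 3 = \<ominus> (a 2 3 \<otimes> a 3 3)"
    by (rule column_anticommute[of 2 3 1] column_anticommute[of 3 2 1]; simp add: klein_triples_def)+
  ultimately show ?thesis
    by (simp add: elem_c_def elem_d_def l_distr r_distr minus_add a_ac)
qed

text \<open>The mixed products add up to twice the minor, which is 2 p for p = \<open>a 1 1\<close>.
  Rows 2 and 3 together with column 1 give 1 + p^2 for the sum of the four squares. The total is (1
  + p)^2.\<close>

lemma elem_squares: "elem_c \<otimes> elem_c \<oplus> elem_d \<otimes> elem_d = elem_s \<otimes> elem_s"
proof -
  define x y z w where "x = a 2 2" and "y = a 2 3" and "z = a 3 2" and "w = a 3 3"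
  define p b c where "p = a 1 1" and "b = a 2 1 \<otimes> a 2 1" and "c = a 3 1 \<otimes> a 3 1"
  have closed [simp]: "x \<in> carrier A" "y \<in> carrier A" "z \<in> carrier A" "w \<in> carrier A" "p \<in> carrier A"
    "b \<in> carrier A" "c \<in> carrier A" by (auto simp: x_def y_def z_def w_def p_def b_def c_def)
  have comm: "w \<otimes> x = x \<otimes> w" "y \<otimes> z = z \<otimes> y"
    unfolding x_def y_def z_def w_def
    by (rule minor_relations(2)[of 2 3 1 3 2 1] minor_relations(2)[of 3 2 1 3 2 1]; simp add: klein_triples_def)+
  have minor: "x \<otimes> w \<oplus> z \<otimes> y = p"
    unfolding x_def y_def z_def w_def p_def
    by (rule minor_relations(1)[of 2 3 1 2 3 1]) (simp_all add: klein_triples_def)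
  have rows: "b \<oplus> (x \<otimes> x \<oplus> y \<otimes> y) = \<one>" "c \<oplus> (z \<otimes> z \<oplus> w \<otimes> w) = \<one>"
    unfolding b_def c_def x_def y_def z_def w_def by (rule row_squares; simp)+
  have col: "p \<otimes> p \<oplus> (b \<oplus> c) = \<one>"
    unfolding b_def c_def p_def by (rule column_squares) simp
  have "(x \<otimes> x \<oplus> y \<otimes> y \<oplus> (z \<otimes> z \<oplus> w \<otimes> w)) \<oplus> (b \<oplus> c)
      = (b \<oplus> (x \<otimes> x \<oplus> y \<otimes> y)) \<oplus> (c \<oplus> (z \<otimes> z \<oplus> w \<otimes> w))"
    by (simp add: a_ac)
  also have "\<dots> = (\<one> \<oplus> p \<otimes> p) \<oplus> (b \<oplus> c)"
    unfolding rows by (subst (2) col[symmetric]) (simp add: a_ac)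
  finally have sq: "x \<otimes> x \<oplus> y \<otimes> y \<oplus> (z \<otimes> z \<oplus> w \<otimes> w) = \<one> \<oplus> p \<otimes> p"
    by simp
  have "elem_c \<otimes> elem_c \<oplus> elem_d \<otimes> elem_d
      = (x \<otimes> x \<oplus> y \<otimes> y \<oplus> (z \<otimes> z \<oplus> w \<otimes> w)) \<oplus> ((x \<otimes> w \<oplus> z \<otimes> y) \<oplus> (x \<otimes> w \<oplus> z \<otimes> y))"
    unfolding elem_c_def elem_d_def x_def[symmetric] y_def[symmetric] z_def[symmetric] w_def[symmetric]
    by (simp add: l_distr r_distr comm a_ac)
  also have "\<dots> = elem_s \<otimes> elem_s"
    unfolding sq minor elem_s_def p_def[symmetric] by (simp add: l_distr r_distr a_ac)
  finally show ?thesis .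
qed

text \<open>The vanishing entries \<open>a 0 1\<close> and \<open>a 1 0\<close> are added to \<open>elem_d\<close> in order to turn the
  identity into one between coefficients.\<close>

lemma diagonal_combination:
  "complex_of_real ((1 + t) / 4) \<odot> (u 1 1 \<oplus> u 2 2) \<oplus> complex_of_real ((1 - t) / 4) \<odot> (u 3 3 \<oplus> u 4 4)
    = (1/4) \<odot> (elem_s \<oplus> (elem_c \<oplus> complex_of_real t \<odot> elem_d))" (is "?l = ?r")
proof -
  define T where "T = complex_of_real t"
  have u: "u i i = entry_comb A u (\<lambda>k l. if k = i \<and> l = i then 1 else 0)" if "i \<in> {1..4}" for i
    using entry_comb_entry that by simp
  have l: "?l = entry_comb A u (\<lambda>i j. if i = j then if i = 1 \<or> i = 2 then (1 + T) / 4
      else if i = 3 \<or> i = 4 then (1 - T) / 4 else 0 else 0)"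
    using u[of 1] u[of 2] u[of 3] u[of 4]
    by (simp add: entry_comb_add entry_comb_smult) (auto intro!: entry_comb_cong simp: T_def)
  have d: "elem_d = (a 2 3 \<oplus> a 3 2) \<oplus> (a 0 1 \<oplus> a 1 0)"
    by (simp add: elem_d_def a_0_d a_c_0)
  have r: "?r = entry_comb A u (\<lambda>i j. ((klein_char 0 i * klein_char 0 j + klein_char 1 i * klein_char 1 j
      + klein_char 2 i * klein_char 2 j + klein_char 3 i * klein_char 3 j)
      + T * (klein_char 2 i * klein_char 3 j + klein_char 3 i * klein_char 2 j
             + klein_char 0 i * klein_char 1 j + klein_char 1 i * klein_char 0 j)) / 16)"
    unfolding elem_s_def elem_c_def d a_0_0[symmetric] fourier_entry_def
    by (simp add: entry_comb_add entry_comb_smult T_def algebra_simps add_divide_distrib)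
  show ?thesis
    unfolding l r
  proof (rule entry_comb_cong)
    fix i j :: nat assume "i \<in> {1..4}" "j \<in> {1..4}"
    then have "i \<in> {1,2,3,4}" "j \<in> {1,2,3,4}" by auto
    then show "(if i = j then if i = 1 \<or> i = 2 then (1 + T) / 4
      else if i = 3 \<or> i = 4 then (1 - T) / 4 else 0 else 0) =
      ((klein_char 0 i * klein_char 0 j + klein_char 1 i * klein_char 1 j
      + klein_char 2 i * klein_char 2 j + klein_char 3 i * klein_char 3 j)
      + T * (klein_char 2 i * klein_char 3 j + klein_char 3 i * klein_char 2 j
             + klein_char 0 i * klein_char 1 j + klein_char 1 i * klein_char 0 j)) / 16"
      by (elim insertE emptyE; hypsubst; simp add: klein_char_def; simp add: divide_simps)
  qed
qed

end

section \<open>A twisted derivation annihilated by the Haar functional\<close>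

definition linear_functional :: "'a cstar_struct \<Rightarrow> ('a \<Rightarrow> complex) \<Rightarrow> bool" where
  "linear_functional A l \<longleftrightarrow>
     (\<forall>x\<in>carrier A. \<forall>y\<in>carrier A. l (x \<oplus>\<^bsub>A\<^esub> y) = l x + l y) \<and>
     (\<forall>c. \<forall>x\<in>carrier A. l (c \<odot>\<^bsub>A\<^esub> x) = c * l x)"

definition matrix_pairing :: "'a cstar_struct \<Rightarrow> ('a \<Rightarrow> complex^2^2 \<Rightarrow> complex) \<Rightarrow> bool" where
  "matrix_pairing A \<beta> \<longleftrightarrow>
     (\<forall>m. linear_functional A (\<lambda>x. \<beta> x m)) \<and>
     (\<forall>x\<in>carrier A. (\<forall>m n. \<beta> x (m + n) = \<beta> x m + \<beta> x n) \<and> (\<forall>c m. \<beta> x (matrix_smult c m) = c * \<beta> x m))"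

context cstar_algebra
begin

lemma linear_functional_zero: "linear_functional A l \<Longrightarrow> l \<zero> = 0"
  unfolding linear_functional_def using smult_zero_left[of \<zero>] by (metis mult_zero_left zero_closed)

lemma linear_functional_minus:
  assumes "linear_functional A l" "x \<in> carrier A" "y \<in> carrier A"
  shows "l (x \<ominus> y) = l x - l y"
proof -
  have "x \<ominus> y = x \<oplus> (- 1) \<odot> y" using assms by (simp add: minus_eq smult_minus_one)
  then show ?thesis using assms unfolding linear_functional_def by simp
qed

lemma linear_functional_finsum:
  assumes "linear_functional A l" "f \<in> I \<rightarrow> carrier A" "finite I"
  shows "l (\<Oplus>i\<in>I. f i) = (\<Sum>i\<in>I. l (f i))"
  using assms(3,2)
proof (induction I rule: finite_induct)
  case empty
  then show ?case using assms(1) by (simp add: linear_functional_zero)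
next
  case (insert i I)
  then show ?case using assms(1) by (simp add: linear_functional_def Pi_iff)
qed

lemma linear_functional_mult:
  assumes "linear_functional A l" "x \<in> carrier A"
  shows "linear_functional A (\<lambda>y. l (x \<otimes> y))"
  using assms unfolding linear_functional_def by (simp add: r_distr smult_mult_right)

end

lemma (in magic_unitary_4) linear_functional_entry_comb:
  assumes "linear_functional A l"
  shows "l (entry_comb A u k) = (\<Sum>i\<in>{1..4}. \<Sum>j\<in>{1..4}. k i j * l (u i j))"
proof -
  have "l (entry_comb A u k) = (\<Sum>i\<in>{1..4}. l (\<Oplus>j\<in>{1..4}. k i j \<odot> u i j))"
    unfolding entry_comb_def
    by (intro linear_functional_finsum assms Pi_I finsum_closed smult_closed) auto
  also have "\<dots> = (\<Sum>i\<in>{1..4}. \<Sum>j\<in>{1..4}. l (k i j \<odot> u i j))"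
    by (intro sum.cong refl linear_functional_finsum assms Pi_I smult_closed) auto
  also have "\<dots> = (\<Sum>i\<in>{1..4}. \<Sum>j\<in>{1..4}. k i j * l (u i j))"
    using assms by (intro sum.cong refl) (auto simp: linear_functional_def)
  finally show ?thesis .
qed

lemma matrix_pairing_sum:
  assumes "matrix_pairing A \<beta>" "x \<in> carrier A" "finite I"
  shows "\<beta> x (\<Sum>i\<in>I. matrix_smult (c i) (m i)) = (\<Sum>i\<in>I. c i * \<beta> x (m i))"
  using assms(3)
proof (induction I rule: finite_induct)
  case empty
  have "\<beta> x (matrix_smult 0 0) = 0 * \<beta> x 0"
    using assms(1,2) unfolding matrix_pairing_def by blast
  moreover have "matrix_smult 0 0 = (0 :: complex^2^2)" by (simp add: matrix_smult_def vec_eq_iff)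
  ultimately show ?case by simp
next
  case (insert i I)
  then show ?case using assms(1,2) by (simp add: matrix_pairing_def)
qed

text \<open>A letter \<open>(x, None)\<close> is even and has derivative \<open>0\<close>; a letter \<open>(x, Some y)\<close> is odd, has derivative
  \<open>y\<close> and changes the sign of the derivation passing over it.\<close>

context cstar_algebra
begin

primrec word_value :: "('a \<times> 'a option) list \<Rightarrow> 'a" where
  "word_value [] = \<one>"
| "word_value (l # w) = fst l \<otimes> word_value w"

primrec word_deriv :: "('a \<times> 'a option) list \<Rightarrow> 'a" where
  "word_deriv [] = \<zero>"
| "word_deriv (l # w) = (case snd l of None \<Rightarrow> fst l \<otimes> word_deriv w
     | Some y \<Rightarrow> y \<otimes> word_value w \<ominus> fst l \<otimes> word_deriv w)"

primrec odd_count :: "('a \<times> 'a option) list \<Rightarrow> nat" where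
  "odd_count [] = 0"
| "odd_count (l # w) = (case snd l of None \<Rightarrow> odd_count w | Some y \<Rightarrow> Suc (odd_count w))"

definition letter_closed :: "'a \<times> 'a option \<Rightarrow> bool" where
  "letter_closed l \<longleftrightarrow> fst l \<in> carrier A \<and> (\<forall>y. snd l = Some y \<longrightarrow> y \<in> carrier A)"

lemma word_closed [simp]:
  "\<forall>l\<in>set w. letter_closed l \<Longrightarrow> word_value w \<in> carrier A"
  "\<forall>l\<in>set w. letter_closed l \<Longrightarrow> word_deriv w \<in> carrier A"
proof -
  have *: "\<forall>l\<in>set w. letter_closed l \<Longrightarrow> word_value w \<in> carrier A" for w
    by (induction w) (auto simp: letter_closed_def)
  then show "\<forall>l\<in>set w. letter_closed l \<Longrightarrow> word_value w \<in> carrier A" .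
  show "\<forall>l\<in>set w. letter_closed l \<Longrightarrow> word_deriv w \<in> carrier A"
  proof (induction w)
    case (Cons l w)
    then show ?case using *[of w] by (auto simp: letter_closed_def split: option.split)
  qed simp
qed

end

text \<open>Here \<open>L\<close> is the slice map h \<otimes> id, and \<open>L_Delta\<close> is the
  resulting form of invariance; the free leg is the second one, on which the rotations act.\<close>

locale haar_4 = magic_unitary_4 A u + C: cstar_algebra C
  for A :: "'a cstar_struct" (structure) and u and C :: "'c cstar_struct" +
  fixes \<tau> :: "'a \<Rightarrow> 'a \<Rightarrow> 'c" and \<Delta> :: "'a \<Rightarrow> 'c" and h :: "'a \<Rightarrow> complex" and L :: "'c \<Rightarrow> 'a"
  assumes universal: "is_A_s 4 A u"
    and tau_closed [simp, intro]: "x \<in> carrier A \<Longrightarrow> y \<in> carrier A \<Longrightarrow> \<tau> x y \<in> carrier C"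
    and tau_mult: "\<lbrakk>x \<in> carrier A; x' \<in> carrier A; y \<in> carrier A; y' \<in> carrier A\<rbrakk> \<Longrightarrow>
      \<tau> x y \<otimes>\<^bsub>C\<^esub> \<tau> x' y' = \<tau> (x \<otimes> x') (y \<otimes> y')"
    and tau_one: "\<tau> \<one> \<one> = \<one>\<^bsub>C\<^esub>"
    and Delta_hom: "unital_star_hom A C \<Delta>"
    and Delta_u: "\<lbrakk>i \<in> {1..4}; j \<in> {1..4}\<rbrakk> \<Longrightarrow> \<Delta> (u i j) = (\<Oplus>\<^bsub>C\<^esub>k\<in>{1..4}. \<tau> (u i k) (u k j))"
    and h_linear: "linear_functional A h"
    and h_one: "h \<one> = 1"
    and L_closed [simp, intro]: "z \<in> carrier C \<Longrightarrow> L z \<in> carrier A"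
    and L_add: "\<lbrakk>z \<in> carrier C; z' \<in> carrier C\<rbrakk> \<Longrightarrow> L (z \<oplus>\<^bsub>C\<^esub> z') = L z \<oplus> L z'"
    and L_smult: "z \<in> carrier C \<Longrightarrow> L (c \<odot>\<^bsub>C\<^esub> z) = c \<odot> L z"
    and L_tau: "\<lbrakk>x \<in> carrier A; y \<in> carrier A\<rbrakk> \<Longrightarrow> L (\<tau> x y) = h x \<odot> y"
    and L_Delta: "x \<in> carrier A \<Longrightarrow> L (\<Delta> x) = h x \<odot> \<one>"
begin

lemma Delta_simps:
  "x \<in> carrier A \<Longrightarrow> \<Delta> x \<in> carrier C"
  "x \<in> carrier A \<Longrightarrow> y \<in> carrier A \<Longrightarrow> \<Delta> (x \<oplus> y) = \<Delta> x \<oplus>\<^bsub>C\<^esub> \<Delta> y"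
  "x \<in> carrier A \<Longrightarrow> y \<in> carrier A \<Longrightarrow> \<Delta> (x \<otimes> y) = \<Delta> x \<otimes>\<^bsub>C\<^esub> \<Delta> y"
  "x \<in> carrier A \<Longrightarrow> \<Delta> (c \<odot> x) = c \<odot>\<^bsub>C\<^esub> \<Delta> x"
  "\<Delta> \<one> = \<one>\<^bsub>C\<^esub>"
  using Delta_hom unfolding unital_star_hom_def by (auto simp: ring_hom_def)

lemmas h_simps = h_linear[unfolded linear_functional_def, THEN conjunct1, rule_format]
  h_linear[unfolded linear_functional_def, THEN conjunct2, rule_format]

section \<open>Rotation of the second leg of the coproduct\<close>

definition rotation_rep :: "nat \<Rightarrow> nat \<Rightarrow> real \<Rightarrow> ('a \<Rightarrow> complex^2^2) \<Rightarrow> bool" where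
  "rotation_rep e f \<theta> \<Phi> \<longleftrightarrow> matrix_rep A \<Phi> \<and>
     (\<forall>i\<in>{1..4}. \<forall>j\<in>{1..4}. \<Phi> (u i j) = rotation_model e f \<theta> i j)"

text \<open>\<open>\<Lambda>\<close> plays the role of \<open>id \<otimes> \<Phi>\<close> followed by \<open>\<beta>\<close>. It only has to be linear with the right values on
  elementary tensors, so \<open>id \<otimes> \<Phi>\<close> itself need not be constructed on the completion \<open>C\<close>.\<close>

definition induced_functional ::
    "('a \<Rightarrow> complex^2^2) \<Rightarrow> ('c \<Rightarrow> complex) \<Rightarrow> ('a \<Rightarrow> complex^2^2 \<Rightarrow> complex) \<Rightarrow> bool" where
  "induced_functional \<Phi> \<Lambda> \<beta> \<longleftrightarrow> linear_functional C \<Lambda> \<and> matrix_pairing A \<beta> \<and>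
     (\<forall>x\<in>carrier A. \<forall>y\<in>carrier A. \<Lambda> (\<tau> x y) = \<beta> x (\<Phi> y))"

text \<open>States that (id \<otimes> \<Phi>)(\<Delta>(x)) is x \<otimes> 1 for an even letter, and
  cos \<theta> (x \<otimes> X) + sin \<theta> (y \<otimes> Y) for an odd one, as seen by every
  functional of the kind just introduced. The partner \<open>y\<close> is thus the derivative of
  \<open>x\<close> at angle 0.\<close>

definition rotation_letter :: "nat \<Rightarrow> nat \<Rightarrow> 'a \<times> 'a option \<Rightarrow> bool" where
  "rotation_letter e f l \<longleftrightarrow> letter_closed l \<and>
     (\<forall>\<theta> \<Phi> \<Lambda> \<beta>. rotation_rep e f \<theta> \<Phi> \<longrightarrow> induced_functional \<Phi> \<Lambda> \<beta> \<longrightarrow>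
        \<Lambda> (\<Delta> (fst l)) = (case snd l of None \<Rightarrow> \<beta> (fst l) (mat 1)
          | Some y \<Rightarrow> cos \<theta> * \<beta> (fst l) reflection_x + sin \<theta> * \<beta> y reflection_y))"

lemma induced_functionalD:
  assumes "induced_functional \<Phi> \<Lambda> \<beta>" "x \<in> carrier A"
  shows "y \<in> carrier A \<Longrightarrow> \<Lambda> (\<Delta> (x \<oplus> y)) = \<Lambda> (\<Delta> x) + \<Lambda> (\<Delta> y)" "\<Lambda> (\<Delta> (c \<odot> x)) = c * \<Lambda> (\<Delta> x)"
    "y \<in> carrier A \<Longrightarrow> \<beta> (x \<oplus> y) m = \<beta> x m + \<beta> y m" "\<beta> (c \<odot> x) m = c * \<beta> x m"
  using assms unfolding induced_functional_def matrix_pairing_def linear_functional_def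
  by (simp_all add: Delta_simps)

lemma rotation_letterD:
  assumes "rotation_letter e f l" "rotation_rep e f \<theta> \<Phi>" "induced_functional \<Phi> \<Lambda> \<beta>"
  shows "\<Lambda> (\<Delta> (fst l)) = (case snd l of None \<Rightarrow> \<beta> (fst l) (mat 1)
          | Some y \<Rightarrow> cos \<theta> * \<beta> (fst l) reflection_x + sin \<theta> * \<beta> y reflection_y)"
  using assms unfolding rotation_letter_def by blast

lemma rotation_letter_closed: "rotation_letter e f l \<Longrightarrow> letter_closed l"
  by (simp add: rotation_letter_def)

lemma rotation_letter_add_even:
  assumes "rotation_letter e f (x, None)" "rotation_letter e f (x', None)"
  shows "rotation_letter e f (x \<oplus> x', None)"
proof -
  note closed = assms[THEN rotation_letter_closed, unfolded letter_closed_def]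
  have "\<Lambda> (\<Delta> (x \<oplus> x')) = \<beta> (x \<oplus> x') (mat 1)"
    if "rotation_rep e f \<theta> \<Phi>" "induced_functional \<Phi> \<Lambda> \<beta>" for \<theta> \<Phi> \<Lambda> \<beta>
    using rotation_letterD[OF assms(1) that] rotation_letterD[OF assms(2) that] that closed
    by (simp add: induced_functionalD)
  then show ?thesis using closed by (simp add: rotation_letter_def letter_closed_def)
qed

lemma rotation_letter_add_odd:
  assumes "rotation_letter e f (x, Some y)" "rotation_letter e f (x', Some y')"
  shows "rotation_letter e f (x \<oplus> x', Some (y \<oplus> y'))"
proof -
  note closed = assms[THEN rotation_letter_closed, unfolded letter_closed_def]
  have "\<Lambda> (\<Delta> (x \<oplus> x')) = cos \<theta> * \<beta> (x \<oplus> x') reflection_x + sin \<theta> * \<beta> (y \<oplus> y') reflection_y"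
    if "rotation_rep e f \<theta> \<Phi>" "induced_functional \<Phi> \<Lambda> \<beta>" for \<theta> \<Phi> \<Lambda> \<beta>
    using rotation_letterD[OF assms(1) that] rotation_letterD[OF assms(2) that] that closed
    by (simp add: induced_functionalD ring_distribs)
  then show ?thesis using closed by (simp add: rotation_letter_def letter_closed_def)
qed

lemma rotation_letter_smult_odd:
  assumes "rotation_letter e f (x, Some y)"
  shows "rotation_letter e f (c \<odot> x, Some (c \<odot> y))"
proof -
  note closed = assms[THEN rotation_letter_closed, unfolded letter_closed_def]
  have "\<Lambda> (\<Delta> (c \<odot> x)) = cos \<theta> * \<beta> (c \<odot> x) reflection_x + sin \<theta> * \<beta> (c \<odot> y) reflection_y"
    if "rotation_rep e f \<theta> \<Phi>" "induced_functional \<Phi> \<Lambda> \<beta>" for \<theta> \<Phi> \<Lambda> \<beta>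
    using rotation_letterD[OF assms that] that closed
    by (simp add: induced_functionalD algebra_simps)
  then show ?thesis using closed by (simp add: rotation_letter_def letter_closed_def)
qed

lemma rotation_letter_one: "rotation_letter e f (\<one>, None)"
proof -
  have "\<Lambda> (\<Delta> \<one>) = \<beta> \<one> (mat 1)" if "rotation_rep e f \<theta> \<Phi>" "induced_functional \<Phi> \<Lambda> \<beta>" for \<theta> \<Phi> \<Lambda> \<beta>
  proof -
    have "\<Phi> \<one> = mat 1" using that(1) by (simp add: rotation_rep_def matrix_rep_def)
    then show ?thesis
      using that(2) unfolding Delta_simps tau_one[symmetric] induced_functional_def by simp
  qed
  then show ?thesis by (simp add: rotation_letter_def letter_closed_def)
qed

text \<open>In \<Delta>(u_ij) the column index j occurs only in the second leg. The Fourier sum over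
  j therefore acts on the matrix model, and the dependence on k that it leaves, \<nu> and \<nu>',
  becomes the column function of the first leg.\<close>

lemma induced_functional_fourier_entry:
  assumes rep: "rotation_rep e f \<theta> \<Phi>" and ind: "induced_functional \<Phi> \<Lambda> \<beta>"
    and rot: "\<And>k. k \<in> {1..4} \<Longrightarrow> (\<Sum>j\<in>{1..4}. matrix_smult (d j) (rotation_model e f \<theta> k j))
      = matrix_smult (\<nu> k * r) M + matrix_smult (\<nu>' k * r') M'"
  shows "\<Lambda> (\<Delta> (fourier_entry A u g d)) = r * \<beta> (fourier_entry A u g \<nu>) M + r' * \<beta> (fourier_entry A u g \<nu>') M'"
proof -
  have pairing: "matrix_pairing A \<beta>" and lin: "linear_functional C \<Lambda>"
    and tau: "\<And>x y. x \<in> carrier A \<Longrightarrow> y \<in> carrier A \<Longrightarrow> \<Lambda> (\<tau> x y) = \<beta> x (\<Phi> y)"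
    using ind by (auto simp: induced_functional_def)
  have lin_Delta: "linear_functional A (\<lambda>x. \<Lambda> (\<Delta> x))"
    using lin unfolding linear_functional_def by (simp add: Delta_simps)
  have lin_\<beta>: "linear_functional A (\<lambda>x. \<beta> x m)" for m
    using pairing by (simp add: matrix_pairing_def)
  have "\<Lambda> (\<Delta> (u i j)) = (\<Sum>k\<in>{1..4}. \<beta> (u i k) (rotation_model e f \<theta> k j))"
    if ij: "i \<in> {1..4}" "j \<in> {1..4}" for i j
  proof -
    have "\<Lambda> (\<Delta> (u i j)) = (\<Sum>k\<in>{1..4}. \<Lambda> (\<tau> (u i k) (u k j)))"
      unfolding Delta_u[OF ij] using ij by (intro C.linear_functional_finsum lin) auto
    then show ?thesis using ij rep by (auto simp: tau rotation_rep_def intro!: sum.cong)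
  qed
  then have "\<Lambda> (\<Delta> (fourier_entry A u g d))
      = (\<Sum>i\<in>{1..4}. \<Sum>j\<in>{1..4}. g i * d j / 4 * (\<Sum>k\<in>{1..4}. \<beta> (u i k) (rotation_model e f \<theta> k j)))"
    unfolding fourier_entry_def linear_functional_entry_comb[OF lin_Delta]
    by (intro sum.cong refl) simp
  also have "\<dots> = (\<Sum>i\<in>{1..4}. \<Sum>j\<in>{1..4}. \<Sum>k\<in>{1..4}. g i / 4 * (d j * \<beta> (u i k) (rotation_model e f \<theta> k j)))"
    by (simp add: sum_distrib_left mult_ac)
  also have "\<dots> = (\<Sum>i\<in>{1..4}. \<Sum>k\<in>{1..4}. \<Sum>j\<in>{1..4}. g i / 4 * (d j * \<beta> (u i k) (rotation_model e f \<theta> k j)))"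
    by (intro sum.cong refl sum.swap)
  also have "\<dots> = (\<Sum>i\<in>{1..4}. \<Sum>k\<in>{1..4}. r * (g i * \<nu> k / 4 * \<beta> (u i k) M) + r' * (g i * \<nu>' k / 4 * \<beta> (u i k) M'))"
  proof (intro sum.cong refl)
    fix i k :: nat assume ik: "i \<in> {1..4}" "k \<in> {1..4}"
    have "(\<Sum>j\<in>{1..4}. d j * \<beta> (u i k) (rotation_model e f \<theta> k j))
        = \<beta> (u i k) (matrix_smult (\<nu> k * r) M + matrix_smult (\<nu>' k * r') M')"
      unfolding rot[OF ik(2), symmetric]
      using ik by (intro matrix_pairing_sum[symmetric, OF pairing]) auto
    also have "\<dots> = \<nu> k * r * \<beta> (u i k) M + \<nu>' k * r' * \<beta> (u i k) M'"
      using pairing ik by (simp add: matrix_pairing_def)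
    finally show "(\<Sum>j\<in>{1..4}. g i / 4 * (d j * \<beta> (u i k) (rotation_model e f \<theta> k j)))
        = r * (g i * \<nu> k / 4 * \<beta> (u i k) M) + r' * (g i * \<nu>' k / 4 * \<beta> (u i k) M')"
      by (simp only: sum_distrib_left[symmetric]) (simp add: field_simps)
  qed
  also have "\<dots> = r * \<beta> (fourier_entry A u g \<nu>) M + r' * \<beta> (fourier_entry A u g \<nu>') M'"
    unfolding fourier_entry_def linear_functional_entry_comb[OF lin_\<beta>]
    by (simp add: sum.distrib sum_distrib_left)
  finally show ?thesis .
qed

lemma rotation_letters:
  assumes "(e, f) \<in> {(1,2), (2,1), (3,1)}" "g = 6 - e - f"
  shows "rotation_letter e f (a c e, None)"
    and "rotation_letter e f (a c f, Some (a c g))"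
    and "rotation_letter e f (a c g, Some (a c f))"
proof -
  note sums = sum_rotation_model[OF assms(1) _ assms(2)]
  \<comment> \<open>The even case is the two-term formula with weights 1 and 0.\<close>
  have "\<Lambda> (\<Delta> (a c e)) = 1 * \<beta> (a c e) (mat 1) + 0 * \<beta> (a c e) (mat 1)"
    if "rotation_rep e f \<theta> \<Phi>" "induced_functional \<Phi> \<Lambda> \<beta>" for \<theta> \<Phi> \<Lambda> \<beta>
    by (rule induced_functional_fourier_entry[OF that])
      (subst sums(1), simp_all add: matrix_smult_def vec_eq_iff)
  then show "rotation_letter e f (a c e, None)"
    by (simp add: rotation_letter_def letter_closed_def)
  have "\<Lambda> (\<Delta> (a c f)) = cos \<theta> * \<beta> (a c f) reflection_x + sin \<theta> * \<beta> (a c g) reflection_y"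
    if "rotation_rep e f \<theta> \<Phi>" "induced_functional \<Phi> \<Lambda> \<beta>" for \<theta> \<Phi> \<Lambda> \<beta>
    by (rule induced_functional_fourier_entry[OF that]) (rule sums(2))
  then show "rotation_letter e f (a c f, Some (a c g))"
    by (simp add: rotation_letter_def letter_closed_def)
  have "\<Lambda> (\<Delta> (a c g)) = cos \<theta> * \<beta> (a c g) reflection_x + sin \<theta> * \<beta> (a c f) reflection_y"
    if "rotation_rep e f \<theta> \<Phi>" "induced_functional \<Phi> \<Lambda> \<beta>" for \<theta> \<Phi> \<Lambda> \<beta>
    by (rule induced_functional_fourier_entry[OF that]) (rule sums(3))
  then show "rotation_letter e f (a c g, Some (a c f))"
    by (simp add: rotation_letter_def letter_closed_def)
qed

section \<open>Trigonometric expansion of rotated words\<close>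

context
  fixes p q :: 2
begin

text \<open>With m = \<Phi>(y) this is the (p, q) entry of (h \<otimes> \<Phi>)((x \<otimes> y)
  \<Delta>(w)), multiplied out letter by letter. The formula does not mention \<Phi>, which makes it
  a function of \<theta> that can be differentiated.\<close>

primrec rotated_value :: "real \<Rightarrow> 'a \<Rightarrow> complex^2^2 \<Rightarrow> ('a \<times> 'a option) list \<Rightarrow> complex" where
  "rotated_value \<theta> x m [] = h x * m $ p $ q"
| "rotated_value \<theta> x m (l # w) = (case snd l of
      None \<Rightarrow> rotated_value \<theta> (x \<otimes> fst l) m w
    | Some y \<Rightarrow> complex_of_real (cos \<theta>) * rotated_value \<theta> (x \<otimes> fst l) (m ** reflection_x) w
               + complex_of_real (sin \<theta>) * rotated_value \<theta> (x \<otimes> y) (m ** reflection_y) w)"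

lemma rotated_value_linear:
  assumes "\<forall>l\<in>set w. letter_closed l" "x \<in> carrier A" "x' \<in> carrier A"
  shows "rotated_value \<theta> (x \<oplus> x') m w = rotated_value \<theta> x m w + rotated_value \<theta> x' m w"
    and "rotated_value \<theta> (c \<odot> x) m w = c * rotated_value \<theta> x m w"
    and "rotated_value \<theta> x (m + n) w = rotated_value \<theta> x m w + rotated_value \<theta> x n w"
    and "rotated_value \<theta> x (matrix_smult c m) w = c * rotated_value \<theta> x m w"
  using assms
proof (induction w arbitrary: x x' m n)
  case Nil
  { case 1 then show ?case by (simp add: h_simps algebra_simps) }
  { case 2 then show ?case by (simp add: h_simps) }
  { case 3 then show ?case by (simp add: algebra_simps) }
  { case 4 then show ?case by (simp add: matrix_smult_def) }
next
  case (Cons l w)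
  { case 1 then show ?case using Cons.IH(1)
      by (auto simp: letter_closed_def l_distr algebra_simps split: option.split) }
  { case 2 then show ?case using Cons.IH(2)
      by (auto simp: letter_closed_def smult_mult_left algebra_simps split: option.split) }
  { case 3 then show ?case using Cons.IH(3)
      by (auto simp: letter_closed_def matrix_add_rdistrib algebra_simps split: option.split) }
  { case 4 then show ?case using Cons.IH(4)
      by (auto simp: letter_closed_def matrix_smult_simps algebra_simps split: option.split) }
qed

text \<open>Induction from the left. With the remaining word kept fixed, \<Lambda> is a linear
  functional of the element standing in place of the first letter, and the induction hypothesis
  computes it on elementary tensors. This is exactly what \<open>rotation_letter\<close> needs in
  order to expand that letter.\<close>

lemma rotated_value_eq:
  assumes "rotation_rep e f \<theta> \<Phi>" "\<forall>l\<in>set w. rotation_letter e f l" "x \<in> carrier A" "y \<in> carrier A"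
  shows "\<Phi> (L (\<tau> x y \<otimes>\<^bsub>C\<^esub> \<Delta> (word_value w))) $ p $ q = rotated_value \<theta> x (\<Phi> y) w"
  using assms(2-)
proof (induction w arbitrary: x y)
  case Nil
  then show ?case using assms(1)
    by (simp add: Delta_simps L_tau rotation_rep_def matrix_rep_def matrix_smult_def)
next
  case (Cons l w)
  have closed: "letter_closed l" "\<forall>l\<in>set w. letter_closed l"
    using Cons.prems(1) by (auto simp: rotation_letter_def)
  then have closed' [simp]: "fst l \<in> carrier A" "word_value w \<in> carrier A"
    by (auto simp: letter_closed_def)
  define \<Lambda> where "\<Lambda> z = \<Phi> (L (\<tau> x y \<otimes>\<^bsub>C\<^esub> z \<otimes>\<^bsub>C\<^esub> \<Delta> (word_value w))) $ p $ q" for z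
  define \<beta> where "\<beta> x' m = rotated_value \<theta> (x \<otimes> x') (\<Phi> y ** m) w" for x' m
  have "linear_functional C \<Lambda>"
    unfolding linear_functional_def \<Lambda>_def using Cons.prems assms(1)
    by (auto simp: C.l_distr C.r_distr C.smult_mult_left C.smult_mult_right Delta_simps L_add L_smult
        rotation_rep_def matrix_rep_def matrix_smult_def)
  moreover have "matrix_pairing A \<beta>"
    unfolding matrix_pairing_def linear_functional_def \<beta>_def using Cons.prems closed(2)
    by (auto simp: r_distr smult_mult_right matrix_add_ldistrib matrix_smult_simps rotated_value_linear)
  moreover have "\<Lambda> (\<tau> x' y') = \<beta> x' (\<Phi> y')" if "x' \<in> carrier A" "y' \<in> carrier A" for x' y'
    unfolding \<Lambda>_def \<beta>_def using Cons that assms(1)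
    by (simp add: tau_mult rotation_rep_def matrix_rep_def)
  ultimately have "induced_functional \<Phi> \<Lambda> \<beta>" by (simp add: induced_functional_def)
  then have "\<Lambda> (\<Delta> (fst l)) = (case snd l of None \<Rightarrow> \<beta> (fst l) (mat 1)
          | Some y \<Rightarrow> cos \<theta> * \<beta> (fst l) reflection_x + sin \<theta> * \<beta> y reflection_y)"
    using Cons.prems(1) assms(1) unfolding rotation_letter_def by simp
  moreover have "\<Phi> (L (\<tau> x y \<otimes>\<^bsub>C\<^esub> \<Delta> (word_value (l # w)))) $ p $ q = \<Lambda> (\<Delta> (fst l))"
    using Cons.prems by (simp add: \<Lambda>_def Delta_simps C.m_assoc)
  ultimately show ?case by (simp add: \<beta>_def split: option.split)
qed

text \<open>Invariance sends \<Delta>(w) to the scalar h(w), and every unital representation fixes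
  scalars. Hence there is no dependence on \<theta>.\<close>

lemma rotated_value_haar:
  assumes "(e, f) \<in> {(1,2), (2,1), (3,1)}" "\<forall>l\<in>set w. rotation_letter e f l"
  shows "rotated_value \<theta> \<one> (mat 1) w = h (word_value w) * mat 1 $ p $ q"
proof -
  obtain \<Phi> where "rotation_rep e f \<theta> \<Phi>"
    using exists_rotation_rep[OF universal assms(1), of \<theta>] unfolding rotation_rep_def by blast
  moreover from this have "\<Phi> \<one> = mat 1" "\<And>c x. x \<in> carrier A \<Longrightarrow> \<Phi> (c \<odot> x) = matrix_smult c (\<Phi> x)"
    by (auto simp: rotation_rep_def matrix_rep_def)
  moreover have "word_value w \<in> carrier A"
    using assms(2) by (auto simp: rotation_letter_def)
  ultimately show ?thesis
    using rotated_value_eq[of e f \<theta> \<Phi> w \<one> \<one>] assms(2)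
    by (simp add: tau_one Delta_simps L_Delta matrix_smult_def)
qed

definition reflection_power :: "nat \<Rightarrow> complex^2^2" where
  "reflection_power n = (if even n then mat 1 else reflection_x)"

lemma reflection_power_Suc:
  "reflection_x ** reflection_power n = reflection_power (Suc n)"
  by (auto simp: reflection_power_def reflection_x_def matrix_2_simps)

lemma reflection_anticommute:
  "reflection_x ** (reflection_y ** m) = - (reflection_y ** (reflection_x ** m))"
  by (simp add: reflection_x_def reflection_y_def matrix_2_simps)

text \<open>At angle 0 every odd letter contributes a factor X, and X^2 = 1.\<close>

lemma rotated_value_0:
  assumes "\<forall>l\<in>set w. letter_closed l" "x \<in> carrier A"
  shows "rotated_value 0 x m w = h (x \<otimes> word_value w) * (m ** reflection_power (odd_count w)) $ p $ q"
  using assms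
proof (induction w arbitrary: x m)
  case Nil
  then show ?case by (simp add: reflection_power_def)
next
  case (Cons l w)
  then show ?case
    by (auto simp: letter_closed_def m_assoc reflection_power_Suc[symmetric] matrix_mul_assoc split: option.split)
qed

text \<open>By the product rule each odd letter in turn is replaced by its partner, with Y in place
  of one X. Moving Y to the left across the preceding factors X produces the signs of
  \<open>word_deriv\<close>. The factors X that are left number one less than
  \<open>odd_count\<close>; as X^2 = 1, the exponent can be written with \<open>Suc\<close>, without
  subtraction.\<close>

lemma rotated_value_deriv:
  assumes "\<forall>l\<in>set w. letter_closed l" "x \<in> carrier A"
  shows "((\<lambda>\<theta>. rotated_value \<theta> x m w) has_vector_derivative
     h (x \<otimes> word_deriv w) * (m ** (reflection_y ** reflection_power (Suc (odd_count w)))) $ p $ q) (at 0)"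
  using assms
proof (induction w arbitrary: x m)
  case Nil
  then show ?case by (simp add: linear_functional_zero[OF h_linear])
next
  case (Cons l w)
  have closed [simp]: "fst l \<in> carrier A" "word_value w \<in> carrier A" "word_deriv w \<in> carrier A"
    using Cons.prems(1) by (auto simp: letter_closed_def)
  show ?case
  proof (cases "snd l")
    case None
    then show ?thesis
      using Cons.IH[of "x \<otimes> fst l" m] Cons.prems by (simp add: m_assoc)
  next
    case (Some y)
    then have y [simp]: "y \<in> carrier A" using Cons.prems(1) by (auto simp: letter_closed_def)
    define n where "n = odd_count w"
    have cos: "((\<lambda>\<theta>. complex_of_real (cos \<theta>)) has_vector_derivative of_real 0) (at 0)"
      by (rule has_vector_derivative_of_real) (auto intro!: derivative_eq_intros)
    have sin: "((\<lambda>\<theta>. complex_of_real (sin \<theta>)) has_vector_derivative of_real 1) (at 0)"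
      by (rule has_vector_derivative_of_real) (auto intro!: derivative_eq_intros)
    have "((\<lambda>\<theta>. rotated_value \<theta> x m (l # w)) has_vector_derivative
        (of_real (cos 0) * (h (x \<otimes> fst l \<otimes> word_deriv w) * (m ** reflection_x ** (reflection_y ** reflection_power (Suc n))) $ p $ q)
          + of_real 0 * rotated_value 0 (x \<otimes> fst l) (m ** reflection_x) w)
        + (of_real (sin 0) * (h (x \<otimes> y \<otimes> word_deriv w) * (m ** reflection_y ** (reflection_y ** reflection_power (Suc n))) $ p $ q)
          + of_real 1 * rotated_value 0 (x \<otimes> y) (m ** reflection_y) w)) (at 0)"
      unfolding n_def using Some Cons.prems
      by (simp only: rotated_value.simps option.case)
        (intro has_vector_derivative_add has_vector_derivative_mult cos sin Cons.IH; simp)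
    moreover have "h (x \<otimes> y \<otimes> word_value w) = h (x \<otimes> (y \<otimes> word_value w))"
      using Cons.prems by (simp add: m_assoc)
    moreover have "h (x \<otimes> word_deriv (l # w)) = h (x \<otimes> (y \<otimes> word_value w)) - h (x \<otimes> fst l \<otimes> word_deriv w)"
      using Some Cons.prems by (simp add: m_assoc linear_functional_minus[OF linear_functional_mult[OF h_linear]])
    moreover have "reflection_power (Suc (Suc n)) = reflection_power n"
      by (simp add: reflection_power_def)
    \<comment> \<open>The derivative falls on a later letter, so Y crosses the X of the present one:
      this is the minus sign in \<open>word_deriv\<close>.\<close>
    moreover have "m ** reflection_x ** (reflection_y ** reflection_power (Suc n))
        = - (m ** (reflection_y ** reflection_power (Suc (Suc n))))"
      unfolding reflection_power_Suc[of "Suc n", symmetric] 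
      by (simp add: matrix_mul_assoc[symmetric] reflection_anticommute)
        (simp add: matrix_matrix_mult_def vec_eq_iff sum_negf)
    moreover have "rotated_value 0 (x \<otimes> y) (m ** reflection_y) w
        = h (x \<otimes> y \<otimes> word_value w) * (m ** (reflection_y ** reflection_power n)) $ p $ q"
      using Cons.prems by (subst rotated_value_0) (simp_all add: n_def matrix_mul_assoc)
    moreover have "odd_count (l # w) = Suc n" using Some by (simp add: n_def)
    ultimately show ?thesis
      by (simp only: cos_zero sin_zero of_real_0 of_real_1 mult_zero_left mult_1 add_0_left add_0_right
          vector_uminus_component) (simp add: algebra_simps del: word_deriv.simps rotated_value.simps)
  qed
qed

end

section \<open>Consequences of invariance for words\<close>

text \<open>At angle 0 invariance says h(w) X = h(w) 1, and the entry (2, 2) of X is -1.\<close>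

lemma haar_parity:
  assumes "(e, f) \<in> {(1,2), (2,1), (3,1)}" "\<forall>l\<in>set w. rotation_letter e f l" "odd (odd_count w)"
  shows "h (word_value w) = 0"
proof -
  have closed: "\<forall>l\<in>set w. letter_closed l" using assms(2) by (auto simp: rotation_letter_def)
  have entries: "(mat 1 :: complex^2^2) $ 2 $ 2 = 1" "reflection_x $ 2 $ 2 = - 1"
    by (simp_all add: reflection_x_def mat_def)
  have "- h (word_value w) = h (word_value w)"
    using rotated_value_0[OF closed one_closed, of 2 2 "mat 1"] rotated_value_haar[OF assms(1,2), of 2 2 0]
      assms(3) closed by (simp add: reflection_power_def entries)
  then show ?thesis by simp
qed

text \<open>The (1, 2) entry of the rotated value is constantly 0, since the identity matrix is
  diagonal. In the derivative, h(\<open>word_deriv\<close> w) is multiplied by the (1, 2) entry of Y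
  or of Y X, which is nonzero.\<close>

lemma haar_derivation:
  assumes "(e, f) \<in> {(1,2), (2,1), (3,1)}" "\<forall>l\<in>set w. rotation_letter e f l"
  shows "h (word_deriv w) = 0"
proof -
  have closed: "\<forall>l\<in>set w. letter_closed l" using assms(2) by (auto simp: rotation_letter_def)
  have entry: "(mat 1 :: complex^2^2) $ 1 $ 2 = 0" by (simp add: mat_def)
  have "((\<lambda>\<theta>. 0) has_vector_derivative
     h (word_deriv w) * (reflection_y ** reflection_power (Suc (odd_count w))) $ 1 $ 2) (at 0)"
    using rotated_value_deriv[OF closed one_closed, of 1 2 "mat 1"] closed
    by (simp add: rotated_value_haar[OF assms] entry)
  then have "h (word_deriv w) * (reflection_y ** reflection_power (Suc (odd_count w))) $ 1 $ 2 = 0"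
    by (metis has_vector_derivative_const vector_derivative_at)
  moreover have "(reflection_y ** reflection_power n) $ 1 $ 2 \<noteq> 0" for n
    by (simp add: reflection_power_def reflection_y_def reflection_x_def matrix_2_simps)
  ultimately show ?thesis by simp
qed

end

section \<open>The moments\<close>

text \<open>The binomial theorem behind a functional: T n l i stands for the value of
  \<open>h\<close> on (S^b + c Q)^n S^l Q^i with commuting S and Q. The shift b is 0, 2 and 1 in the
  three applications.\<close>

lemma binomial_recursion:
  fixes T :: "nat \<Rightarrow> nat \<Rightarrow> nat \<Rightarrow> complex"
  assumes "\<And>n l i. T (Suc n) l i = T n (l + b) i + c * T n l (Suc i)"
  shows "T n l i = (\<Sum>r\<le>n. of_nat (n choose r) * c ^ r * T 0 (l + b * (n - r)) (i + r))"
proof (induction n arbitrary: l i)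
  case 0
  then show ?case by simp
next
  case (Suc n)
  define F where "F r = c ^ r * T 0 (l + b * (Suc n - r)) (i + r)" for r
  have "T (Suc n) l i = (\<Sum>r\<le>n. of_nat (n choose r) * c ^ r * T 0 (l + b + b * (n - r)) (i + r))
      + c * (\<Sum>r\<le>n. of_nat (n choose r) * c ^ r * T 0 (l + b * (n - r)) (Suc i + r))"
    unfolding assms Suc by simp
  also have "(\<Sum>r\<le>n. of_nat (n choose r) * c ^ r * T 0 (l + b + b * (n - r)) (i + r))
      = (\<Sum>r\<le>n. of_nat (n choose r) * F r)"
    by (intro sum.cong refl) (simp add: F_def Suc_diff_le add.assoc)
  also have "\<dots> = F 0 + (\<Sum>r\<le>n. of_nat (n choose Suc r) * F (Suc r))"
  proof -
    have "(\<Sum>r\<le>n. of_nat (n choose r) * F r) = (\<Sum>r\<le>Suc n. of_nat (n choose r) * F r)"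
      by simp
    then show ?thesis by (simp only: sum.atMost_Suc_shift) simp
  qed
  also have "c * (\<Sum>r\<le>n. of_nat (n choose r) * c ^ r * T 0 (l + b * (n - r)) (Suc i + r))
      = (\<Sum>r\<le>n. of_nat (n choose r) * F (Suc r))"
    unfolding sum_distrib_left by (intro sum.cong refl) (simp add: F_def)
  also have "F 0 + (\<Sum>r\<le>n. of_nat (n choose Suc r) * F (Suc r)) + (\<Sum>r\<le>n. of_nat (n choose r) * F (Suc r))
      = F 0 + (\<Sum>r\<le>n. of_nat (Suc n choose Suc r) * F (Suc r))"
    by (simp add: sum.distrib algebra_simps)
  also have "\<dots> = (\<Sum>r\<le>Suc n. of_nat (Suc n choose r) * F r)"
    by (simp only: sum.atMost_Suc_shift) simp
  finally show ?case by (simp add: F_def mult.assoc)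
qed

context cstar_algebra
begin

lemma nat_pow_commute:
  assumes "x \<otimes> y = y \<otimes> x" "x \<in> carrier A" "y \<in> carrier A"
  shows "x [^] (n::nat) \<otimes> y = y \<otimes> x [^] n"
proof (induction n)
  case (Suc n)
  have "x [^] Suc n \<otimes> y = x [^] n \<otimes> y \<otimes> x" using assms by (simp add: m_assoc)
  then show ?case using Suc assms by (simp add: m_assoc)
qed (use assms in simp)

lemma word_value_append: "\<forall>l\<in>set v. letter_closed l \<Longrightarrow> \<forall>l\<in>set w. letter_closed l \<Longrightarrow>
    word_value (v @ w) = word_value v \<otimes> word_value w"
  by (induction v) (auto simp: letter_closed_def m_assoc)

lemma word_value_replicate: "fst l \<in> carrier A \<Longrightarrow> word_value (replicate n l) = fst l [^] n"
proof (induction n)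
  case (Suc n)
  then show ?case using nat_pow_Suc2[of "fst l" n] by simp
qed simp

lemma word_deriv_even_prefix:
  "x \<in> carrier A \<Longrightarrow> \<forall>l\<in>set w. letter_closed l \<Longrightarrow>
    word_deriv (replicate n (x, None) @ w) = x [^] n \<otimes> word_deriv w"
proof (induction n)
  case (Suc n)
  then show ?case using nat_pow_Suc2[of x n] by (simp add: m_assoc)
qed simp

text \<open>The sign of the derivation passing over \<open>d\<close> cancels the sign from moving
  \<open>c\<close> across \<open>d\<close>, so the ordinary power rule holds.\<close>

lemma word_deriv_replicate_odd:
  assumes c: "c \<in> carrier A" and d: "d \<in> carrier A" and anti: "c \<otimes> d = \<ominus> (d \<otimes> c)"
  shows "word_deriv (replicate (Suc n) (d, Some c)) = of_nat (Suc n) \<odot> (c \<otimes> d [^] n)"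
proof (induction n)
  case 0
  then show ?case using c d by (simp add: smult_one minus_eq)
next
  case (Suc n)
  have "word_deriv (replicate (Suc (Suc n)) (d, Some c))
      = c \<otimes> d [^] Suc n \<ominus> d \<otimes> (of_nat (Suc n) \<odot> (c \<otimes> d [^] n))"
    using Suc word_value_replicate[of "(d, Some c)" "Suc n"] c d by simp
  also have "d \<otimes> (of_nat (Suc n) \<odot> (c \<otimes> d [^] n)) = of_nat (Suc n) \<odot> (d \<otimes> c \<otimes> d [^] n)"
    using c d by (simp add: smult_mult_right m_assoc del: of_nat_Suc)
  also have "d \<otimes> c = \<ominus> (c \<otimes> d)" using anti c d by simp
  also have "of_nat (Suc n) \<odot> (\<ominus> (c \<otimes> d) \<otimes> d [^] n) = \<ominus> (of_nat (Suc n) \<odot> (c \<otimes> d [^] Suc n))"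
  proof -
    have "\<ominus> (c \<otimes> d) \<otimes> d [^] n = (- 1) \<odot> (c \<otimes> d [^] Suc n)"
      using c d nat_pow_Suc2[OF d, of n] by (simp add: l_minus m_assoc smult_minus_one)
    then show ?thesis using c d by (simp add: smult_smult[symmetric] smult_minus_one[symmetric] del: of_nat_Suc)
  qed
  also have "c \<otimes> d [^] Suc n \<ominus> \<ominus> (of_nat (Suc n) \<odot> (c \<otimes> d [^] Suc n)) = of_nat (Suc (Suc n)) \<odot> (c \<otimes> d [^] Suc n)"
    using c d smult_add_left[of "c \<otimes> d [^] Suc n" 1 "of_nat (Suc n)"] by (simp add: minus_eq smult_one)
  finally show ?case .
qed

end

section \<open>Moments of the Haar functional\<close>

context haar_4
begin

text \<open>Integration by parts: the word s^l c d^(n+1) has derivative s^l (d^(n+2) - (n+1) c^2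
  d^n), on which \<open>h\<close> vanishes.\<close>

lemma haar_rotation_recursion:
  assumes axis: "(e, f) \<in> {(1,2), (2,1), (3,1)}"
    and letters: "rotation_letter e f (s, None)" "rotation_letter e f (c, Some d)" "rotation_letter e f (d, Some c)"
    and anti: "c \<otimes> d = \<ominus> (d \<otimes> c)"
  shows "h (s [^] (l::nat) \<otimes> d [^] (n + 2)) = of_nat (n + 1) * h (s [^] l \<otimes> (c \<otimes> c \<otimes> d [^] n))"
proof -
  have closed [simp]: "s \<in> carrier A" "c \<in> carrier A" "d \<in> carrier A"
    using letters[THEN rotation_letter_closed] by (auto simp: letter_closed_def)
  define w where "w = (c, Some d) # replicate (Suc n) (d, Some c)"
  have w: "word_deriv w = d [^] (n + 2) \<ominus> of_nat (Suc n) \<odot> (c \<otimes> c \<otimes> d [^] n)"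
    using word_deriv_replicate_odd[of c d n] anti word_value_replicate[of "(d, Some c)" "Suc n"]
      nat_pow_Suc2[of d "Suc n"]
    unfolding w_def by (simp add: smult_mult_right m_assoc del: nat_pow_Suc of_nat_Suc replicate_Suc)
  have "h (word_deriv (replicate l (s, None) @ w)) = 0"
    by (rule haar_derivation[OF axis]) (use letters in \<open>auto simp: w_def\<close>)
  moreover have "word_deriv (replicate l (s, None) @ w) = s [^] l \<otimes> word_deriv w"
    by (rule word_deriv_even_prefix) (use letters[THEN rotation_letter_closed] in \<open>auto simp: w_def\<close>)
  ultimately have "h (s [^] l \<otimes> (d [^] (n + 2) \<ominus> of_nat (Suc n) \<odot> (c \<otimes> c \<otimes> d [^] n))) = 0"
    using w by simp
  moreover have "h (s [^] l \<otimes> (d [^] (n + 2) \<ominus> of_nat (Suc n) \<odot> (c \<otimes> c \<otimes> d [^] n)))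
      = h (s [^] l \<otimes> d [^] (n + 2)) - of_nat (Suc n) * h (s [^] l \<otimes> (c \<otimes> c \<otimes> d [^] n))"
    by (subst linear_functional_minus[OF linear_functional_mult[OF h_linear]])
      (simp_all add: smult_mult_right h_simps del: of_nat_Suc nat_pow_Suc)
  ultimately show ?thesis by simp
qed

text \<open>Let x, y, z be the first row. The rotations about the axes 3 and 2 show that (n+1) h(y^2
  x^n) and (n+1) h(z^2 x^n) both equal h(x^(n+2)). With x^2 + y^2 + z^2 = 1 this is the recursion
  (n+3) h(x^(n+2)) = (n+1) h(x^n) of the uniform law on [-1, 1].\<close>

lemma haar_diagonal_moments:
  "h (a 1 1 [^] n) = (if even n then 1 / of_nat (n + 1) else 0)"
proof -
  define x y z where "x = a 1 1" and "y = a 1 2" and "z = a 1 3"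
  have closed [simp]: "x \<in> carrier A" "y \<in> carrier A" "z \<in> carrier A"
    by (simp_all add: x_def y_def z_def)
  have letters3: "rotation_letter 3 1 (x, Some y)" "rotation_letter 3 1 (y, Some x)"
    unfolding x_def y_def by (rule rotation_letters(2,3)[of 3 1 2]; simp)+
  have letters2: "rotation_letter 2 1 (x, Some z)" "rotation_letter 2 1 (z, Some x)"
    unfolding x_def z_def by (rule rotation_letters(2,3)[of 2 1 3]; simp)+
  have anti: "y \<otimes> x = \<ominus> (x \<otimes> y)" "z \<otimes> x = \<ominus> (x \<otimes> z)"
    unfolding x_def y_def z_def
    by (rule row_anticommute[of 2 1 3] row_anticommute[of 3 1 2]; simp add: klein_triples_def)+
  have squares: "x \<otimes> x \<oplus> (y \<otimes> y \<oplus> z \<otimes> z) = \<one>"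
    unfolding x_def y_def z_def by (rule row_squares) simp
  have rec: "of_nat (n + 3) * h (x [^] (n + 2)) = of_nat (n + 1) * h (x [^] n)" for n :: nat
  proof -
    have "h (x [^] (n + 2)) = of_nat (n + 1) * h (y \<otimes> y \<otimes> x [^] n)"
      using haar_rotation_recursion[OF _ rotation_letter_one letters3(2,1) anti(1), of 0 n] by simp
    moreover have "h (x [^] (n + 2)) = of_nat (n + 1) * h (z \<otimes> z \<otimes> x [^] n)"
      using haar_rotation_recursion[OF _ rotation_letter_one letters2(2,1) anti(2), of 0 n] by simp
    moreover have "h (x [^] n) = h (x [^] (n + 2)) + (h (y \<otimes> y \<otimes> x [^] n) + h (z \<otimes> z \<otimes> x [^] n))"
    proof -
      have "x [^] n = (x \<otimes> x \<oplus> (y \<otimes> y \<oplus> z \<otimes> z)) \<otimes> x [^] n" by (simp add: squares)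
      also have "\<dots> = x [^] (n + 2) \<oplus> (y \<otimes> y \<otimes> x [^] n \<oplus> z \<otimes> z \<otimes> x [^] n)"
        using nat_pow_mult[of x 2 n] by (simp add: l_distr numeral_2_eq_2 add.commute)
      finally have "h (x [^] n) = h (x [^] (n + 2) \<oplus> (y \<otimes> y \<otimes> x [^] n \<oplus> z \<otimes> z \<otimes> x [^] n))"
        by (rule arg_cong)
      then show ?thesis by (simp only: h_simps closed m_closed a_closed nat_pow_closed)
    qed
    ultimately show ?thesis by (simp add: algebra_simps)
  qed
  have "h (x [^] (1::nat)) = 0"
    using haar_parity[of 3 1 "[(x, Some y)]"] letters3 by simp
  then have "h (x [^] n) = (if even n then 1 / of_nat (n + 1) else 0)"
  proof (induction n rule: induct_nat_012)
    case 0
    then show ?case by (simp add: h_one)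
  next
    case 1
    then show ?case by simp
  next
    case (ge2 n)
    have "of_nat (n + 3) * h (x [^] Suc (Suc n)) = (if even n then 1 else 0)"
    proof -
      have "of_nat (n + 1) * (1 / of_nat (n + 1)) = (1 :: complex)"
        by (metis Suc_eq_plus1 nonzero_mult_div_cancel_left mult.right_neutral of_nat_neq_0 times_divide_eq_right)
      then show ?thesis using rec[of n] ge2 by (simp del: nat_pow_Suc of_nat_add)
    qed
    moreover have "of_nat (n + 3) \<noteq> (0 :: complex)" by (simp only: of_nat_eq_0_iff)
    ultimately have "h (x [^] Suc (Suc n)) = (if even n then 1 else 0) / of_nat (n + 3)"
      by (metis nonzero_mult_div_cancel_left)
    then show ?case by (auto simp: numeral_3_eq_3 simp del: nat_pow_Suc)
  qed
  then show ?thesis by (simp add: x_def)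
qed

text \<open>These are the moments of the uniform law on [0, 2]. After expanding (1 + x)^n,
  absorption turns the sum into that of the binomial coefficients of n + 1 with odd lower index,
  which is 2^n.\<close>

lemma haar_elem_s_moments: "h (elem_s [^] n) = 2 ^ n / of_nat (n + 1)"
proof -
  let ?x = "a 1 1"
  define T where "T n l i = h (elem_s [^] n \<otimes> ?x [^] i)" for n l i :: nat
  have "T (Suc n) l i = T n (l + 0) i + 1 * T n l (Suc i)" for n l i
  proof -
    have "elem_s [^] Suc n \<otimes> ?x [^] i = elem_s [^] n \<otimes> (elem_s \<otimes> ?x [^] i)"
      by (simp add: m_assoc)
    also have "elem_s \<otimes> ?x [^] i = ?x [^] i \<oplus> ?x [^] Suc i"
      using nat_pow_Suc2[of ?x i] by (simp add: elem_s_def l_distr del: nat_pow_Suc)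
    finally have "elem_s [^] Suc n \<otimes> ?x [^] i = elem_s [^] n \<otimes> ?x [^] i \<oplus> elem_s [^] n \<otimes> ?x [^] Suc i"
      by (simp add: r_distr del: nat_pow_Suc)
    then show ?thesis by (simp add: T_def h_simps del: nat_pow_Suc)
  qed
  \<comment> \<open>The summand 1 of S = 1 + x needs no exponent of its own: b = 0, and the argument
    l is idle.\<close>
  then have "T n 0 0 = (\<Sum>r\<le>n. of_nat (n choose r) * 1 ^ r * T 0 (0 + 0 * (n - r)) (0 + r))"
    by (rule binomial_recursion)
  then have "h (elem_s [^] n) = (\<Sum>r\<le>n. of_nat (n choose r) * (if even r then 1 / of_nat (r + 1) else 0))"
    by (simp add: T_def haar_diagonal_moments del: One_nat_def)
  then have "of_nat (n + 1) * h (elem_s [^] n)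
      = (\<Sum>r\<le>n. of_nat (n + 1) * (of_nat (n choose r) * (if even r then 1 / of_nat (r + 1) else 0)))"
    by (simp only: sum_distrib_left)
  also have "\<dots> = (\<Sum>r\<le>n. if odd (Suc r) then of_nat (Suc n choose Suc r) else 0)"
  proof (intro sum.cong refl)
    fix r :: nat
    have "of_nat (n + 1) * of_nat (n choose r) = (of_nat (r + 1) * of_nat (Suc n choose Suc r) :: complex)"
      using Suc_times_binomial[of r n] by (metis Suc_eq_plus1 of_nat_mult)
    then show "of_nat (n + 1) * (of_nat (n choose r) * (if even r then 1 / of_nat (r + 1) else 0))
        = (if odd (Suc r) then of_nat (Suc n choose Suc r) else (0::complex))"
      by (auto simp: field_simps simp del: of_nat_add of_nat_Suc binomial_Suc_Suc)
  qed
  also have "\<dots> = (\<Sum>r\<le>Suc n. if odd r then of_nat (Suc n choose r) else 0)"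
    by (simp only: sum.atMost_Suc_shift) simp
  also have "\<dots> = 2 ^ n"
    using choose_odd_sum[of "Suc n", where ?'a = complex]
    by (metis mult_left_cancel power_Suc zero_less_Suc zero_neq_numeral)
  finally have "of_nat (n + 1) * h (elem_s [^] n) = 2 ^ n" .
  moreover have "of_nat (n + 1) \<noteq> (0 :: complex)" by (simp only: of_nat_eq_0_iff)
  ultimately show ?thesis by (metis nonzero_mult_div_cancel_left)
qed

lemma rotation_letter_elem:
  "rotation_letter 1 2 (elem_s, None)"
  "rotation_letter 1 2 (elem_c, Some elem_d)"
  "rotation_letter 1 2 (elem_d, Some elem_c)"
proof -
  have "rotation_letter 1 2 (a 1 1, None)"
    by (rule rotation_letters(1)[of 1 2 3]) simp_all
  then show "rotation_letter 1 2 (elem_s, None)"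
    unfolding elem_s_def by (rule rotation_letter_add_even[OF rotation_letter_one])
  have c: "rotation_letter 1 2 (a c 2, Some (a c 3))" "rotation_letter 1 2 (a c 3, Some (a c 2))" for c
    by (rule rotation_letters(2,3)[of 1 2 3]; simp)+
  show "rotation_letter 1 2 (elem_c, Some elem_d)" "rotation_letter 1 2 (elem_d, Some elem_c)"
    unfolding elem_c_def elem_d_def by (rule rotation_letter_add_odd c)+
qed

text \<open>Rotation about axis 1 and C^2 + D^2 = S^2 give (n+2) h(S^l D^(n+2)) = (n+1) h(S^(l+2)
  D^n). This is the Wallis recursion: the factor with \<open>gchoose\<close> is the mean of the
  2i-th power of the sine, the rest the moment of S of order l + 2i.\<close>

lemma haar_elem_s_d_moments:
  "h (elem_s [^] l \<otimes> (elem_d \<otimes> elem_d) [^] i)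
    = (- 1) ^ i * ((- 1 / 2) gchoose i) * 2 ^ (l + 2 * i) / of_nat (l + 2 * i + 1)"
proof -
  have dd: "(elem_d \<otimes> elem_d) [^] i = elem_d [^] (2 * i)" for i :: nat
    using nat_pow_pow[of elem_d 2 i] by (simp add: numeral_2_eq_2)
  have rec: "of_nat (n + 2) * h (elem_s [^] l \<otimes> elem_d [^] (n + 2)) = of_nat (n + 1) * h (elem_s [^] (l + 2) \<otimes> elem_d [^] n)"
    for l n :: nat
  proof -
    have "elem_s [^] (l + 2) \<otimes> elem_d [^] n = elem_s [^] l \<otimes> ((elem_s \<otimes> elem_s) \<otimes> elem_d [^] n)"
      using nat_pow_mult[of elem_s l 2] by (simp add: numeral_2_eq_2 m_assoc)
    also have "\<dots> = elem_s [^] l \<otimes> (elem_c \<otimes> elem_c \<otimes> elem_d [^] n) \<oplus> elem_s [^] l \<otimes> elem_d [^] (n + 2)"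
      using nat_pow_mult[of elem_d 2 n] unfolding elem_squares[symmetric]
      by (simp add: numeral_2_eq_2 l_distr r_distr add.commute)
    finally have "h (elem_s [^] (l + 2) \<otimes> elem_d [^] n)
        = h (elem_s [^] l \<otimes> (elem_c \<otimes> elem_c \<otimes> elem_d [^] n)) + h (elem_s [^] l \<otimes> elem_d [^] (n + 2))"
      by (simp add: h_simps)
    moreover have "h (elem_s [^] l \<otimes> elem_d [^] (n + 2))
        = of_nat (n + 1) * h (elem_s [^] l \<otimes> (elem_c \<otimes> elem_c \<otimes> elem_d [^] n))"
      by (rule haar_rotation_recursion[OF _ rotation_letter_elem elem_c_d_anticommute]) simp
    ultimately show ?thesis by (simp add: algebra_simps)
  qed
  have "h (elem_s [^] l \<otimes> elem_d [^] (2 * i))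
    = (- 1) ^ i * ((- 1 / 2) gchoose i) * 2 ^ (l + 2 * i) / of_nat (l + 2 * i + 1)"
  proof (induction i arbitrary: l)
    case 0
    then show ?case by (simp add: haar_elem_s_moments)
  next
    case (Suc i)
    have e1: "of_nat (2 * i + 2) * h (elem_s [^] l \<otimes> elem_d [^] (2 * Suc i))
        = of_nat (2 * i + 1) * ((- 1) ^ i * ((- 1 / 2) gchoose i) * 2 ^ (l + 2 * Suc i) / of_nat (l + 2 * Suc i + 1))"
    proof -
      have "2 * Suc i = 2 * i + 2" "l + 2 * Suc i = l + 2 + 2 * i" by simp_all
      then show ?thesis by (simp only: rec Suc)
    qed
    have e2: "of_nat (2 * i + 2) * ((- 1 / 2) gchoose Suc i) = - of_nat (2 * i + 1) * ((- 1 / 2 :: complex) gchoose i)"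
      using gbinomial_mult_1[of "- 1 / 2 :: complex" i] by (simp add: field_simps)
    have e3: "of_nat (2 * i + 2) \<noteq> (0 :: complex)" by (simp only: of_nat_eq_0_iff)
    have cancel: "H = - s * g' * p / N"
      if "M * H = m * (s * g * p / N)" "M * g' = - m * g" "M \<noteq> 0" for M H m s g g' p N :: complex
    proof -
      have "M * H = - s * (- m * g) * p / N" using that(1) by simp
      also have "\<dots> = M * (- s * g' * p / N)" unfolding that(2)[symmetric] by simp
      finally show ?thesis using that(3) by (metis mult_left_cancel)
    qed
    show ?case using cancel[OF e1 e2 e3] by (simp only: power_Suc mult_minus1)
  qed
  then show ?thesis by (simp add: dd)
qed

text \<open>By anticommutation the square of \<open>elem_c + t elem_d\<close> is \<open>elem_s\<^sup>2 - (1 - t\<^sup>2) elem_d\<^sup>2\<close>; odd powers do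
  not contribute for reasons of parity.\<close>

lemma haar_moments:
  fixes t :: complex
  defines "P \<equiv> \<lambda>j. \<Sum>i\<le>j. of_nat (j choose i) * (1 - t\<^sup>2) ^ i * ((- 1 / 2) gchoose i)"
  shows "of_nat (n + 1) * h (((1/4) \<odot> (elem_s \<oplus> (elem_c \<oplus> t \<odot> elem_d))) [^] n)
    = (1/2) ^ n * (\<Sum>r\<le>n. of_nat (n choose r) * (if even r then P (r div 2) else 0))"
proof -
  define E where "E = elem_c \<oplus> t \<odot> elem_d"
  define V where "V = elem_s \<oplus> E"
  define Q where "Q = elem_d \<otimes> elem_d"
  define R where "R = E \<otimes> E"
  have closed [simp]: "E \<in> carrier A" "V \<in> carrier A" "Q \<in> carrier A" "R \<in> carrier A"
    by (simp_all add: E_def V_def Q_def R_def)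
  have SE: "E \<otimes> elem_s = elem_s \<otimes> E"
    by (simp add: E_def l_distr r_distr elem_s_commute smult_mult_left smult_mult_right)
  have R: "R = elem_s \<otimes> elem_s \<oplus> (- (1 - t\<^sup>2)) \<odot> Q"
  proof -
    have "R = elem_c \<otimes> elem_c \<oplus> (t\<^sup>2 \<odot> Q \<oplus> t \<odot> (elem_c \<otimes> elem_d \<oplus> elem_d \<otimes> elem_c))"
      unfolding R_def E_def Q_def
      by (simp add: l_distr r_distr smult_mult_left smult_mult_right smult_add_right power2_eq_square smult_smult a_ac)
    also have "\<dots> = (elem_c \<otimes> elem_c \<oplus> Q) \<oplus> (t\<^sup>2 - 1) \<odot> Q"
      using smult_add_left[of Q 1 "t\<^sup>2 - 1"] by (simp add: elem_c_d_anticommute l_neg smult_one a_assoc)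
    finally show ?thesis by (simp add: Q_def elem_squares)
  qed
  have SR: "elem_s [^] l \<otimes> R [^] j = R [^] j \<otimes> elem_s [^] l" for l j :: nat
  proof -
    have "elem_s \<otimes> R = R \<otimes> elem_s"
      unfolding R_def by (metis SE closed(1) elem_closed(1) m_assoc)
    then show ?thesis
      by (metis closed(4) elem_closed(1) nat_pow_commute nat_pow_closed)
  qed
  \<comment> \<open>Prepares \<open>binomial_recursion\<close> for R = S^2 - (1 - t^2) Q, with b = 2
    because R contributes S squared.\<close>
  define T where "T j l i = h (R [^] j \<otimes> (elem_s [^] l \<otimes> Q [^] i))" for j l i :: nat
  have T_rec: "T (Suc j) l i = T j (l + 2) i + (- (1 - t\<^sup>2)) * T j l (Suc i)" for j l i
  proof -
    have QS: "Q \<otimes> elem_s [^] l = elem_s [^] l \<otimes> Q"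
    proof -
      have "elem_s \<otimes> Q = Q \<otimes> elem_s"
        unfolding Q_def by (metis elem_s_commute(2) elem_closed m_assoc)
      then show ?thesis by (metis closed(3) elem_closed(1) nat_pow_commute)
    qed
    have "R [^] Suc j \<otimes> (elem_s [^] l \<otimes> Q [^] i)
        = R [^] j \<otimes> ((elem_s \<otimes> elem_s \<oplus> (- (1 - t\<^sup>2)) \<odot> Q) \<otimes> (elem_s [^] l \<otimes> Q [^] i))"
      unfolding R[symmetric] by (simp add: m_assoc)
    also have "(elem_s \<otimes> elem_s \<oplus> (- (1 - t\<^sup>2)) \<odot> Q) \<otimes> (elem_s [^] l \<otimes> Q [^] i)
        = elem_s \<otimes> elem_s \<otimes> elem_s [^] l \<otimes> Q [^] i \<oplus> (- (1 - t\<^sup>2)) \<odot> (Q \<otimes> elem_s [^] l \<otimes> Q [^] i)"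
      by (simp add: l_distr smult_mult_left m_assoc)
    also have "elem_s \<otimes> elem_s \<otimes> elem_s [^] l = elem_s [^] (l + 2)"
      using nat_pow_mult[of elem_s 2 l] by (simp add: numeral_2_eq_2 add.commute)
    also have "Q \<otimes> elem_s [^] l \<otimes> Q [^] i = elem_s [^] l \<otimes> Q [^] Suc i"
      unfolding QS by (simp only: nat_pow_Suc2 closed) (simp add: m_assoc)
    finally show ?thesis
      by (simp add: T_def r_distr smult_mult_right h_simps del: nat_pow_Suc)
  qed
  have even_moment: "of_nat (n + 1) * h (elem_s [^] (n - 2 * j) \<otimes> R [^] j) = 2 ^ n * P j" if "2 * j \<le> n" for n j
  proof -
    have "h (elem_s [^] (n - 2 * j) \<otimes> R [^] j) = T j (n - 2 * j) 0"
      by (simp add: T_def SR)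
    also have "\<dots> = (\<Sum>i\<le>j. of_nat (j choose i) * (- (1 - t\<^sup>2)) ^ i * T 0 (n - 2 * j + 2 * (j - i)) (0 + i))"
      by (rule binomial_recursion[of T]) (rule T_rec)
    also have "of_nat (n + 1) * \<dots> = 2 ^ n * P j"
      unfolding P_def sum_distrib_left
    proof (intro sum.cong refl)
      fix i assume "i \<in> {..j}"
      then have n: "n - 2 * j + 2 * (j - i) + 2 * i = n" using that by auto
      have "T 0 (n - 2 * j + 2 * (j - i)) (0 + i) = (- 1) ^ i * ((- 1 / 2) gchoose i) * 2 ^ n / of_nat (n + 1)"
        using haar_elem_s_d_moments[of "n - 2 * j + 2 * (j - i)" i] unfolding n Q_def[symmetric] by (simp add: T_def)
      \<comment> \<open>The sign from expanding R cancels the sign in the moments of D, so the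
        coefficients of \<open>P\<close> are those of (1 + (1 - t^2) x) to the power -1/2.\<close>
      moreover have "(- (1 - t\<^sup>2)) ^ i * (- 1) ^ i = (1 - t\<^sup>2) ^ i"
        by (simp flip: power_mult_distrib)
      moreover have "of_nat (n + 1) \<noteq> (0 :: complex)" by (simp only: of_nat_eq_0_iff)
      moreover have "N * (b * k * (s * g * p / N)) = p * (b * (k * s) * g)" if "N \<noteq> 0" for N b k s g p :: complex
        using that by simp
      ultimately show "of_nat (n + 1) * (of_nat (j choose i) * (- (1 - t\<^sup>2)) ^ i * T 0 (n - 2 * j + 2 * (j - i)) (0 + i))
        = 2 ^ n * (of_nat (j choose i) * (1 - t\<^sup>2) ^ i * ((- 1 / 2) gchoose i))"
        by metis
    qed
    finally show ?thesis .
  qed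
  have moment: "of_nat (n + 1) * h (elem_s [^] (n - r) \<otimes> E [^] r) = (if even r then 2 ^ n * P (r div 2) else 0)"
    if "r \<le> n" for n r
  proof (cases "even r")
    case True
    then obtain j where r: "r = 2 * j" by (rule evenE)
    have "R [^] j = E [^] r"
      using nat_pow_pow[of E 2 j] by (simp add: r R_def numeral_2_eq_2)
    then show ?thesis using even_moment[of j n] that r by simp
  next
    case False
    \<comment> \<open>E is odd for the rotation about axis 1 while S is even, so an odd power of E
      makes the whole word odd.\<close>
    have E: "rotation_letter 1 2 (E, Some (elem_d \<oplus> t \<odot> elem_c))"
      unfolding E_def by (intro rotation_letter_add_odd rotation_letter_smult_odd rotation_letter_elem)
    let ?w = "replicate (n - r) (elem_s, None) @ replicate r (E, Some (elem_d \<oplus> t \<odot> elem_c))"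
    have count: "odd_count (replicate k (x, None) @ replicate r (x', Some y)) = r" for k x x' y
    proof -
      have "odd_count (replicate r (x', Some y)) = r" by (induction r) auto
      then show ?thesis by (induction k) auto
    qed
    have "h (word_value ?w) = 0"
      by (rule haar_parity[of 1 2]) (use E rotation_letter_elem(1) False count in auto)
    moreover have "word_value ?w = elem_s [^] (n - r) \<otimes> E [^] r"
      by (subst word_value_append) (auto simp: word_value_replicate letter_closed_def)
    ultimately show ?thesis using False by simp
  qed
  \<comment> \<open>Second use of the binomial theorem, now for V = S + E, with b = 1 and c =
    1.\<close>
  define W where "W k l i = h (V [^] k \<otimes> (elem_s [^] l \<otimes> E [^] i))" for k l i :: nat
  have W_rec: "W (Suc k) l i = W k (l + 1) i + 1 * W k l (Suc i)" for k l i
  proof -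
    have ES: "E \<otimes> elem_s [^] l = elem_s [^] l \<otimes> E"
      using SE by (metis closed(1) elem_closed(1) nat_pow_commute)
    have "V [^] Suc k \<otimes> (elem_s [^] l \<otimes> E [^] i)
        = V [^] k \<otimes> (elem_s \<otimes> elem_s [^] l \<otimes> E [^] i \<oplus> E \<otimes> elem_s [^] l \<otimes> E [^] i)"
      by (simp add: m_assoc V_def[symmetric]) (simp add: V_def l_distr)
    also have "elem_s \<otimes> elem_s [^] l = elem_s [^] (l + 1)"
      using nat_pow_Suc2[of elem_s l] by simp
    also have "E \<otimes> elem_s [^] l \<otimes> E [^] i = elem_s [^] l \<otimes> E [^] Suc i"
      unfolding ES by (simp only: nat_pow_Suc2 closed) (simp add: m_assoc)
    finally show ?thesis
      by (simp add: W_def r_distr h_simps del: nat_pow_Suc)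
  qed
  have "h (V [^] n) = W n 0 0" by (simp add: W_def)
  also have "\<dots> = (\<Sum>r\<le>n. of_nat (n choose r) * 1 ^ r * W 0 (0 + 1 * (n - r)) (0 + r))"
    by (rule binomial_recursion[of W]) (rule W_rec)
  finally have "of_nat (n + 1) * h (V [^] n)
      = (\<Sum>r\<le>n. of_nat (n choose r) * (of_nat (n + 1) * h (elem_s [^] (n - r) \<otimes> E [^] r)))"
    by (simp add: W_def sum_distrib_left mult.left_commute del: of_nat_add)
  also have "\<dots> = (\<Sum>r\<le>n. 2 ^ n * (of_nat (n choose r) * (if even r then P (r div 2) else 0)))"
    by (intro sum.cong refl) (subst moment; simp)
  also have "\<dots> = 2 ^ n * (\<Sum>r\<le>n. of_nat (n choose r) * (if even r then P (r div 2) else 0))"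
    by (simp only: sum_distrib_left)
  finally have V: "of_nat (n + 1) * h (V [^] n)
      = 2 ^ n * (\<Sum>r\<le>n. of_nat (n choose r) * (if even r then P (r div 2) else 0))" .
  have "((1/4) \<odot> V) [^] n = (1/4) ^ n \<odot> (V [^] n)"
    by (induction n) (simp_all add: smult_one smult_mult_left smult_mult_right smult_smult[symmetric] mult.commute)
  then have "of_nat (n + 1) * h (((1/4) \<odot> V) [^] n) = (1/4) ^ n * (of_nat (n + 1) * h (V [^] n))"
    by (simp add: h_simps)
  also have "\<dots> = (1/2) ^ n * (\<Sum>r\<le>n. of_nat (n choose r) * (if even r then P (r div 2) else 0))"
    unfolding V by (simp flip: power_mult_distrib mult.assoc)
  finally show ?thesis by (simp add: V_def E_def)
qed

end

section \<open>The generating function and the Cauchy transform\<close>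

text \<open>The geometric series 1 / (1 - X).\<close>

definition fps_ones :: "complex fps" where
  "fps_ones = Abs_fps (\<lambda>_. 1)"

lemma fps_ones_inverse: "(1 - fps_X) * fps_ones = 1"
  by (simp add: fps_eq_iff fps_ones_def algebra_simps)

text \<open>The expansion of X^r / (1 - X)^(r+1). Another factor 1 / (1 - X) forms partial sums, and
  the hockey-stick identity evaluates them.\<close>

lemma fps_ones_binomial: "fps_nth ((fps_X * fps_ones) ^ r * fps_ones) n = of_nat (n choose r)"
proof (induction r arbitrary: n)
  case 0
  then show ?case by (simp add: fps_ones_def)
next
  case (Suc r)
  have shift: "(fps_X * fps_ones) ^ Suc r * fps_ones = fps_X * (((fps_X * fps_ones) ^ r * fps_ones) * fps_ones)"
    by (simp add: mult_ac)
  then show ?case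
  proof (cases n)
    case 0
    then show ?thesis by (simp add: fps_mult_nth)
  next
    case (Suc k)
    have "fps_nth (((fps_X * fps_ones) ^ r * fps_ones) * fps_ones) k = (\<Sum>i\<le>k. of_nat (i choose r))"
      by (simp add: fps_mult_nth[of "(fps_X * fps_ones) ^ r * fps_ones"] Suc.IH atLeast0AtMost)
        (simp add: fps_ones_def)
    also have "\<dots> = of_nat (\<Sum>i\<le>k. i choose r)" by simp
    also have "\<dots> = of_nat (Suc k choose Suc r)" by (simp only: sum_choose_upper)
    finally show ?thesis
      unfolding Suc shift fps_X_mult_nth by (simp del: binomial_Suc_Suc)
  qed
qed

text \<open>Euler's transformation: the binomial transform of p has generating function p(X / (1 -
  X)) / (1 - X).\<close>

lemma binomial_transform_fps:
  "Abs_fps (\<lambda>n. \<Sum>r\<le>n. of_nat (n choose r) * fps_nth p r) = fps_ones * (p oo (fps_X * fps_ones))"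
proof (rule fps_ext)
  fix n
  let ?b = "fps_X * fps_ones"
  have "fps_nth (fps_ones * (p oo ?b)) n = (\<Sum>m\<le>n. (\<Sum>i\<le>m. fps_nth p i * fps_nth (?b ^ i) m) * fps_nth fps_ones (n - m))"
    by (subst mult.commute) (simp add: fps_mult_nth fps_compose_nth atLeast0AtMost)
  \<comment> \<open>The i-th power of the inner series starts in degree i, so the range of i can be
    made independent of m and the sums exchanged.\<close>
  also have "\<dots> = (\<Sum>m\<le>n. (\<Sum>i\<le>n. fps_nth p i * fps_nth (?b ^ i) m) * fps_nth fps_ones (n - m))"
  proof (intro sum.cong refl)
    fix m assume m: "m \<in> {..n}"
    have "fps_nth ?b 0 = 0" by simp
    then have "(\<Sum>i\<le>m. fps_nth p i * fps_nth (?b ^ i) m) = (\<Sum>i\<le>n. fps_nth p i * fps_nth (?b ^ i) m)"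
      using m startsby_zero_power_prefix[of ?b] by (intro sum.mono_neutral_left) auto
    then show "(\<Sum>i\<le>m. fps_nth p i * fps_nth (?b ^ i) m) * fps_nth fps_ones (n - m)
        = (\<Sum>i\<le>n. fps_nth p i * fps_nth (?b ^ i) m) * fps_nth fps_ones (n - m)"
      by simp
  qed
  also have "\<dots> = (\<Sum>i\<le>n. fps_nth p i * (\<Sum>m\<le>n. fps_nth (?b ^ i) m * fps_nth fps_ones (n - m)))"
    unfolding sum_distrib_left sum_distrib_right by (subst sum.swap) (simp add: mult.assoc)
  also have "\<dots> = (\<Sum>i\<le>n. of_nat (n choose i) * fps_nth p i)"
    by (intro sum.cong refl) (simp add: fps_ones_binomial[symmetric] fps_mult_nth atLeast0AtMost)
  finally show "fps_nth (Abs_fps (\<lambda>n. \<Sum>r\<le>n. of_nat (n choose r) * fps_nth p r)) n = fps_nth (fps_ones * (p oo ?b)) n"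
    by simp
qed

text \<open>A binomial transform of (1 + \<kappa> X) to the power -1/2 gives the series of
  \<open>P\<close>, substituting X^2 places it in the even degrees, and a second transform sums over
  r. Each operation acts on squares by a rational substitution, so the square of the result is
  rational.\<close>

lemma iterated_binomial_transform_square:
  fixes \<kappa> :: complex
  defines "P \<equiv> \<lambda>j. \<Sum>i\<le>j. of_nat (j choose i) * \<kappa> ^ i * ((- 1 / 2) gchoose i)"
  defines "F \<equiv> Abs_fps (\<lambda>n. (1/2) ^ n * (\<Sum>r\<le>n. of_nat (n choose r) * (if even r then P (r div 2) else 0)))"
  shows "F\<^sup>2 * ((1 - fps_X) * (1 - fps_X + fps_const (\<kappa> / 4) * fps_X\<^sup>2)) = (1 - fps_const (1/2) * fps_X)\<^sup>2"
proof -
  define w b where "w = fps_ones" and "b = fps_X * fps_ones"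
  have b0: "fps_nth b 0 = 0" by (simp add: b_def)
  have w: "(1 - fps_X) * w = 1" and b: "b = fps_X * w" by (simp_all add: w_def b_def fps_ones_inverse)
  have Xw: "(1 - fps_X) * b = fps_X" using w by (simp add: b mult.left_commute)
  define g where "g = (fps_binomial (- 1 / 2) :: complex fps)"
  have g: "g\<^sup>2 * (1 + fps_X) = 1"
  proof -
    have "g\<^sup>2 = inverse (1 + fps_X)"
      by (simp add: g_def power2_eq_square fps_binomial_add_mult[symmetric] fps_binomial_minus_one)
    then show ?thesis by (simp add: inverse_mult_eq_1)
  qed
  define g1 where "g1 = g oo (fps_const \<kappa> * fps_X)"
  have g1_nth: "fps_nth g1 i = \<kappa> ^ i * ((- 1 / 2) gchoose i)" for i
    by (simp add: g1_def g_def fps_compose_linear)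
  have g1: "g1\<^sup>2 * (1 + fps_const \<kappa> * fps_X) = 1"
    using arg_cong[OF g, of "\<lambda>f. f oo (fps_const \<kappa> * fps_X)"]
    by (simp add: g1_def fps_compose_mult_distrib fps_compose_power fps_compose_add_distrib)
  define p where "p = Abs_fps P"
  have p: "p = w * (g1 oo b)"
    unfolding p_def w_def b_def P_def binomial_transform_fps[symmetric]
    by (simp add: g1_nth mult.assoc)
  have g1b: "(g1 oo b)\<^sup>2 * (1 + fps_const \<kappa> * b) = 1"
    using arg_cong[OF g1, of "\<lambda>f. f oo b"] b0
    by (simp add: fps_compose_mult_distrib fps_compose_power fps_compose_add_distrib)
  have p_eq: "p\<^sup>2 * ((1 - fps_X) * (1 - fps_X + fps_const \<kappa> * fps_X)) = 1"
  proof -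
    have "p\<^sup>2 * ((1 - fps_X) * (1 - fps_X + fps_const \<kappa> * fps_X))
        = p\<^sup>2 * ((1 - fps_X) * ((1 - fps_X) * (1 + fps_const \<kappa> * b)))"
      using Xw by (simp add: ring_distribs(1) mult.left_commute)
    also have "\<dots> = ((1 - fps_X) * w)\<^sup>2 * ((g1 oo b)\<^sup>2 * (1 + fps_const \<kappa> * b))"
      by (simp only: p power2_eq_square mult_ac)
    also have "\<dots> = 1" by (simp add: w g1b)
    finally show ?thesis .
  qed
  define q where "q = p oo fps_X\<^sup>2"
  have q_nth: "fps_nth q r = (if even r then P (r div 2) else 0)" for r
  proof -
    have "fps_nth q r = (\<Sum>i\<le>r. P i * (if r = 2 * i then 1 else 0))"
      by (simp add: q_def fps_compose_nth p_def atLeast0AtMost fps_X_power_nth flip: power_mult)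
    also have "\<dots> = (\<Sum>i\<le>r. if i = r div 2 then if even r then P i else 0 else 0)"
      by (intro sum.cong refl) auto
    also have "\<dots> = (if even r then P (r div 2) else 0)"
      by (simp add: sum.delta)
    finally show ?thesis .
  qed
  have q_eq: "q\<^sup>2 * ((1 - fps_X\<^sup>2) * (1 - fps_X\<^sup>2 + fps_const \<kappa> * fps_X\<^sup>2)) = 1"
    using arg_cong[OF p_eq, of "\<lambda>f. f oo fps_X\<^sup>2"]
    by (simp add: q_def fps_compose_mult_distrib fps_compose_power fps_compose_add_distrib fps_compose_sub_distrib)
  have qb: "(q oo b)\<^sup>2 * ((1 - b\<^sup>2) * (1 - b\<^sup>2 + fps_const \<kappa> * b\<^sup>2)) = 1"
    using arg_cong[OF q_eq, of "\<lambda>f. f oo b"] b0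
    by (simp add: fps_compose_mult_distrib fps_compose_power[symmetric] fps_compose_add_distrib fps_compose_sub_distrib)
  define F0 where "F0 = Abs_fps (\<lambda>n. \<Sum>r\<le>n. of_nat (n choose r) * fps_nth q r)"
  have F0: "F0 = w * (q oo b)"
    unfolding F0_def w_def b_def by (rule binomial_transform_fps)
  have squares: "(1 - fps_X)\<^sup>2 * (1 - b\<^sup>2) = 1 - 2 * fps_X"
    "(1 - fps_X)\<^sup>2 * (1 - b\<^sup>2 + fps_const \<kappa> * b\<^sup>2) = 1 - 2 * fps_X + fps_const \<kappa> * fps_X\<^sup>2"
  proof -
    have "(1 - fps_X)\<^sup>2 * b\<^sup>2 = fps_X\<^sup>2" using Xw by (simp flip: power_mult_distrib)
    then have "(1 - fps_X)\<^sup>2 * (1 - b\<^sup>2) = (1 - fps_X)\<^sup>2 - fps_X\<^sup>2"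
      "(1 - fps_X)\<^sup>2 * (1 - b\<^sup>2 + fps_const \<kappa> * b\<^sup>2) = (1 - fps_X)\<^sup>2 - fps_X\<^sup>2 + fps_const \<kappa> * fps_X\<^sup>2"
      by (simp_all only: ring_distribs mult_1_right mult.left_commute[of _ "fps_const \<kappa>"])
    then show "(1 - fps_X)\<^sup>2 * (1 - b\<^sup>2) = 1 - 2 * fps_X"
      "(1 - fps_X)\<^sup>2 * (1 - b\<^sup>2 + fps_const \<kappa> * b\<^sup>2) = 1 - 2 * fps_X + fps_const \<kappa> * fps_X\<^sup>2"
      by (simp_all add: power2_eq_square algebra_simps)
  qed
  have F0_eq: "F0\<^sup>2 * ((1 - 2 * fps_X) * (1 - 2 * fps_X + fps_const \<kappa> * fps_X\<^sup>2)) = (1 - fps_X)\<^sup>2"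
  proof -
    have "F0\<^sup>2 * ((1 - 2 * fps_X) * (1 - 2 * fps_X + fps_const \<kappa> * fps_X\<^sup>2))
        = ((1 - fps_X) * w)\<^sup>2 * ((q oo b)\<^sup>2 * ((1 - b\<^sup>2) * (1 - b\<^sup>2 + fps_const \<kappa> * b\<^sup>2))) * (1 - fps_X)\<^sup>2"
      unfolding squares(2)[symmetric] unfolding squares(1)[symmetric] F0 by (simp only: power2_eq_square mult_ac)
    then show ?thesis by (simp add: w qb)
  qed
  \<comment> \<open>The weights (1/2)^n rescale X to X / 2; this turns \<kappa> into \<kappa> / 4
    and 1 - 2 X into 1 - X.\<close>
  let ?h = "fps_const (1/2) * fps_X :: complex fps"
  have F: "F = F0 oo ?h"
    unfolding F_def F0_def by (simp add: fps_compose_linear q_nth fps_eq_iff)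
  have const: "2 * fps_const (1/2) = (1 :: complex fps)"
    by (simp add: fps_eq_iff numeral_fps_const)
  have h: "2 * ?h = fps_X" "fps_const \<kappa> * ?h\<^sup>2 = fps_const (\<kappa> / 4) * fps_X\<^sup>2"
    using const by (simp_all add: power_mult_distrib mult.assoc[symmetric] power2_eq_square fps_const_mult[symmetric] del: fps_const_mult)
  have "(F0 oo ?h)\<^sup>2 * ((1 - 2 * ?h) * (1 - 2 * ?h + fps_const \<kappa> * ?h\<^sup>2)) = (1 - ?h)\<^sup>2"
    using arg_cong[OF F0_eq, of "\<lambda>f. f oo ?h"]
    by (simp add: fps_compose_mult_distrib fps_compose_power[symmetric] fps_compose_add_distrib fps_compose_sub_distrib)
  then show ?thesis unfolding h F .
qed

section \<open>From the moment series to the Cauchy transform\<close>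

text \<open>The geometric series of 1 / (\<xi> - y) is integrated term by term. Requiring 2 R
  instead of R leaves a ratio of 1/2 for the bound on the radius of convergence.\<close>

lemma cauchy_transform_eval_fps:
  fixes \<mu> :: "real measure"
  assumes "prob_space \<mu>" "sets \<mu> = sets borel" "AE y in \<mu>. \<bar>y\<bar> \<le> R" "0 < R" "2 * R < cmod \<xi>"
  defines "m \<equiv> \<lambda>k. complex_of_real (\<integral>y. y ^ k \<partial>\<mu>)"
  shows "cauchy_transform \<mu> \<xi> = eval_fps (fps_X * Abs_fps m) (1 / \<xi>)"
    and "ereal (1 / (2 * R)) \<le> fps_conv_radius (Abs_fps m)"
proof -
  interpret prob_space \<mu> by fact
  have meas [measurable]: "(\<lambda>y. y) \<in> borel_measurable \<mu>"
    using assms(2) by (rule measurable_ident_sets)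
  have int: "integrable \<mu> (\<lambda>y. y ^ k)" for k :: nat
  proof (rule integrable_const_bound)
    show "AE y in \<mu>. norm (y ^ k) \<le> R ^ k"
      using assms(3) by eventually_elim (simp add: power_abs power_mono)
  qed measurable
  have bound: "(\<integral>y. \<bar>y\<bar> ^ k \<partial>\<mu>) \<le> R ^ k" for k
  proof -
    have "(\<integral>y. \<bar>y\<bar> ^ k \<partial>\<mu>) \<le> (\<integral>y. R ^ k \<partial>\<mu>)"
    proof (rule integral_mono_AE)
      show "integrable \<mu> (\<lambda>y. \<bar>y\<bar> ^ k)"
        using integrable_norm[OF int[of k]] by (simp add: power_abs)
      show "AE y in \<mu>. \<bar>y\<bar> ^ k \<le> R ^ k"
        using assms(3) by eventually_elim (simp add: power_mono)
    qed simp
    then show ?thesis by (simp add: prob_space)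
  qed
  have m_bound: "cmod (m k) \<le> R ^ k" for k
    using integral_norm_bound[of \<mu> "\<lambda>y. y ^ k"] bound[of k] by (simp add: m_def norm_power power_abs)
  show radius: "ereal (1 / (2 * R)) \<le> fps_conv_radius (Abs_fps m)"
  proof -
    have "summable (\<lambda>k. m k * complex_of_real (1 / (2 * R)) ^ k)"
    proof (rule summable_comparison_test'[of "\<lambda>k. (1/2) ^ k" 0])
      fix k :: nat
      have "norm (m k * complex_of_real (1 / (2 * R)) ^ k) \<le> R ^ k * (1 / (2 * R)) ^ k"
        using m_bound[of k] assms(4) by (simp add: norm_mult norm_power norm_divide mult_right_mono)
      also have "\<dots> = (1/2) ^ k" using assms(4) by (simp flip: power_mult_distrib)
      finally show "norm (m k * complex_of_real (1 / (2 * R)) ^ k) \<le> (1/2) ^ k" .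
    qed (simp add: summable_geometric)
    from conv_radius_geI[OF this] show ?thesis
      using assms(4) by (simp add: fps_conv_radius_def norm_divide)
  qed
  have \<xi>: "\<xi> \<noteq> 0" using assms(4,5) by auto
  have "ereal (norm (1 / \<xi>)) < ereal (1 / (2 * R))"
    using assms(4,5) by (simp add: norm_divide frac_less2)
  then have in_radius: "ereal (norm (1 / \<xi>)) < fps_conv_radius (Abs_fps m)"
    using radius by (rule less_le_trans)
  define f where "f k y = complex_of_real (y ^ k) * (1 / \<xi>) ^ Suc k" for k :: nat and y :: real
  have ratio: "R / cmod \<xi> < 1" using assms(4,5) by (simp add: divide_less_eq)
  have int_f: "integrable \<mu> (f k)" for k
    unfolding f_def by (intro integrable_mult_left integrable_of_real int)
  have geo: "summable (\<lambda>k. (R / cmod \<xi>) ^ k * (1 / cmod \<xi>))"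
    using ratio assms(4) by (intro summable_mult2 summable_geometric) simp
  have "(\<lambda>k. integral\<^sup>L \<mu> (f k)) sums (\<integral>y. (\<Sum>k. f k y) \<partial>\<mu>)"
  proof (rule sums_integral[OF int_f])
    show "AE y in \<mu>. summable (\<lambda>k. norm (f k y))"
      using assms(3)
    proof eventually_elim
      case (elim y)
      have "norm (f k y) \<le> (R / cmod \<xi>) ^ k * (1 / cmod \<xi>)" for k
      proof -
        have "norm (f k y) = (\<bar>y\<bar> / cmod \<xi>) ^ k * (1 / cmod \<xi>)"
          by (simp add: f_def norm_mult norm_power norm_divide power_divide power_abs)
        also have "\<dots> \<le> (R / cmod \<xi>) ^ k * (1 / cmod \<xi>)"
          using elim by (intro mult_right_mono power_mono divide_right_mono) auto
        finally show ?thesis .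
      qed
      then show ?case by (intro summable_comparison_test'[OF geo, of 0]) simp
    qed
    show "summable (\<lambda>k. \<integral>y. norm (f k y) \<partial>\<mu>)"
    proof (rule summable_comparison_test'[OF geo, of 0])
      fix k
      have "(\<integral>y. norm (f k y) \<partial>\<mu>) = (\<integral>y. \<bar>y\<bar> ^ k \<partial>\<mu>) * (1 / cmod \<xi>) ^ Suc k"
        by (simp add: f_def norm_mult norm_power norm_divide power_abs)
      also have "\<dots> \<le> R ^ k * (1 / cmod \<xi>) ^ Suc k"
        by (intro mult_right_mono bound) simp
      also have "\<dots> = (R / cmod \<xi>) ^ k * (1 / cmod \<xi>)"
        by (simp add: power_divide)
      finally show "norm (\<integral>y. norm (f k y) \<partial>\<mu>) \<le> (R / cmod \<xi>) ^ k * (1 / cmod \<xi>)"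
        by (simp add: integral_nonneg_AE)
    qed
  qed
  moreover have "(\<integral>y. (\<Sum>k. f k y) \<partial>\<mu>) = cauchy_transform \<mu> \<xi>"
    unfolding cauchy_transform_def
  proof (rule integral_cong_AE)
    show "AE y in \<mu>. (\<Sum>k. f k y) = 1 / (\<xi> - complex_of_real y)"
      using assms(3)
    proof eventually_elim
      case (elim y)
      have "norm (complex_of_real y / \<xi>) < 1"
        using elim ratio \<xi> by (simp add: norm_divide divide_less_eq)
      from sums_mult2[OF geometric_sums[OF this], of "1 / \<xi>"]
      have "(\<lambda>k. f k y) sums (1 / (1 - complex_of_real y / \<xi>) * (1 / \<xi>))"
        by (simp add: f_def power_divide mult.commute)
      moreover have "1 / (1 - complex_of_real y / \<xi>) * (1 / \<xi>) = 1 / (\<xi> - complex_of_real y)"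
        using \<xi> by (simp add: field_simps)
      ultimately show ?case by (simp add: sums_iff)
    qed
    show "(\<lambda>y. \<Sum>k. f k y) \<in> borel_measurable \<mu>"
      unfolding f_def by measurable
  qed measurable
  moreover have "integral\<^sup>L \<mu> (f k) = 1 / \<xi> * (m k * (1 / \<xi>) ^ k)" for k
    unfolding f_def m_def integral_mult_left_zero integral_complex_of_real by simp
  ultimately have "cauchy_transform \<mu> \<xi> = (\<Sum>k. 1 / \<xi> * (m k * (1 / \<xi>) ^ k))"
    by (simp add: sums_iff)
  also have "\<dots> = 1 / \<xi> * eval_fps (Abs_fps m) (1 / \<xi>)"
    unfolding eval_fps_def
    by (subst suminf_mult) (use summable_fps[OF in_radius] in simp_all)
  also have "\<dots> = eval_fps (fps_X * Abs_fps m) (1 / \<xi>)"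
    by (subst eval_fps_mult) (use in_radius in simp_all)
  finally show "cauchy_transform \<mu> \<xi> = eval_fps (fps_X * Abs_fps m) (1 / \<xi>)" .
qed

text \<open>In z = 1 / \<xi> the transform is z M(z) with M the moment series, and the weights k + 1
  make \<open>F\<close> its derivative. Thus G'(\<xi>) = - z^2 F(z), and the identity for the square
  of \<open>F\<close> decides everything else. As R \<ge> 1, |z| stays below 1/2, away from the
  zeros of 1 - z and 1 - z/2.\<close>

lemma cauchy_transform_deriv_closed_form:
  fixes \<mu> :: "real measure" and t :: real
  assumes prob: "prob_space \<mu>" "sets \<mu> = sets borel" and support: "AE y in \<mu>. \<bar>y\<bar> \<le> R" "1 \<le> R"
    and moments: "\<And>k. of_nat (k + 1) * complex_of_real (\<integral>y. y ^ k \<partial>\<mu>) = fps_nth F k"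
    and F: "F\<^sup>2 * ((1 - fps_X) * (1 - fps_X + fps_const \<beta> * fps_X\<^sup>2)) = (1 - fps_const (1/2) * fps_X)\<^sup>2"
  shows "\<exists>s. s holomorphic_on {\<xi>. cmod \<xi> > 2 * R} \<and> (s \<longlongrightarrow> 1) at_infinity \<and>
           (\<forall>\<xi>. cmod \<xi> > 2 * R \<longrightarrow>
              \<xi> - \<xi>\<^sup>2 - \<beta> \<noteq> 0 \<and> \<xi>\<^sup>2 - \<xi> ^ 3 \<noteq> 0 \<and>
              (s \<xi>)\<^sup>2 = (\<xi> - \<xi>\<^sup>2) / (\<xi> - \<xi>\<^sup>2 - \<beta>) \<and>
              (cauchy_transform \<mu> has_field_derivative
                 1 / 2 * ((2 * \<xi> - 1) / (\<xi>\<^sup>2 - \<xi> ^ 3)) * s \<xi>) (at \<xi>))"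
proof -
  interpret prob_space \<mu> by fact
  define m where "m k = complex_of_real (\<integral>y. y ^ k \<partial>\<mu>)" for k :: nat
  define U where "U = {\<xi>. cmod \<xi> > 2 * R}"
  have U: "open U" unfolding U_def by (intro open_Collect_less continuous_intros)
  note cauchy = cauchy_transform_eval_fps[OF prob support(1), folded m_def]
  have "cmod (complex_of_real (2 * R + 1)) = 2 * R + 1"
    unfolding norm_of_real using support(2) by simp
  then have ex: "\<exists>\<xi>::complex. 2 * R < cmod \<xi>"
    by (intro exI[of _ "complex_of_real (2 * R + 1)"]) (simp only: less_add_one)
  then have radius_m: "ereal (1 / (2 * R)) \<le> fps_conv_radius (Abs_fps m)"
    using cauchy(2) support(2) by auto
  have radius_f: "ereal (1 / (2 * R)) \<le> fps_conv_radius (fps_X * Abs_fps m)"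
    using fps_conv_radius_mult[of fps_X "Abs_fps m"] radius_m by simp
  have F_deriv: "F = fps_deriv (fps_X * Abs_fps m)"
  proof (rule fps_ext)
    fix k
    show "fps_nth F k = fps_nth (fps_deriv (fps_X * Abs_fps m)) k"
      using moments[of k] unfolding m_def[symmetric] by (cases k) (simp_all add: algebra_simps)
  qed
  have radius_F: "ereal (1 / (2 * R)) \<le> fps_conv_radius F"
    using order_trans[OF radius_f fps_conv_radius_deriv] unfolding F_deriv .
  have small: "cmod (1 / \<xi>) < 1 / (2 * R)" "cmod (1 / \<xi>) < 1" "\<xi> \<noteq> 0" if "\<xi> \<in> U" for \<xi>
  proof -
    show "\<xi> \<noteq> 0" using that support(2) by (auto simp: U_def)
    show "cmod (1 / \<xi>) < 1 / (2 * R)"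
      using that support(2) by (simp add: U_def norm_divide frac_less2)
    moreover have "1 / (2 * R) \<le> 1" using support(2) by (simp add: divide_le_eq)
    ultimately show "cmod (1 / \<xi>) < 1" by simp
  qed
  then have in_radius: "ereal (cmod (1 / \<xi>)) < fps_conv_radius F"
    "ereal (cmod (1 / \<xi>)) < fps_conv_radius (fps_X * Abs_fps m)" if "\<xi> \<in> U" for \<xi>
    using that radius_F radius_f by (meson ereal_less(2) less_ereal.simps(1) less_le_trans)+
  \<comment> \<open>Obtained by solving the asserted formula for the root. Holomorphy comes from the
    power series, and the value 1 at infinity is F(0), the total mass.\<close>
  define s where "s \<xi> = eval_fps F (1 / \<xi>) * (1 - 1 / \<xi>) / (1 - 1 / \<xi> / 2)" for \<xi>
  have half: "1 - z / 2 \<noteq> 0" "1 - z \<noteq> 0" if "cmod z < 1" for z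
    using that by (auto simp: field_simps)
  have square: "(eval_fps F z)\<^sup>2 * ((1 - z) * (1 - z + \<beta> * z\<^sup>2)) = (1 - z / 2)\<^sup>2"
    if "ereal (cmod z) < fps_conv_radius F" for z
  proof -
    define p q :: "complex fps"
      where "p = fps_of_poly ([:1, -1:] * [:1, -1, \<beta>:])" and "q = fps_of_poly ([:1, -1/2:]\<^sup>2)"
    have p: "(1 - fps_X) * (1 - fps_X + fps_const \<beta> * fps_X\<^sup>2) = p"
      unfolding p_def by (simp add: fps_of_poly_mult fps_of_poly_pCons algebra_simps power2_eq_square)
    have q: "(1 - fps_const (1/2) * fps_X)\<^sup>2 = q"
      unfolding q_def by (simp add: fps_of_poly_power fps_of_poly_pCons algebra_simps fps_const_neg[symmetric] del: fps_const_neg)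
    have "eval_fps (F\<^sup>2 * p) z = (eval_fps F z)\<^sup>2 * eval_fps p z"
      using that fps_conv_radius_power[of F 2]
      by (subst eval_fps_mult) (auto simp: eval_fps_power p_def intro: less_le_trans)
    then have "(eval_fps F z)\<^sup>2 * eval_fps p z = eval_fps q z" using F by (simp add: p q)
    then show ?thesis by (simp add: p_def q_def algebra_simps power2_eq_square)
  qed
  have hol: "s holomorphic_on U"
  proof -
    have "(\<lambda>\<xi>. eval_fps F (1 / \<xi>)) holomorphic_on U"
    proof (rule holomorphic_on_compose_gen[unfolded o_def, of "\<lambda>\<xi>. 1 / \<xi>" _ "eval_fps F" "eball 0 (fps_conv_radius F)"])
      show "(\<lambda>\<xi>. 1 / \<xi>) holomorphic_on U" using small(3) by (intro holomorphic_intros) auto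
      show "eval_fps F holomorphic_on eball 0 (fps_conv_radius F)" by (intro holomorphic_on_eval_fps) simp
      show "(\<lambda>\<xi>. 1 / \<xi>) ` U \<subseteq> eball 0 (fps_conv_radius F)" using in_radius(1) by auto
    qed
    moreover have "(\<lambda>\<xi>. 1 / \<xi>) holomorphic_on U"
      using small(3) by (intro holomorphic_intros) auto
    moreover have "1 - 1 / \<xi> / 2 \<noteq> 0" if "\<xi> \<in> U" for \<xi>
      using half(1)[OF small(2)[OF that]] .
    ultimately have "(\<lambda>\<xi>. eval_fps F (1 / \<xi>) * (1 - 1 / \<xi>) / (1 - 1 / \<xi> / 2)) holomorphic_on U"
      by (rule_tac holomorphic_on_divide[OF holomorphic_on_mult holomorphic_on_diff[OF _ holomorphic_on_divide]])
        (auto intro!: holomorphic_on_diff)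
    then show ?thesis by (simp only: s_def[abs_def])
  qed
  have limit: "(s \<longlongrightarrow> 1) at_infinity"
  proof -
    have "fps_nth F 0 = 1" using moments[of 0] by (simp add: prob_space)
    moreover have "0 < 1 / (2 * R)" using support(2) by simp
    then have "0 < fps_conv_radius F" using radius_F by (metis ereal_less(2) less_le_trans)
    then have "isCont (eval_fps F) 0" by (intro continuous_eval_fps) (auto simp: zero_ereal_def)
    ultimately have "(eval_fps F \<longlongrightarrow> 1) (at 0)" by (simp add: isCont_def eval_fps_at_0)
    then have "((\<lambda>z. eval_fps F z * (1 - z) / (1 - z / 2)) \<longlongrightarrow> 1 * (1 - 0) / (1 - 0 / 2)) (at 0)"
      by (intro tendsto_intros) auto
    then show ?thesis
      unfolding lim_at_infinity_0 s_def by (simp add: o_def inverse_eq_divide)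
  qed
  have main: "\<xi> - \<xi>\<^sup>2 - \<beta> \<noteq> 0 \<and> \<xi>\<^sup>2 - \<xi> ^ 3 \<noteq> 0 \<and>
      (s \<xi>)\<^sup>2 = (\<xi> - \<xi>\<^sup>2) / (\<xi> - \<xi>\<^sup>2 - \<beta>) \<and>
      (cauchy_transform \<mu> has_field_derivative 1 / 2 * ((2 * \<xi> - 1) / (\<xi>\<^sup>2 - \<xi> ^ 3)) * s \<xi>) (at \<xi>)"
    if \<xi>: "\<xi> \<in> U" for \<xi>
  proof -
    define z where "z = 1 / \<xi>"
    have z: "cmod z < 1" "z \<noteq> 0" "\<xi> = 1 / z" using small[OF \<xi>] by (auto simp: z_def)
    have z_nz: "1 - z / 2 \<noteq> 0" "1 - z \<noteq> 0" using half[OF z(1)] by auto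
    have sq: "(eval_fps F z)\<^sup>2 * ((1 - z) * (1 - z + \<beta> * z\<^sup>2)) = (1 - z / 2)\<^sup>2"
      using square in_radius(1)[OF \<xi>] by (simp add: z_def)
    \<comment> \<open>The denominator under the root cannot vanish, because the right-hand side of
      \<open>sq\<close> does not.\<close>
    then have nz: "1 - z + \<beta> * z\<^sup>2 \<noteq> 0" using z_nz by auto
    have e1: "\<xi> - \<xi>\<^sup>2 - \<beta> = - (1 - z + \<beta> * z\<^sup>2) / z\<^sup>2" and e2: "\<xi> - \<xi>\<^sup>2 = - (1 - z) / z\<^sup>2"
      and e3: "\<xi>\<^sup>2 - \<xi> ^ 3 = - (1 - z) / z ^ 3" and e4: "2 * \<xi> - 1 = 2 * (1 - z / 2) / z"
      using z(2) unfolding z(3) by (simp_all add: field_simps power2_eq_square power3_eq_cube)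
    have s: "s \<xi> = eval_fps F z * (1 - z) / (1 - z / 2)" by (simp add: s_def z_def)
    have "(s \<xi>)\<^sup>2 * (1 - z + \<beta> * z\<^sup>2) * (1 - z / 2)\<^sup>2
        = (1 - z) * ((eval_fps F z)\<^sup>2 * ((1 - z) * (1 - z + \<beta> * z\<^sup>2)))"
      using z_nz(1) unfolding s power_divide power_mult_distrib by (simp add: power2_eq_square mult_ac)
    then have "(s \<xi>)\<^sup>2 * (1 - z + \<beta> * z\<^sup>2) = 1 - z"
      using z_nz(1) unfolding sq by simp
    then have "(s \<xi>)\<^sup>2 = (1 - z) / (1 - z + \<beta> * z\<^sup>2)" using nz by (simp add: field_simps)
    also have "\<dots> = (\<xi> - \<xi>\<^sup>2) / (\<xi> - \<xi>\<^sup>2 - \<beta>)"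
    proof -
      have "(- x / z\<^sup>2) / (- y / z\<^sup>2) = x / y" for x y :: complex
        using z(2) by simp
      then show ?thesis by (simp only: e1) (simp only: e2)
    qed
    finally have s2: "(s \<xi>)\<^sup>2 = (\<xi> - \<xi>\<^sup>2) / (\<xi> - \<xi>\<^sup>2 - \<beta>)" .
    have inv: "((\<lambda>\<xi>. 1 / \<xi>) has_field_derivative - (z\<^sup>2)) (at \<xi>)"
      using small(3)[OF \<xi>] by (auto intro!: derivative_eq_intros simp: z_def power2_eq_square)
    have "((\<lambda>\<xi>. eval_fps (fps_X * Abs_fps m) (1 / \<xi>)) has_field_derivative
        eval_fps F (1 / \<xi>) * - (z\<^sup>2)) (at \<xi>)"
      unfolding F_deriv
      by (rule DERIV_chain2[OF has_field_derivative_eval_fps inv]) (rule in_radius(2)[OF \<xi>])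
    then have "(cauchy_transform \<mu> has_field_derivative eval_fps F (1 / \<xi>) * - (z\<^sup>2)) (at \<xi>)"
    proof (rule has_field_derivative_transform_within_open[OF _ U \<xi>])
      fix \<zeta> assume "\<zeta> \<in> U"
      then show "eval_fps (fps_X * Abs_fps m) (1 / \<zeta>) = cauchy_transform \<mu> \<zeta>"
        using cauchy(1)[of \<zeta>] support(2) by (simp add: U_def)
    qed
    also have "eval_fps F (1 / \<xi>) * - (z\<^sup>2) = 1 / 2 * ((2 * \<xi> - 1) / (\<xi>\<^sup>2 - \<xi> ^ 3)) * s \<xi>"
    proof -
      have "f * - (z\<^sup>2) = 1 / 2 * ((2 * x / z) / (- y / z ^ 3)) * (f * y / x)"
        if "x \<noteq> 0" "y \<noteq> 0" for f x y :: complex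
        using z(2) that by (simp add: power2_eq_square power3_eq_cube)
      from this[OF z_nz] show ?thesis unfolding e3 e4 s z_def[symmetric] .
    qed
    finally have deriv: "(cauchy_transform \<mu> has_field_derivative
        1 / 2 * ((2 * \<xi> - 1) / (\<xi>\<^sup>2 - \<xi> ^ 3)) * s \<xi>) (at \<xi>)" .
    have "\<xi> - \<xi>\<^sup>2 - \<beta> \<noteq> 0" "\<xi>\<^sup>2 - \<xi> ^ 3 \<noteq> 0"
      unfolding e1 e3 divide_eq_0_iff neg_equal_0_iff_equal using z(2) z_nz(2) nz by auto
    with s2 deriv show ?thesis by blast
  qed
  show ?thesis
    using hol limit main unfolding U_def by auto
qed

text \<open>The root appears as a holomorphic function \<open>s\<close> with prescribed square and
  limit 1. On the connected exterior of a disc, where the prescribed square has no zero, these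
  properties determine \<open>s\<close>.\<close>

theorem theorem8p1:
  fixes A :: "'a cstar_struct" and u :: "nat \<Rightarrow> nat \<Rightarrow> 'a"
    and C :: "'c cstar_struct" and \<tau> :: "'a \<Rightarrow> 'a \<Rightarrow> 'c" and \<Delta> :: "'a \<Rightarrow> 'c"
    and h :: "'a \<Rightarrow> complex" and t :: real and v :: 'a and \<mu> :: "real measure"
  assumes "is_A_s 4 A u"
    and "min_cstar_tensor A A C \<tau>"
    and "comultiplication 4 A u C \<tau> \<Delta>"
    and "haar_functional A C \<tau> \<Delta> h"
    and "v = complex_of_real ((1 + t) / 4) \<odot>\<^bsub>A\<^esub> (u 1 1 \<oplus>\<^bsub>A\<^esub> u 2 2)
             \<oplus>\<^bsub>A\<^esub> complex_of_real ((1 - t) / 4) \<odot>\<^bsub>A\<^esub> (u 3 3 \<oplus>\<^bsub>A\<^esub> u 4 4)"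
    and "is_law A h v \<mu>"
  shows "\<exists>r>0. \<exists>s. s holomorphic_on {\<xi>. cmod \<xi> > r} \<and> (s \<longlongrightarrow> 1) at_infinity \<and>
           (\<forall>\<xi>. cmod \<xi> > r \<longrightarrow>
              \<xi> - \<xi>\<^sup>2 - complex_of_real ((1 - t\<^sup>2) / 4) \<noteq> 0 \<and> \<xi>\<^sup>2 - \<xi> ^ 3 \<noteq> 0 \<and>
              (s \<xi>)\<^sup>2 = (\<xi> - \<xi>\<^sup>2) / (\<xi> - \<xi>\<^sup>2 - complex_of_real ((1 - t\<^sup>2) / 4)) \<and>
              (cauchy_transform \<mu> has_field_derivative
                 1 / 2 * ((2 * \<xi> - 1) / (\<xi>\<^sup>2 - \<xi> ^ 3)) * s \<xi>) (at \<xi>))"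
proof -
  have cstar: "cstar_algebra A" and magic: "magic_unitary 4 A u"
    using assms(1) by (simp_all add: is_A_s_def)
  have tensor: "cstar_tensor A A C \<tau>" using assms(2) by (simp add: min_cstar_tensor_def)
  note tensor = tensor[unfolded cstar_tensor_def]
  have state: "state A h" using assms(4) by (simp add: haar_functional_def)
  from assms(4) obtain L where L: "bounded_linear_map C A L"
    "\<forall>a\<in>carrier A. \<forall>b\<in>carrier A. L (\<tau> a b) = h a \<odot>\<^bsub>A\<^esub> b"
    "\<forall>x\<in>carrier A. L (\<Delta> x) = h x \<odot>\<^bsub>A\<^esub> \<one>\<^bsub>A\<^esub>"
    unfolding haar_functional_def by (elim conjE exE)
  interpret A: cstar_algebra A by fact
  interpret C: cstar_algebra C using tensor by simp
  interpret haar_4 A u C \<tau> \<Delta> h L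
  proof unfold_locales
    show "linear_functional A h" using state by (simp add: state_def linear_functional_def)
    show "h \<one>\<^bsub>A\<^esub> = 1" using state by (simp add: state_def)
    show "is_A_s 4 A u" by fact
    show "unital_star_hom A C \<Delta>" using assms(3) by (simp add: comultiplication_def)
    show "\<Delta> (u i j) = (\<Oplus>\<^bsub>C\<^esub>k\<in>{1..4}. \<tau> (u i k) (u k j))" if "i \<in> {1..4}" "j \<in> {1..4}" for i j
      using assms(3) that unfolding comultiplication_def by blast
  qed (use magic tensor L in \<open>simp_all add: bounded_linear_map_def\<close>)
  define F where "F = Abs_fps (\<lambda>n. (1/2) ^ n * (\<Sum>r\<le>n. of_nat (n choose r) * (if even r
    then (\<Sum>i\<le>r div 2. of_nat (r div 2 choose i) * (1 - (complex_of_real t)\<^sup>2) ^ i * ((- 1 / 2) gchoose i)) else 0)))"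
  have law: "prob_space \<mu>" "sets \<mu> = sets borel" "\<exists>K. compact K \<and> (AE y in \<mu>. y \<in> K)"
    and moments: "\<And>k. complex_of_real (\<integral>y. y ^ k \<partial>\<mu>) = h (v [^]\<^bsub>A\<^esub> k)"
    using assms(6) by (simp_all add: is_law_def)
  from law(3) obtain K where K: "compact K" "AE y in \<mu>. y \<in> K" by blast
  from compact_imp_bounded[OF K(1)] obtain B where B: "\<And>y. y \<in> K \<Longrightarrow> \<bar>y\<bar> \<le> B"
    by (auto simp: bounded_iff)
  \<comment> \<open>The lower bound 1 keeps |1 / \<xi>| below 1/2 on the domain |\<xi>| > 2
    R.\<close>
  define R where "R = max 1 B"
  have support: "AE y in \<mu>. \<bar>y\<bar> \<le> R" "1 \<le> R"
    using K(2) by (auto simp: R_def dest!: B elim!: eventually_mono)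
  have v: "v = (1/4) \<odot>\<^bsub>A\<^esub> (elem_s \<oplus>\<^bsub>A\<^esub> (elem_c \<oplus>\<^bsub>A\<^esub> complex_of_real t \<odot>\<^bsub>A\<^esub> elem_d))"
    unfolding assms(5) by (rule diagonal_combination)
  have F_moments: "of_nat (k + 1) * complex_of_real (\<integral>y. y ^ k \<partial>\<mu>) = fps_nth F k" for k
    unfolding moments v haar_moments by (simp add: F_def)
  have "F\<^sup>2 * ((1 - fps_X) * (1 - fps_X + fps_const ((1 - (complex_of_real t)\<^sup>2) / 4) * fps_X\<^sup>2))
      = (1 - fps_const (1/2) * fps_X)\<^sup>2"
    unfolding F_def by (rule iterated_binomial_transform_square)
  moreover have "(1 - (complex_of_real t)\<^sup>2) / 4 = complex_of_real ((1 - t\<^sup>2) / 4)" by simp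
  ultimately have F: "F\<^sup>2 * ((1 - fps_X) * (1 - fps_X + fps_const (complex_of_real ((1 - t\<^sup>2) / 4)) * fps_X\<^sup>2))
      = (1 - fps_const (1/2) * fps_X)\<^sup>2"
    by (simp only:)
  show ?thesis
    using support(2)
    by (intro exI[of _ "2 * R"] conjI cauchy_transform_deriv_closed_form[OF law(1,2) support F_moments F]) simp
qed

end
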